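(* Let $S\ge 1$ be an integer, let $\boldsymbol{x}_1,\boldsymbol{x}_2,\dots$ be i.i.d. with density $f>0$ on the support $[0,\mathscr{U})$ (where $\mathscr{U}$ may be infinite), and write $L=\log f$ and $\beta_s=L^{(s)}(x)$. Let $\hat{\boldsymbol f}(x)$ be the density estimator at the point $x$ with bandwidth $h=h_n>0$ defined in the context. Assume that $L$ is $S+1$ times continuously differentiable in a neighborhood of $x$, that $f(x)>0$, and that $$0\le \Xi_f^2=\lim_{n\to\infty}nh^{2S+3}<\infty .$$ Then $$\sqrt{nh}\,\{\hat{\boldsymbol f}(x)-f(x)\}\ \xrightarrow{d}\ N(\mathscr B,\mathscr V),$$ where $$\mathscr B=f(x)\,\beta_{S+1}\,\Xi_f\,\frac{1}{(S+1)!}\int_{-z}^1\omega_z(t)\,t^{S+1}\,dt=f(x)\,\beta_{S+1}\,\Xi_f\,\big(c_{m,S+1,z}-c_{mz}^\top b\big),\qquad \mathscr V=f(x)\int_{-z}^1\omega_z^2(t)\,dt .$$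
   Context: Evaluation point: $z=\min(x/h,1)$. The point $x$ may be fixed, and the case $x=zh$ (a point approaching or equal to the boundary $0$ of the support) is also allowed; in that case $f(x)$ and $\beta_{S+1}$ in $\mathscr B,\mathscr V$ are understood as their limiting values. Functions: $g=(g_1,\dots,g_S)^\top:\mathbb R\to\mathbb R^S$ is a chosen function with support $[-z,1]$, differentiable there with derivative $g'$ (and $g'=0$ outside $[-z,1]$), satisfying $g(-z)=g(1)=0$; a leading example is, up to an irrelevant sign, $g_j(t)=(t+z)^j(1-t)\,\mathbb 1(-z\le t\le 1)$. The kernel $m_z$ is nonnegative with support $[-z,1]$ and $\int_{-z}^1 m_z(t)\,dt=1$. First step: $\hat{\boldsymbol\beta}=(\hat{\boldsymbol\beta}_1,\dots,\hat{\boldsymbol\beta}_S)^\top$ is the solution of the linear system $$\frac1{nh^2}\sum_{i=1}^n g'\Big(\frac{\boldsymbol x_i-x}{h}\Big)=-\sum_{s=1}^S\hat{\boldsymbol\beta}_s\,\frac1{nh}\sum_{i=1}^n g\Big(\frac{\boldsymbol x_i-x}{h}\Big)\frac{(\boldsymbol x_i-x)^{s-1}}{(s-1)!}.$$ Density estimator: $$\hat{\boldsymbol f}(x)=\frac{\frac1{nh}\sum_{i=1}^n m_z\big(\frac{\boldsymbol x_i-x}{h}\big)}{\int_{-z}^1 m_z(t)\exp\big(\sum_{s=1}^S\hat{\boldsymbol\beta}_s t^sh^s/s!\big)\,dt}.$$ Constants: $\Omega_{js}=-\frac1{(s-1)!}\int_{-z}^1 g_j(t)t^{s-1}\,dt$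 for $j,s\ge1$; $\Omega=(\Omega_{js})_{j,s=1}^S$, which is invertible; $b=\Omega^{-1}(\Omega_{1,S+1},\dots,\Omega_{S,S+1})^\top$; $c_{msz}=\frac1{s!}\int_{-z}^1 m_z(t)t^s\,dt$; $c_{mz}=(c_{m1z},\dots,c_{mSz})^\top$; $\omega_z(t)=m_z(t)-c_{mz}^\top\Omega^{-1}g'(t)$.
   Formalization: The formal theorem additionally assumes nh → ∞ (without it the claim fails, e.g. h = 1/n) and that m_z and each g_j' are square integrable on [-z,1] (so that the variance V is finite). *)

theory Defs
  imports
    "HOL-Probability.Probability"
    "Jordan_Normal_Form.Gauss_Jordan_Elimination"
begin

text \<open>
  Iterated derivatives are taken relative to a set A (the support of the density): at
  interior points of A they are the ordinary derivatives, at a boundary point the one-sided ones.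
\<close>

primrec nderiv_within :: "real set \<Rightarrow> nat \<Rightarrow> (real \<Rightarrow> real) \<Rightarrow> real \<Rightarrow> real" where
  "nderiv_within A 0 F = F"
| "nderiv_within A (Suc k) F = (\<lambda>y. vector_derivative (nderiv_within A k F) (at y within A))"

definition cont_differentiable_near :: "real set \<Rightarrow> nat \<Rightarrow> (real \<Rightarrow> real) \<Rightarrow> real \<Rightarrow> bool" where
  "cont_differentiable_near A k F x \<longleftrightarrow>
     (\<exists>\<delta>>0. (\<forall>j<k. \<forall>y\<in>A \<inter> ball x \<delta>. nderiv_within A j F differentiable (at y within A)) \<and>
            continuous_on (A \<inter> ball x \<delta>) (nderiv_within A k F))"

definition edge_ratio :: "real \<Rightarrow> real \<Rightarrow> real" where
  "edge_ratio x h = min (x / h) 1"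


text \<open>
  The estimator, computed from data y 1, ..., y n. The functions g and g' take the component
  index j in 1..S as first argument.
\<close>

definition score_lhs :: "(nat \<Rightarrow> real \<Rightarrow> real) \<Rightarrow> nat \<Rightarrow> real \<Rightarrow> real \<Rightarrow> (nat \<Rightarrow> real) \<Rightarrow> nat \<Rightarrow> real" where
  "score_lhs g' n h x y j = 1 / (real n * h ^ 2) * (\<Sum>i=1..n. g' j ((y i - x) / h))"

definition score_coeff ::
  "(nat \<Rightarrow> real \<Rightarrow> real) \<Rightarrow> nat \<Rightarrow> real \<Rightarrow> real \<Rightarrow> (nat \<Rightarrow> real) \<Rightarrow> nat \<Rightarrow> nat \<Rightarrow> real" where
  "score_coeff g n h x y j s =
     1 / (real n * h) * (\<Sum>i=1..n. g j ((y i - x) / h) * ((y i - x) ^ (s - 1) / fact (s - 1)))"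

text \<open>Matrices and vectors are indexed from 0, so entry (j, s) belongs to the pair (j + 1, s + 1).\<close>

definition score_mat ::
  "nat \<Rightarrow> (nat \<Rightarrow> real \<Rightarrow> real) \<Rightarrow> nat \<Rightarrow> real \<Rightarrow> real \<Rightarrow> (nat \<Rightarrow> real) \<Rightarrow> real mat" where
  "score_mat S g n h x y = Matrix.mat S S (\<lambda>(j, s). score_coeff g n h x y (j + 1) (s + 1))"

definition solves_score_system ::
  "nat \<Rightarrow> (nat \<Rightarrow> real \<Rightarrow> real) \<Rightarrow> (nat \<Rightarrow> real \<Rightarrow> real) \<Rightarrow> nat \<Rightarrow> real \<Rightarrow> real \<Rightarrow> (nat \<Rightarrow> real)
     \<Rightarrow> (nat \<Rightarrow> real) \<Rightarrow> bool" where
  "solves_score_system S g g' n h x y \<beta> \<longleftrightarrow>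
     (\<forall>j\<in>{1..S}. score_lhs g' n h x y j = - (\<Sum>s=1..S. \<beta> s * score_coeff g n h x y j s))"

definition density_est ::
  "nat \<Rightarrow> real \<Rightarrow> (real \<Rightarrow> real) \<Rightarrow> nat \<Rightarrow> real \<Rightarrow> real \<Rightarrow> (nat \<Rightarrow> real) \<Rightarrow> (nat \<Rightarrow> real) \<Rightarrow> real" where
  "density_est S z m n h x y \<beta> =
     (1 / (real n * h) * (\<Sum>i=1..n. m ((y i - x) / h))) /
     (LINT t:{-z..1}|lborel. m t * exp (\<Sum>s=1..S. \<beta> s * t ^ s * h ^ s / fact s))"


definition Omega :: "real \<Rightarrow> (nat \<Rightarrow> real \<Rightarrow> real) \<Rightarrow> nat \<Rightarrow> nat \<Rightarrow> real" where
  "Omega z g j s = - (1 / fact (s - 1)) * (LINT t:{-z..1}|lborel. g j t * t ^ (s - 1))"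

definition Omega_mat :: "nat \<Rightarrow> real \<Rightarrow> (nat \<Rightarrow> real \<Rightarrow> real) \<Rightarrow> real mat" where
  "Omega_mat S z g = Matrix.mat S S (\<lambda>(j, s). Omega z g (j + 1) (s + 1))"

text \<open>Unspecified if the matrix is singular.\<close>

definition Omega_inv :: "nat \<Rightarrow> real \<Rightarrow> (nat \<Rightarrow> real \<Rightarrow> real) \<Rightarrow> real mat" where
  "Omega_inv S z g = the (mat_inverse (Omega_mat S z g))"

definition b_vec :: "nat \<Rightarrow> real \<Rightarrow> (nat \<Rightarrow> real \<Rightarrow> real) \<Rightarrow> real Matrix.vec" where
  "b_vec S z g = Omega_inv S z g *\<^sub>v Matrix.vec S (\<lambda>j. Omega z g (j + 1) (S + 1))"

definition c_const :: "(real \<Rightarrow> real) \<Rightarrow> nat \<Rightarrow> real \<Rightarrow> real" where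
  "c_const m s z = 1 / fact s * (LINT t:{-z..1}|lborel. m t * t ^ s)"

definition c_vec :: "nat \<Rightarrow> (real \<Rightarrow> real) \<Rightarrow> real \<Rightarrow> real Matrix.vec" where
  "c_vec S m z = Matrix.vec S (\<lambda>s. c_const m (s + 1) z)"

definition omega_fun ::
  "nat \<Rightarrow> real \<Rightarrow> (nat \<Rightarrow> real \<Rightarrow> real) \<Rightarrow> (nat \<Rightarrow> real \<Rightarrow> real) \<Rightarrow> (real \<Rightarrow> real) \<Rightarrow> real \<Rightarrow> real" where
  "omega_fun S z g g' m t =
     m t - Matrix.scalar_prod (c_vec S m z) (Omega_inv S z g *\<^sub>v Matrix.vec S (\<lambda>j. g' (j + 1) t))"

text \<open>
  For a convergent sequence of evaluation points x n, the numbers f(x) and L^(S+1)(x) in the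
  limit law are the limits of f and of the (S+1)-st derivative of ln f along that sequence;
  for a constant sequence these are the values at the point.
\<close>

definition limit_density :: "(real \<Rightarrow> real) \<Rightarrow> (nat \<Rightarrow> real) \<Rightarrow> real" where
  "limit_density f x = lim (\<lambda>n. f (x n))"

definition limit_log_deriv :: "real set \<Rightarrow> nat \<Rightarrow> (real \<Rightarrow> real) \<Rightarrow> (nat \<Rightarrow> real) \<Rightarrow> real" where
  "limit_log_deriv A k f x = lim (\<lambda>n. nderiv_within A k (\<lambda>y. ln (f y)) (x n))"

end

theory Submission
  imports Defs "Jordan_Normal_Form.Determinant"
begin

text \<open>
  Rescale the first-step estimator to \<open>T\<^sub>s = h\<^sup>s \<beta>hat\<^sub>s\<close>. Integration by parts shows that
  \<open>\<gamma>\<^sub>s = h\<^sup>s L\<^sup>(\<^sup>s\<^sup>)(x)\<close> solves the expected score system up to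
  \<open>h\<^sup>S\<^sup>+\<^sup>1 f(x) L\<^sup>(\<^sup>S\<^sup>+\<^sup>1\<^sup>)(x) \<Omega>\<^sub>j\<^sub>,\<^sub>S\<^sub>+\<^sub>1\<close>, and the random coefficient matrix converges in probability to
  \<open>f(x) \<Omega>\<close>. Hence \<open>f(x) \<Omega> (T - \<gamma>)\<close> equals this bias plus the centred average of \<open>g'\<close>, up to
  \<open>o\<^sub>P(1 / sqrt (n h))\<close>. Linearising numerator and denominator of the density estimator in
  \<open>T - \<gamma>\<close> leaves the bias \<open>B\<close> plus the centred average of \<open>\<omega>\<close>. The latter is asymptotically normal
  by a Lindeberg-type argument with characteristic functions, which needs nothing beyond square
  integrability of \<open>\<omega>\<close>, and Slutsky's lemma concludes. The variance is positive because \<open>\<omega>\<close>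
  integrates to 1.
\<close>

section \<open>Convergence in probability\<close>

text \<open>Three features shape the argument. The evaluation point may move with n and the kernels
  are only square integrable, so the summands form a triangular array without third moments. The
  vector \<open>\<beta>hat\<close> is known to solve the system only where the random matrix is
  invertible and is arbitrary elsewhere, so stochastic statements are made outside events of small
  probability. Finally, the bias has order h^(S+1), while the terms \<open>h^s L^(s)(x)\<close> with
  s at most S are larger: they cannot be discarded and have to cancel. In the score they cancel
  because \<open>f' = f L'\<close> turns the mean of \<open>g'\<close> into the same linear form in
  \<gamma> as the system itself; in the density, because the mean of \<open>m\<close> is f(x) times
  the denominator evaluated at \<gamma>, up to order h^(S+1). What survives is the Taylor term of
  order S+1, once directly through \<open>c\<close> at index S+1, and once through the column of
  \<Omega> with index S+1, weighted by the row vector that arises from \<open>c\<close> and the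
  inverse of \<Omega>. The same row vector weights \<open>g'\<close> in \<omega>, which is why one
  function governs both bias and variance.\<close>

context prob_space
begin

text \<open>
  Convergence in probability is convergence along this filter. Quantifying over exceptional
  events avoids all measurability conditions on the predicates.
\<close>

definition in_prob :: "(nat \<times> 'a) filter" where
  "in_prob = Abs_filter (\<lambda>P. \<forall>e>0. \<forall>\<^sub>F n in sequentially.
     \<exists>A\<in>events. prob A \<le> e \<and> (\<forall>w\<in>space M - A. P (n, w)))"

text \<open>The filter axioms reduce to a union bound: exceptional events of probability at most e /
  2 for two predicates serve their conjunction.\<close>

lemma eventually_in_prob:
  "eventually P in_prob \<longleftrightarrow> (\<forall>e>0. \<forall>\<^sub>F n in sequentially.
     \<exists>A\<in>events. prob A \<le> e \<and> (\<forall>w\<in>space M - A. P (n, w)))"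
  unfolding in_prob_def
proof (rule eventually_Abs_filter, rule is_filter.intro, goal_cases)
  case 1
  show ?case by (auto intro!: always_eventually bexI[of _ "{}"])
next
  case (2 P Q)
  show ?case
  proof (intro allI impI)
    fix e :: real assume "e > 0"
    then have "e / 2 > 0" by simp
    with 2 have "\<forall>\<^sub>F n in sequentially. \<exists>A\<in>events. prob A \<le> e / 2 \<and> (\<forall>w\<in>space M - A. P (n, w))"
      "\<forall>\<^sub>F n in sequentially. \<exists>A\<in>events. prob A \<le> e / 2 \<and> (\<forall>w\<in>space M - A. Q (n, w))"
      by blast+
    then show "\<forall>\<^sub>F n in sequentially. \<exists>A\<in>events. prob A \<le> e \<and> (\<forall>w\<in>space M - A. P (n, w) \<and> Q (n, w))"
    proof eventually_elim
      case (elim n)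
      then obtain A B where "A \<in> events" "prob A \<le> e / 2" "\<forall>w\<in>space M - A. P (n, w)"
        "B \<in> events" "prob B \<le> e / 2" "\<forall>w\<in>space M - B. Q (n, w)" by blast
      moreover from this have "prob (A \<union> B) \<le> e"
        using measure_Un_le[of A M B] by simp
      ultimately show ?case by (intro bexI[of _ "A \<union> B"]) auto
    qed
  qed
next
  case (3 P Q)
  show ?case
  proof (intro allI impI)
    fix e :: real assume "e > 0"
    with 3(2) have "\<forall>\<^sub>F n in sequentially. \<exists>A\<in>events. prob A \<le> e \<and> (\<forall>w\<in>space M - A. P (n, w))"
      by blast
    then show "\<forall>\<^sub>F n in sequentially. \<exists>A\<in>events. prob A \<le> e \<and> (\<forall>w\<in>space M - A. Q (n, w))"
      by eventually_elim (use 3(1) in blast)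
  qed
qed

lemma eventually_in_probD:
  assumes "eventually P in_prob" "e > 0"
  shows "\<forall>\<^sub>F n in sequentially. \<exists>A\<in>events. prob A \<le> e \<and> (\<forall>w\<in>space M - A. P (n, w))"
  using assms by (simp add: eventually_in_prob)

text \<open>The empty exceptional event suffices, so every deterministic limit in n is a limit in
  probability; the limits of \<open>h\<close>, \<open>x\<close> and of means are carried over this
  way.\<close>

lemma filterlim_fst_in_prob: "filterlim fst sequentially in_prob"
  unfolding filterlim_iff eventually_in_prob
proof (intro allI impI)
  fix P :: "nat \<Rightarrow> bool" and e :: real
  assume "eventually P sequentially" "e > 0"
  then show "\<forall>\<^sub>F n in sequentially. \<exists>A\<in>events. prob A \<le> e \<and> (\<forall>w\<in>space M - A. P (fst (n, w)))"
    by (auto elim!: eventually_mono intro!: bexI[of _ "{}"])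
qed

lemma tendsto_in_prob_const:
  "(a \<longlongrightarrow> l) sequentially \<Longrightarrow> ((\<lambda>p. a (fst p)) \<longlongrightarrow> l) in_prob"
  by (rule filterlim_compose[OF _ filterlim_fst_in_prob])

lemma eventually_in_prob_const:
  "eventually P sequentially \<Longrightarrow> eventually (\<lambda>p. P (fst p)) in_prob"
  using filterlim_fst_in_prob by (simp add: filterlim_iff)

text \<open>Gives access, inside the filter, to the assumption on \<open>\<beta>hat\<close>, which
  is made for points of \<open>space M\<close> only.\<close>

lemma eventually_in_prob_space: "eventually (\<lambda>p. snd p \<in> space M) in_prob"
  unfolding eventually_in_prob by (auto intro!: bexI[of _ "{}"])

text \<open>\<open>Z = O\<^sub>P(1)\<close>, characterised by \<open>o\<^sub>P(1) O\<^sub>P(1) = o\<^sub>P(1)\<close>.\<close>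

definition bounded_in_prob :: "(nat \<times> 'a \<Rightarrow> real) \<Rightarrow> bool" where
  "bounded_in_prob Z \<longleftrightarrow> (\<forall>r. (r \<longlongrightarrow> 0) in_prob \<longrightarrow> ((\<lambda>p. r p * Z p) \<longlongrightarrow> 0) in_prob)"

lemma bounded_in_prob_mult_0: "bounded_in_prob Z \<Longrightarrow> (r \<longlongrightarrow> 0) in_prob \<Longrightarrow> ((\<lambda>p. r p * Z p) \<longlongrightarrow> 0) in_prob"
  by (simp add: bounded_in_prob_def)

lemma bounded_in_prob_add: "bounded_in_prob Y \<Longrightarrow> bounded_in_prob Z \<Longrightarrow> bounded_in_prob (\<lambda>p. Y p + Z p)"
  unfolding bounded_in_prob_def by (auto simp: distrib_left intro: tendsto_add_zero)

lemma bounded_in_prob_tendsto: "(Z \<longlongrightarrow> l) in_prob \<Longrightarrow> bounded_in_prob Z"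
  unfolding bounded_in_prob_def using tendsto_mult_zero tendsto_mult by fastforce

lemma bounded_in_prob_mult:
  assumes "bounded_in_prob Y" "bounded_in_prob Z" shows "bounded_in_prob (\<lambda>p. Y p * Z p)"
  unfolding bounded_in_prob_def
proof (intro allI impI)
  fix r :: "nat \<times> 'a \<Rightarrow> real" assume "(r \<longlongrightarrow> 0) in_prob"
  then have "((\<lambda>p. (r p * Y p) * Z p) \<longlongrightarrow> 0) in_prob"
    using assms by (intro bounded_in_prob_mult_0)
  then show "((\<lambda>p. r p * (Y p * Z p)) \<longlongrightarrow> 0) in_prob" by (simp add: mult.assoc)
qed

lemma bounded_in_prob_sum: "(\<And>i. i \<in> I \<Longrightarrow> bounded_in_prob (Z i)) \<Longrightarrow> bounded_in_prob (\<lambda>p. \<Sum>i\<in>I. Z i p)"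
  unfolding bounded_in_prob_def by (auto simp: sum_distrib_left intro!: tendsto_null_sum)

lemma bounded_in_prob_abs: "bounded_in_prob Z \<Longrightarrow> bounded_in_prob (\<lambda>p. \<bar>Z p\<bar>)"
  unfolding bounded_in_prob_def
proof (intro allI impI)
  fix r :: "nat \<times> 'a \<Rightarrow> real"
  assume Z: "\<forall>r. (r \<longlongrightarrow> 0) in_prob \<longrightarrow> ((\<lambda>p. r p * Z p) \<longlongrightarrow> 0) in_prob" and "(r \<longlongrightarrow> 0) in_prob"
  then have "((\<lambda>p. \<bar>r p * Z p\<bar>) \<longlongrightarrow> 0) in_prob" by (intro tendsto_rabs_zero) blast
  then show "((\<lambda>p. r p * \<bar>Z p\<bar>) \<longlongrightarrow> 0) in_prob"
    by (rule Lim_null_comparison[rotated]) (simp add: abs_mult)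
qed

lemma bounded_in_prob_bound:
  assumes "bounded_in_prob Y" "\<forall>\<^sub>F p in in_prob. \<bar>Z p\<bar> \<le> \<bar>Y p\<bar>" shows "bounded_in_prob Z"
  unfolding bounded_in_prob_def
proof (intro allI impI)
  fix r :: "nat \<times> 'a \<Rightarrow> real" assume r: "(r \<longlongrightarrow> 0) in_prob"
  show "((\<lambda>p. r p * Z p) \<longlongrightarrow> 0) in_prob"
  proof (rule Lim_null_comparison)
    show "((\<lambda>p. \<bar>r p * Y p\<bar>) \<longlongrightarrow> 0) in_prob"
      using bounded_in_prob_mult_0[OF assms(1) r] by (rule tendsto_rabs_zero)
    show "\<forall>\<^sub>F p in in_prob. norm (r p * Z p) \<le> \<bar>r p * Y p\<bar>"
      using assms(2) by eventually_elim (simp add: abs_mult mult_left_mono)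
  qed
qed

text \<open>Markov's inequality for the square bounds Z by a constant K up to probability d / 2; the
  other d / 2 is spent on the factor tending to zero.\<close>

lemma bounded_in_prob_second_moment:
  assumes meas: "\<forall>\<^sub>F n in sequentially. (\<lambda>w. Z (n, w)) \<in> borel_measurable M"
    and int: "\<forall>\<^sub>F n in sequentially. integrable M (\<lambda>w. (Z (n, w))\<^sup>2)"
    and bd: "\<forall>\<^sub>F n in sequentially. expectation (\<lambda>w. (Z (n, w))\<^sup>2) \<le> C"
  shows "bounded_in_prob Z"
  unfolding bounded_in_prob_def
proof (intro allI impI tendstoI)
  fix r :: "nat \<times> 'a \<Rightarrow> real" and e :: real assume r: "(r \<longlongrightarrow> 0) in_prob" and e: "e > 0"
  show "\<forall>\<^sub>F p in in_prob. dist (r p * Z p) 0 < e"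
    unfolding eventually_in_prob
  proof (intro allI impI)
    fix d :: real assume d: "d > 0"
    \<comment> \<open>Chosen to make the Markov bound at most d / 2. The absolute value and the
      added 1 keep K positive whatever the sign of C.\<close>
    define K where "K = sqrt ((\<bar>C\<bar> + 1) / (d / 2))"
    have K: "K > 0" "K\<^sup>2 = (\<bar>C\<bar> + 1) / (d / 2)" using d by (auto simp: K_def)
    have "\<forall>\<^sub>F p in in_prob. \<bar>r p\<bar> < e / K"
      using tendstoD[OF r, of "e / K"] e K by simp
    then have "\<forall>\<^sub>F n in sequentially. \<exists>A\<in>events. prob A \<le> d / 2 \<and> (\<forall>w\<in>space M - A. \<bar>r (n, w)\<bar> < e / K)"
      unfolding eventually_in_prob using d half_gt_zero by blast
    then show "\<forall>\<^sub>F n in sequentially. \<exists>A\<in>events. prob A \<le> d \<and> (\<forall>w\<in>space M - A. dist (r (n, w) * Z (n, w)) 0 < e)"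
      using meas int bd
    proof eventually_elim
      case (elim n)
      note [measurable] = elim(2)
      from elim obtain A where A: "A \<in> events" "prob A \<le> d / 2" "\<forall>w\<in>space M - A. \<bar>r (n, w)\<bar> < e / K" by blast
      define B where "B = {w\<in>space M. (Z (n, w))\<^sup>2 \<ge> K\<^sup>2}"
      have B: "B \<in> events" unfolding B_def by measurable
      have "prob B \<le> expectation (\<lambda>w. (Z (n, w))\<^sup>2) / K\<^sup>2"
        unfolding B_def by (rule integral_Markov_inequality_measure[where A="space M"]) (use elim(3) zero_less_power[OF K(1), of 2] in auto)
      also have "\<dots> \<le> (\<bar>C\<bar> + 1) / K\<^sup>2" using elim(4) K(1) by (intro divide_right_mono) auto
      also have "\<dots> = d / 2" using K by (auto simp: field_simps)
      finally have "prob (A \<union> B) \<le> d" using measure_Un_le[OF A(1) B] A by simp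
      moreover have "dist (r (n, w) * Z (n, w)) 0 < e" if "w \<in> space M - (A \<union> B)" for w
      proof -
        have "\<bar>Z (n, w)\<bar> < K"
        proof (rule ccontr)
          assume "\<not> \<bar>Z (n, w)\<bar> < K"
          then have "K\<^sup>2 \<le> \<bar>Z (n, w)\<bar>\<^sup>2" using K(1) by (intro power_mono) auto
          then show False using that by (auto simp: B_def)
        qed
        moreover have "\<bar>r (n, w)\<bar> < e / K" using that A by auto
        ultimately have "\<bar>r (n, w)\<bar> * \<bar>Z (n, w)\<bar> < e / K * K"
          by (intro mult_strict_mono') auto
        then show ?thesis using K by (simp add: abs_mult)
      qed
      ultimately show ?case using A B by (intro bexI[of _ "A \<union> B"]) auto
    qed
  qed
qed

text \<open>A sandwich of distribution functions: if Z and W differ by less than c outside a small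
  event, P(Z \<le> a) lies between P(W \<le> a - c) and P(W \<le> a + c) up to its probability, and
  continuity of the limit closes the gap. Z is measurable only eventually because the estimator uses
  \<open>m\<close> at the edge ratio, which equals \<open>z\<close> only for large n.\<close>

lemma slutsky:
  assumes W: "\<And>n. random_variable borel (W n)"
    and Z: "\<forall>\<^sub>F n in sequentially. random_variable borel (Z n)"
    and diff: "((\<lambda>p. Z (fst p) (snd p) - W (fst p) (snd p)) \<longlongrightarrow> 0) in_prob"
    and conv: "weak_conv_m (\<lambda>n. distr M borel (W n)) N"
    and N: "real_distribution N" "\<And>a. isCont (cdf N) a"
  shows "weak_conv_m (\<lambda>n. distr M borel (Z n)) N"
  unfolding weak_conv_m_def weak_conv_def
proof (intro allI impI)
  fix a
  have cdf_distr: "cdf (distr M borel Y) b = prob {w\<in>space M. Y w \<le> b}"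
    if [measurable]: "random_variable borel Y" for Y b
    unfolding cdf_def by (subst measure_distr) (auto intro!: arg_cong[where f=prob])
  have cW: "(\<lambda>n. cdf (distr M borel (W n)) b) \<longlonglongrightarrow> cdf N b" for b
    using conv N(2) by (simp add: weak_conv_m_def weak_conv_def)
  show "(\<lambda>n. cdf (distr M borel (Z n)) a) \<longlonglongrightarrow> cdf N a"
  proof (rule tendstoI)
    fix e :: real assume e: "e > 0"
    then have "e / 3 > 0" by simp
    obtain d where d: "d > 0" "\<And>b. dist b a < d \<Longrightarrow> dist (cdf N b) (cdf N a) < e / 3"
      using N(2)[of a] \<open>e / 3 > 0\<close> unfolding continuous_at_eps_delta by blast
    define c where "c = d / 2"
    have c: "c > 0" "dist (cdf N (a + c)) (cdf N a) < e / 3" "dist (cdf N (a - c)) (cdf N a) < e / 3"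
      using d by (auto simp: c_def dist_real_def)
    have "\<forall>\<^sub>F p in in_prob. \<bar>Z (fst p) (snd p) - W (fst p) (snd p)\<bar> < c"
      using tendstoD[OF diff c(1)] by simp
    then have "\<forall>\<^sub>F n in sequentially. \<exists>A\<in>events. prob A \<le> e / 3 \<and> (\<forall>w\<in>space M - A. \<bar>Z n w - W n w\<bar> < c)"
      using eventually_in_probD[OF _ \<open>e / 3 > 0\<close>, of "\<lambda>p. \<bar>Z (fst p) (snd p) - W (fst p) (snd p)\<bar> < c"]
      by (simp only: fst_conv snd_conv)
    then show "\<forall>\<^sub>F n in sequentially. dist (cdf (distr M borel (Z n)) a) (cdf N a) < e"
      using Z tendstoD[OF cW[of "a + c"] \<open>e / 3 > 0\<close>] tendstoD[OF cW[of "a - c"] \<open>e / 3 > 0\<close>]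
    proof eventually_elim
      case (elim n)
      note [measurable] = elim(2) W[of n]
      from elim obtain A where A: "A \<in> events" "prob A \<le> e / 3" "\<forall>w\<in>space M - A. \<bar>Z n w - W n w\<bar> < c" by blast
      have close: "W n w < Z n w + c \<and> Z n w < W n w + c" if "w \<in> space M" "w \<notin> A" for w
        using A(3) that by (auto simp: abs_less_iff algebra_simps)
      have "W n w \<le> a + c" if "w \<in> space M" "w \<notin> A" "Z n w \<le> a" for w
        using close[OF that(1,2)] that(3) by linarith
      then have "prob {w\<in>space M. Z n w \<le> a} \<le> prob ({w\<in>space M. W n w \<le> a + c} \<union> A)"
        using A(1) by (intro finite_measure_mono) auto
      also have "\<dots> \<le> prob {w\<in>space M. W n w \<le> a + c} + e / 3"
        using measure_Un_le[of "{w\<in>space M. W n w \<le> a + c}" M A] A by auto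
      finally have 1: "prob {w\<in>space M. Z n w \<le> a} \<le> prob {w\<in>space M. W n w \<le> a + c} + e / 3" .
      have "Z n w \<le> a" if "w \<in> space M" "w \<notin> A" "W n w \<le> a - c" for w
        using close[OF that(1,2)] that(3) by linarith
      then have "prob {w\<in>space M. W n w \<le> a - c} \<le> prob ({w\<in>space M. Z n w \<le> a} \<union> A)"
        using A(1) by (intro finite_measure_mono) auto
      also have "\<dots> \<le> prob {w\<in>space M. Z n w \<le> a} + e / 3"
        using measure_Un_le[of "{w\<in>space M. Z n w \<le> a}" M A] A by auto
      finally have 2: "prob {w\<in>space M. W n w \<le> a - c} \<le> prob {w\<in>space M. Z n w \<le> a} + e / 3" .
      show ?case
        using 1 2 elim(3,4) c(2,3)
        unfolding cdf_distr[OF W] cdf_distr[OF elim(2)] dist_real_def abs_less_iff by linarith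
    qed
  qed
qed

end

section \<open>Kernels and normal distributions\<close>

text \<open>The common class of \<open>m\<close>, \<open>g\<close>, \<open>g'\<close> and \<omega>.
  Square integrability serves the variances; bounded support makes the functions integrable and lets
  powers and exponentials of polynomials act as bounded factors.\<close>

definition kernel_fun :: "real \<Rightarrow> (real \<Rightarrow> real) \<Rightarrow> bool" where
  "kernel_fun z \<phi> \<longleftrightarrow> \<phi> \<in> borel_measurable borel \<and> (\<forall>t. t \<notin> {-z..1} \<longrightarrow> \<phi> t = 0) \<and>
     integrable lborel (\<lambda>t. (\<phi> t)\<^sup>2)"

lemma kernel_funD:
  assumes "kernel_fun z \<phi>"
  shows "\<phi> \<in> borel_measurable borel" "t \<notin> {-z..1} \<Longrightarrow> \<phi> t = 0" "integrable lborel (\<lambda>t. (\<phi> t)\<^sup>2)"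
  using assms by (auto simp: kernel_fun_def)

text \<open>On the bounded support \<open>2 * \<bar>\<phi>\<bar> \<le> \<phi>^2 + 1\<close> gives an
  integrable majorant.\<close>

lemma kernel_fun_integrable:
  assumes "kernel_fun z \<phi>"
  shows "integrable lborel \<phi>"
proof (rule Bochner_Integration.integrable_bound)
  note [measurable] = kernel_funD(1)[OF assms]
  show "integrable lborel (\<lambda>t. (\<phi> t)\<^sup>2 + indicator {-z..1} t :: real)"
    using kernel_funD(3)[OF assms] by (intro Bochner_Integration.integrable_add) (auto intro!: integrable_real_indicator simp: emeasure_lborel_Icc_eq)
  show "\<phi> \<in> borel_measurable lborel" by simp
  show "AE t in lborel. norm (\<phi> t) \<le> norm ((\<phi> t)\<^sup>2 + indicator {-z..1} t :: real)"
  proof (rule AE_I2)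
    fix t
    have "0 \<le> (\<bar>\<phi> t\<bar> - 1)\<^sup>2" by simp
    then have "2 * \<bar>\<phi> t\<bar> \<le> (\<phi> t)\<^sup>2 + 1" by (simp add: power2_eq_square algebra_simps)
    then show "norm (\<phi> t) \<le> norm ((\<phi> t)\<^sup>2 + indicator {-z..1} t :: real)"
      using kernel_funD(2)[OF assms, of t] by (auto split: split_indicator)
  qed
qed

section \<open>Closure properties of the kernel class\<close>

lemma kernel_fun_mult_bounded:
  assumes "kernel_fun z \<phi>" "u \<in> borel_measurable borel" "\<And>t. t \<in> {-z..1} \<Longrightarrow> \<bar>u t\<bar> \<le> C"
  shows "kernel_fun z (\<lambda>t. \<phi> t * u t)"
  unfolding kernel_fun_def
proof (intro conjI)
  note [measurable] = kernel_funD(1)[OF assms(1)] assms(2)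
  show "(\<lambda>t. \<phi> t * u t) \<in> borel_measurable borel" by simp
  show "\<forall>t. t \<notin> {-z..1} \<longrightarrow> \<phi> t * u t = 0" using kernel_funD(2)[OF assms(1)] by auto
  show "integrable lborel (\<lambda>t. (\<phi> t * u t)\<^sup>2)"
  proof (rule Bochner_Integration.integrable_bound)
    show "integrable lborel (\<lambda>t. C\<^sup>2 * (\<phi> t)\<^sup>2)" using kernel_funD(3)[OF assms(1)] by simp
    show "AE t in lborel. norm ((\<phi> t * u t)\<^sup>2) \<le> norm (C\<^sup>2 * (\<phi> t)\<^sup>2)"
    proof (rule AE_I2)
      fix t
      show "norm ((\<phi> t * u t)\<^sup>2) \<le> norm (C\<^sup>2 * (\<phi> t)\<^sup>2)"
      proof (cases "t \<in> {-z..1}")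
        case True
        then have "(u t)\<^sup>2 \<le> C\<^sup>2" using power_mono[OF assms(3)[OF True], of 2] by simp
        then show ?thesis
            using mult_right_mono[of "(u t)\<^sup>2" "C\<^sup>2" "(\<phi> t)\<^sup>2"] by (simp add: power_mult_distrib mult.commute)
      qed (simp add: kernel_funD(2)[OF assms(1)])
    qed
  qed simp
qed

lemma kernel_fun_add:
  assumes "kernel_fun z \<phi>" "kernel_fun z \<psi>"
  shows "kernel_fun z (\<lambda>t. \<phi> t + \<psi> t)"
  unfolding kernel_fun_def
proof (intro conjI)
  note [measurable] = kernel_funD(1)[OF assms(1)] kernel_funD(1)[OF assms(2)]
  show "(\<lambda>t. \<phi> t + \<psi> t) \<in> borel_measurable borel" by simp
  show "\<forall>t. t \<notin> {-z..1} \<longrightarrow> \<phi> t + \<psi> t = 0" using assms by (auto simp: kernel_funD(2))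
  show "integrable lborel (\<lambda>t. (\<phi> t + \<psi> t)\<^sup>2)"
  proof (rule Bochner_Integration.integrable_bound)
    show "integrable lborel (\<lambda>t. 2 * (\<phi> t)\<^sup>2 + 2 * (\<psi> t)\<^sup>2)"
      using kernel_funD(3)[OF assms(1)] kernel_funD(3)[OF assms(2)] by simp
    show "AE t in lborel. norm ((\<phi> t + \<psi> t)\<^sup>2) \<le> norm (2 * (\<phi> t)\<^sup>2 + 2 * (\<psi> t)\<^sup>2)"
    proof (rule AE_I2)
      fix t
      have "0 \<le> (\<phi> t - \<psi> t)\<^sup>2" by simp
      then have "(\<phi> t + \<psi> t)\<^sup>2 \<le> 2 * (\<phi> t)\<^sup>2 + 2 * (\<psi> t)\<^sup>2"
        by (simp add: power2_eq_square algebra_simps)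
      then show "norm ((\<phi> t + \<psi> t)\<^sup>2) \<le> norm (2 * (\<phi> t)\<^sup>2 + 2 * (\<psi> t)\<^sup>2)"
        by simp
    qed
  qed simp
qed

lemma kernel_fun_scale: "kernel_fun z \<phi> \<Longrightarrow> kernel_fun z (\<lambda>t. c * \<phi> t)"
  using kernel_fun_mult_bounded[of z \<phi> "\<lambda>_. c" "\<bar>c\<bar>"] by (simp add: mult.commute)

lemma kernel_fun_sum:
  assumes "\<And>i. i \<in> I \<Longrightarrow> kernel_fun z (\<phi> i)"
  shows "kernel_fun z (\<lambda>t. \<Sum>i\<in>I. \<phi> i t)"
  using assms
proof (induction I rule: infinite_finite_induct)
  case (insert i I)
  then show ?case using kernel_fun_add[of z "\<phi> i" "\<lambda>t. \<Sum>i\<in>I. \<phi> i t"] by simp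
qed (simp_all add: kernel_fun_def)

text \<open>By induction: a new summand is centred and independent of the partial sum, so the cross
  term has expectation zero. Integrability is part of the conclusion because the induction step
  needs it.\<close>

lemma (in prob_space) expectation_sum_square_indep:
  fixes Y :: "'i \<Rightarrow> 'a \<Rightarrow> real"
  assumes "finite I" "indep_vars (\<lambda>_. borel) Y I"
    "\<And>i. i \<in> I \<Longrightarrow> integrable M (\<lambda>w. (Y i w)\<^sup>2)" "\<And>i. i \<in> I \<Longrightarrow> expectation (Y i) = 0"
  shows "integrable M (\<lambda>w. (\<Sum>i\<in>I. Y i w)\<^sup>2) \<and>
    expectation (\<lambda>w. (\<Sum>i\<in>I. Y i w)\<^sup>2) = (\<Sum>i\<in>I. expectation (\<lambda>w. (Y i w)\<^sup>2))"
  using assms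
proof (induction I rule: finite_induct)
  case (insert i I)
  have ind: "indep_vars (\<lambda>_. borel) Y I"
    by (rule indep_vars_subset[OF insert.prems(1)]) auto
  have rv: "random_variable borel (Y k)" if "k \<in> insert i I" for k
    using insert.prems(1) that by (auto simp: indep_vars_def)
  have int: "integrable M (Y k)" if "k \<in> insert i I" for k
    using square_integrable_imp_integrable[OF rv[OF that] insert.prems(2)[OF that]] .
  have IH: "integrable M (\<lambda>w. (\<Sum>i\<in>I. Y i w)\<^sup>2)"
    "expectation (\<lambda>w. (\<Sum>i\<in>I. Y i w)\<^sup>2) = (\<Sum>i\<in>I. expectation (\<lambda>w. (Y i w)\<^sup>2))"
    using insert.IH[OF ind] insert.prems by auto
  have iv: "indep_var borel (Y i) borel (\<lambda>w. \<Sum>i\<in>I. Y i w)"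
    by (rule indep_vars_sum[OF insert.hyps insert.prems(1)])
  have intS: "integrable M (\<lambda>w. \<Sum>i\<in>I. Y i w)" using int by auto
  have cross: "integrable M (\<lambda>w. Y i w * (\<Sum>i\<in>I. Y i w))"
    "expectation (\<lambda>w. Y i w * (\<Sum>i\<in>I. Y i w)) = 0"
    using indep_var_integrable[OF iv] indep_var_lebesgue_integral[OF iv] int intS insert.prems(3)
    by auto
  have eq: "(\<Sum>i\<in>insert i I. Y i w)\<^sup>2 = (Y i w)\<^sup>2 + 2 * (Y i w * (\<Sum>i\<in>I. Y i w)) + (\<Sum>i\<in>I. Y i w)\<^sup>2" for w
    using insert.hyps by (simp add: power2_eq_square algebra_simps)
  show ?case
    unfolding eq using insert.hyps insert.prems(2) IH cross by simp
qed simp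

section \<open>Normal laws: affine images, characteristic functions, continuity\<close>

lemma distr_std_normal_affine:
  assumes "0 < \<sigma>"
  shows "distr std_normal_distribution borel (\<lambda>y. \<mu> + \<sigma> * y) = density lborel (\<lambda>y. ennreal (normal_density \<mu> \<sigma> y))"
proof -
  interpret prob_space std_normal_distribution
    by (rule prob_space_normal_density) simp
  have "distributed std_normal_distribution lborel (\<lambda>y. y) std_normal_density"
    by (auto simp: distributed_def distr_id2)
  then have "distributed std_normal_distribution lborel (\<lambda>y. \<mu> + \<sigma> * y) (normal_density (\<mu> + \<sigma> * 0) (\<bar>\<sigma>\<bar> * 1))"
    using assms by (intro normal_density_affine) auto
  then have "distr std_normal_distribution lborel (\<lambda>y. \<mu> + \<sigma> * y) = density lborel (\<lambda>y. ennreal (normal_density \<mu> \<sigma> y))"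
    using assms by (simp add: distributed_def)
  then show ?thesis by (subst (asm) distr_cong[OF refl sets_lborel refl])
qed

lemma (in prob_space) char_affine:
  assumes [measurable]: "random_variable borel Y"
  shows "char (distr M borel (\<lambda>w. \<mu> + \<sigma> * Y w)) t = iexp (t * \<mu>) * char (distr M borel Y) (t * \<sigma>)"
  unfolding char_def
  by (simp add: integral_distr ring_distribs exp_add mult_ac)

lemma char_normal_distribution:
  assumes "0 < \<sigma>"
  shows "char (density lborel (\<lambda>y. ennreal (normal_density \<mu> \<sigma> y))) t =
    iexp (t * \<mu>) * complex_of_real (exp (- (t\<^sup>2 * \<sigma>\<^sup>2 / 2)))"
proof -
  interpret prob_space std_normal_distribution
    by (rule prob_space_normal_density) simp
  have "distr std_normal_distribution borel (\<lambda>y. y) = std_normal_distribution"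
    by (rule distr_id2) simp
  then show ?thesis
    using char_affine[of "\<lambda>y. y" \<mu> \<sigma> t] assms
    by (simp add: distr_std_normal_affine char_std_normal_distribution power_mult_distrib)
qed

lemma normal_distribution_real_distribution:
  assumes "0 < \<sigma>"
  shows "real_distribution (density lborel (\<lambda>y. ennreal (normal_density \<mu> \<sigma> y)))"
  using prob_space_normal_density[OF assms]
  by (auto simp: real_distribution_def real_distribution_axioms_def)

text \<open>A law with a density has no atoms. The sandwich in \<open>slutsky\<close> needs this
  continuity.\<close>

lemma isCont_cdf_normal_distribution:
  assumes "0 < \<sigma>"
  shows "isCont (cdf (density lborel (\<lambda>y. ennreal (normal_density \<mu> \<sigma> y)))) a"
proof -
  interpret real_distribution "density lborel (\<lambda>y. ennreal (normal_density \<mu> \<sigma> y))"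
    by (rule normal_distribution_real_distribution[OF assms])
  have "emeasure (density lborel (\<lambda>y. ennreal (normal_density \<mu> \<sigma> y))) {a} = 0"
    by (subst emeasure_density) (auto simp: nn_integral_0_iff_AE intro!: AE_I[where N="{a}"] split: split_indicator)
  then show ?thesis by (simp add: isCont_cdf measure_def)
qed

section \<open>Local averages and their central limit theorem\<close>

text \<open>The only regularity asked of the density is \<open>f_lim\<close>, uniform convergence on
  the shrinking window; it treats a fixed point and a point moving to the boundary alike.\<close>

locale local_sample = prob_space M for M :: "'a measure" +
  fixes X :: "nat \<Rightarrow> 'a \<Rightarrow> real" and f :: "real \<Rightarrow> real" and h x :: "nat \<Rightarrow> real" and z f0 :: real
  assumes indep: "indep_vars (\<lambda>_. borel) X {1..}"
    and dens: "\<And>i. 1 \<le> i \<Longrightarrow> distributed M lborel (X i) (\<lambda>y. ennreal (f y))"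
    and f_nonneg: "\<And>y. 0 \<le> f y"
    and h_pos: "\<And>n. 0 < h n"
    and h_lim: "h \<longlonglongrightarrow> 0"
    and nh: "filterlim (\<lambda>n. real n * h n) at_top sequentially"
    and f_lim: "\<And>e. e > 0 \<Longrightarrow> \<forall>\<^sub>F n in sequentially. \<forall>t\<in>{-z..1}. \<bar>f (x n + t * h n) - f0\<bar> < e"
begin

text \<open>For positive n this is the expectation of \<open>local_avg\<close>: substituting y = x +
  t h produces a factor h that cancels the one in the denominator.\<close>

definition local_mean :: "(real \<Rightarrow> real) \<Rightarrow> nat \<Rightarrow> real" where
  "local_mean \<phi> n = (LINT t|lborel. \<phi> t * f (x n + t * h n))"

definition local_avg :: "(real \<Rightarrow> real) \<Rightarrow> nat \<times> 'a \<Rightarrow> real" where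
  "local_avg \<phi> p = (\<Sum>i=1..fst p. \<phi> ((X i (snd p) - x (fst p)) / h (fst p))) / (real (fst p) * h (fst p))"

definition local_fluct :: "(real \<Rightarrow> real) \<Rightarrow> nat \<times> 'a \<Rightarrow> real" where
  "local_fluct \<phi> p = sqrt (real (fst p) * h (fst p)) * (local_avg \<phi> p - local_mean \<phi> (fst p))"

definition f_bound :: real where "f_bound = \<bar>f0\<bar> + 1"

text \<open>Collects what holds for all large n and yields every integrability claim: f is bounded
  on the window by a constant free of n.\<close>

definition well_placed :: "nat \<Rightarrow> bool" where
  "well_placed n \<longleftrightarrow> 0 < n \<and> (\<forall>t\<in>{-z..1}. f (x n + t * h n) \<le> f_bound)"

lemma f_bound_pos: "0 < f_bound" by (simp add: f_bound_def)

lemma eventually_well_placed: "eventually well_placed sequentially"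
  using f_lim[of 1] eventually_gt_at_top[of 0]
  by (rule eventually_elim2[OF _ _ ]) (auto simp: well_placed_def f_bound_def abs_less_iff dest!: bspec)

lemma f_measurable [measurable]: "f \<in> borel_measurable borel"
  using distributed_real_measurable[OF _ dens[of 1]] f_nonneg by simp

lemma X_measurable: "1 \<le> i \<Longrightarrow> random_variable borel (X i)"
  using indep by (simp add: indep_vars_def)

section \<open>Expectations of local functions and their limits\<close>

lemma expectation_local:
  assumes i: "1 \<le> i" and [measurable]: "u \<in> borel_measurable borel"
  shows "expectation (\<lambda>w. u ((X i w - x n) / h n)) = h n * (LINT t|lborel. u t * f (x n + t * h n))"
proof -
  have "expectation (\<lambda>w. u ((X i w - x n) / h n)) = (LINT y|lborel. f y * u ((y - x n) / h n))"
    by (rule distributed_integral[OF dens[OF i], symmetric]) (auto simp: f_nonneg)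
  also have "\<dots> = \<bar>h n\<bar> *\<^sub>R (LINT t|lborel. f (x n + h n * t) * u ((x n + h n * t - x n) / h n))"
    using h_pos[of n] by (intro lborel_integral_real_affine) simp
  also have "\<dots> = h n * (LINT t|lborel. u t * f (x n + t * h n))"
    using h_pos[of n] by (simp add: mult.commute)
  finally show ?thesis .
qed

lemma integrable_local:
  assumes i: "1 \<le> i" and [measurable]: "u \<in> borel_measurable borel"
    and int: "integrable lborel (\<lambda>t. u t * f (x n + t * h n))"
  shows "integrable M (\<lambda>w. u ((X i w - x n) / h n))"
proof -
  have "integrable lborel (\<lambda>t. f (x n + h n * t) * u ((x n + h n * t - x n) / h n))"
    using int h_pos[of n] by (simp add: mult.commute)
  then have "integrable lborel (\<lambda>y. f y * u ((y - x n) / h n))"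
    using lborel_integrable_real_affine_iff[of "h n" "\<lambda>y. f y * u ((y - x n) / h n)" "x n"] h_pos[of n] by simp
  then show ?thesis
    by (subst (asm) distributed_integrable[OF dens[OF i]]) (auto simp: f_nonneg)
qed

lemma integrable_mult_f:
  assumes n: "well_placed n" and int: "integrable lborel u" and supp: "\<And>t. t \<notin> {-z..1} \<Longrightarrow> u t = 0"
  shows "integrable lborel (\<lambda>t. u t * f (x n + t * h n))"
    and "(LINT t|lborel. \<bar>u t * f (x n + t * h n)\<bar>) \<le> f_bound * (LINT t|lborel. \<bar>u t\<bar>)"
proof -
  note [measurable] = borel_measurable_integrable[OF int]
  have bd: "\<bar>u t * f (x n + t * h n)\<bar> \<le> f_bound * \<bar>u t\<bar>" for t
    using n supp[of t] f_nonneg[of "x n + t * h n"] mult_left_mono[of "f (x n + t * h n)" f_bound "\<bar>u t\<bar>"]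
    by (cases "t \<in> {-z..1}") (auto simp: well_placed_def abs_mult mult.commute)
  show 1: "integrable lborel (\<lambda>t. u t * f (x n + t * h n))"
  proof (rule Bochner_Integration.integrable_bound)
    show "integrable lborel (\<lambda>t. f_bound * \<bar>u t\<bar>)" using int by simp
    show "AE t in lborel. norm (u t * f (x n + t * h n)) \<le> norm (f_bound * \<bar>u t\<bar>)"
      using bd f_bound_pos by (auto simp: abs_mult)
  qed simp
  have "(LINT t|lborel. \<bar>u t * f (x n + t * h n)\<bar>) \<le> (LINT t|lborel. f_bound * \<bar>u t\<bar>)"
    using 1 int bd by (intro integral_mono) auto
  then show "(LINT t|lborel. \<bar>u t * f (x n + t * h n)\<bar>) \<le> f_bound * (LINT t|lborel. \<bar>u t\<bar>)" by simp
qed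

text \<open>Uniform convergence of f on the window bounds the error by a small multiple of the L1
  norm of u, so u need only be integrable.\<close>

lemma local_mean_lim:
  assumes int: "integrable lborel u" and supp: "\<And>t. t \<notin> {-z..1} \<Longrightarrow> u t = 0"
  shows "local_mean u \<longlonglongrightarrow> f0 * (LINT t|lborel. u t)"
proof (rule tendstoI)
  fix e :: real assume e: "e > 0"
  define K where "K = (LINT t|lborel. \<bar>u t\<bar>) + 1"
  have K: "K > 0" by (simp add: K_def add_nonneg_pos)
  have "\<forall>\<^sub>F n in sequentially. \<forall>t\<in>{-z..1}. \<bar>f (x n + t * h n) - f0\<bar> < e / K"
    using e K by (intro f_lim) simp
  then show "\<forall>\<^sub>F n in sequentially. dist (local_mean u n) (f0 * (LINT t|lborel. u t)) < e"
    using eventually_well_placed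
  proof eventually_elim
    case (elim n)
    have i1: "integrable lborel (\<lambda>t. u t * f (x n + t * h n))" by (rule integrable_mult_f[OF elim(2) int supp])
    have "local_mean u n - f0 * (LINT t|lborel. u t) = (LINT t|lborel. u t * f (x n + t * h n) - f0 * u t)"
      using i1 int by (simp add: local_mean_def)
    also have "\<bar>\<dots>\<bar> \<le> (LINT t|lborel. \<bar>u t * f (x n + t * h n) - f0 * u t\<bar>)"
      by (rule integral_abs_bound)
    also have "\<dots> \<le> (LINT t|lborel. e / K * \<bar>u t\<bar>)"
    proof (rule integral_mono)
      show "integrable lborel (\<lambda>t. \<bar>u t * f (x n + t * h n) - f0 * u t\<bar>)" using i1 int by simp
      show "integrable lborel (\<lambda>t. e / K * \<bar>u t\<bar>)" using int by simp
      fix t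
      have "u t * f (x n + t * h n) - f0 * u t = (f (x n + t * h n) - f0) * u t" by (simp add: algebra_simps)
      then show "\<bar>u t * f (x n + t * h n) - f0 * u t\<bar> \<le> e / K * \<bar>u t\<bar>"
        using mult_right_mono[of "\<bar>f (x n + t * h n) - f0\<bar>" "e / K" "\<bar>u t\<bar>"] elim(1) supp[of t]
        by (cases "t \<in> {-z..1}") (auto simp: abs_mult less_imp_le)
    qed
    also have "\<dots> = e / K * (K - 1)" by (simp add: K_def)
    also have "\<dots> < e" using e K by (simp add: field_simps)
    finally show ?case by (simp add: dist_real_def)
  qed
qed

text \<open>Exhibits the fluctuation as a row sum of independent centred variables, the form used
  both for second moments and for products of characteristic functions.\<close>

lemma local_fluct_eq:
  assumes "0 < n"
  shows "local_fluct \<phi> (n, w) =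
    (\<Sum>i=1..n. (\<phi> ((X i w - x n) / h n) - h n * local_mean \<phi> n) / sqrt (real n * h n))"
proof -
  have s: "sqrt (real n * h n) * sqrt (real n * h n) = real n * h n" "sqrt (real n * h n) \<noteq> 0"
    using h_pos[of n] assms by auto
  have "(\<Sum>i=1..n. (\<phi> ((X i w - x n) / h n) - h n * local_mean \<phi> n) / sqrt (real n * h n)) =
    ((\<Sum>i=1..n. \<phi> ((X i w - x n) / h n)) - real n * h n * local_mean \<phi> n) / sqrt (real n * h n)"
    by (simp add: sum_divide_distrib[symmetric] sum_subtractf)
  also have "\<dots> = local_fluct \<phi> (n, w)"
  proof -
    have "c / q = q * (c / (q * q))" if "q \<noteq> 0" for c q :: real using that by simp
    from this[OF s(2)] have "c / sqrt (real n * h n) = sqrt (real n * h n) * (c / (real n * h n))" for c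
      unfolding s(1) .
    then show ?thesis
      using assms h_pos[of n] unfolding local_fluct_def local_avg_def fst_conv snd_conv
      by (simp add: diff_divide_distrib right_diff_distrib)
  qed
  finally show ?thesis ..
qed

section \<open>Second moments, tightness and the weak law\<close>

lemma local_fluct_measurable:
  assumes [measurable]: "\<phi> \<in> borel_measurable borel"
  shows "(\<lambda>w. local_fluct \<phi> (n, w)) \<in> borel_measurable M"
proof -
  have [measurable]: "X i \<in> borel_measurable M" if "i \<in> {1..n}" for i using that X_measurable by simp
  show ?thesis unfolding local_fluct_def local_avg_def fst_conv snd_conv by measurable
qed

text \<open>The summands form one row of the triangular array. In their variance the squared mean
  carries an extra factor h, so it is negligible in the limit.\<close>

lemma centred_summand:
  fixes \<phi> n defines "Y \<equiv> \<lambda>i w. (\<phi> ((X i w - x n) / h n) - h n * local_mean \<phi> n) / sqrt (real n * h n)"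
  assumes \<phi>: "kernel_fun z \<phi>" and n: "well_placed n"
  shows "indep_vars (\<lambda>_. borel) Y {1..n}"
    and "\<And>i. i \<in> {1..n} \<Longrightarrow> integrable M (Y i)"
    and "\<And>i. i \<in> {1..n} \<Longrightarrow> integrable M (\<lambda>w. (Y i w)\<^sup>2)"
    and "\<And>i. i \<in> {1..n} \<Longrightarrow> expectation (Y i) = 0"
    and "\<And>i. i \<in> {1..n} \<Longrightarrow> expectation (\<lambda>w. (Y i w)\<^sup>2) =
       (local_mean (\<lambda>t. (\<phi> t)\<^sup>2) n - h n * (local_mean \<phi> n)\<^sup>2) / real n"
proof -
  note [measurable] = kernel_funD(1)[OF \<phi>]
  have n0: "0 < n" using n by (simp add: well_placed_def)
  define m where "m = h n * local_mean \<phi> n"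
  have nh0: "real n * h n > 0" using h_pos[of n] n0 by simp
  show "indep_vars (\<lambda>_. borel) Y {1..n}"
    unfolding Y_def
    by (rule indep_vars_compose2[where X=X and M'="\<lambda>_. borel", OF indep_vars_subset[OF indep]]) auto
  fix i assume "i \<in> {1..n}"
  then have i: "1 \<le> i" by simp
  have I1: "integrable M (\<lambda>w. \<phi> ((X i w - x n) / h n))"
    by (intro integrable_local[OF i] integrable_mult_f(1)[OF n] kernel_fun_integrable[OF \<phi>]
        kernel_funD[OF \<phi>])
  have I2: "integrable M (\<lambda>w. (\<phi> ((X i w - x n) / h n))\<^sup>2)"
    by (rule integrable_local[OF i, of "\<lambda>t. (\<phi> t)\<^sup>2"])
       (auto intro!: integrable_mult_f(1)[OF n] simp: kernel_funD(2,3)[OF \<phi>])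
  have E1: "expectation (\<lambda>w. \<phi> ((X i w - x n) / h n)) = m"
    unfolding m_def local_mean_def by (rule expectation_local[OF i]) simp
  have E2: "expectation (\<lambda>w. (\<phi> ((X i w - x n) / h n))\<^sup>2) = h n * local_mean (\<lambda>t. (\<phi> t)\<^sup>2) n"
    unfolding local_mean_def by (rule expectation_local[OF i, of "\<lambda>t. (\<phi> t)\<^sup>2"]) simp
  show "integrable M (Y i)" unfolding Y_def using I1 by simp
  have sq: "(Y i w)\<^sup>2 = ((\<phi> ((X i w - x n) / h n))\<^sup>2 - 2 * m * \<phi> ((X i w - x n) / h n) + m\<^sup>2) / (real n * h n)" for w
    using nh0 by (simp add: Y_def m_def power_divide power2_diff) 
  show "integrable M (\<lambda>w. (Y i w)\<^sup>2)" unfolding sq using I1 I2 by simp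
  show "expectation (Y i) = 0" unfolding Y_def using I1 E1 by (simp add: m_def prob_space)
  have "expectation (\<lambda>w. (Y i w)\<^sup>2) = (h n * local_mean (\<lambda>t. (\<phi> t)\<^sup>2) n - m\<^sup>2) / (real n * h n)"
    unfolding sq using I1 I2 E1 E2 by (simp add: prob_space power2_eq_square)
  also have "\<dots> = (local_mean (\<lambda>t. (\<phi> t)\<^sup>2) n - h n * (local_mean \<phi> n)\<^sup>2) / real n"
    using h_pos[of n] n0 by (simp add: m_def divide_simps power2_eq_square) (simp add: algebra_simps)
  finally show "expectation (\<lambda>w. (Y i w)\<^sup>2) =
       (local_mean (\<lambda>t. (\<phi> t)\<^sup>2) n - h n * (local_mean \<phi> n)\<^sup>2) / real n" .
qed

lemma local_fluct_second_moment:
  assumes \<phi>: "kernel_fun z \<phi>" and n: "well_placed n"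
  shows "integrable M (\<lambda>w. (local_fluct \<phi> (n, w))\<^sup>2)"
    and "expectation (\<lambda>w. (local_fluct \<phi> (n, w))\<^sup>2) \<le> f_bound * (LINT t|lborel. (\<phi> t)\<^sup>2)"
proof -
  have n0: "0 < n" using n by (simp add: well_placed_def)
  note c = centred_summand[OF \<phi> n]
  note s = expectation_sum_square_indep[OF _ c(1) c(3) c(4)]
  show "integrable M (\<lambda>w. (local_fluct \<phi> (n, w))\<^sup>2)"
    unfolding local_fluct_eq[OF n0] using s by simp
  have "expectation (\<lambda>w. (local_fluct \<phi> (n, w))\<^sup>2) =
     local_mean (\<lambda>t. (\<phi> t)\<^sup>2) n - h n * (local_mean \<phi> n)\<^sup>2"
    unfolding local_fluct_eq[OF n0] using s c(5) n0 by simp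
  also have "\<dots> \<le> local_mean (\<lambda>t. (\<phi> t)\<^sup>2) n" using h_pos[of n] by simp
  also have "\<dots> \<le> f_bound * (LINT t|lborel. (\<phi> t)\<^sup>2)"
    using integrable_mult_f(2)[OF n kernel_funD(3)[OF \<phi>]] f_nonneg
    by (simp add: local_mean_def abs_mult kernel_funD(2)[OF \<phi>])
  finally show "expectation (\<lambda>w. (local_fluct \<phi> (n, w))\<^sup>2) \<le> f_bound * (LINT t|lborel. (\<phi> t)\<^sup>2)" .
qed

lemma local_fluct_tight:
  assumes "kernel_fun z \<phi>"
  shows "bounded_in_prob (local_fluct \<phi>)"
proof (rule bounded_in_prob_second_moment)
  show "\<forall>\<^sub>F n in sequentially. (\<lambda>w. local_fluct \<phi> (n, w)) \<in> borel_measurable M"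
    using local_fluct_measurable kernel_funD(1)[OF assms] by simp
  show "\<forall>\<^sub>F n in sequentially. integrable M (\<lambda>w. (local_fluct \<phi> (n, w))\<^sup>2)"
    using eventually_well_placed by eventually_elim (rule local_fluct_second_moment[OF assms])
  show "\<forall>\<^sub>F n in sequentially. expectation (\<lambda>w. (local_fluct \<phi> (n, w))\<^sup>2) \<le> f_bound * (LINT t|lborel. (\<phi> t)\<^sup>2)"
    using eventually_well_placed by eventually_elim (rule local_fluct_second_moment[OF assms])
qed

text \<open>The average is its mean plus the tight fluctuation divided by sqrt(n h), which
  diverges.\<close>

lemma local_avg_lim:
  assumes \<phi>: "kernel_fun z \<phi>"
  shows "(local_avg \<phi> \<longlongrightarrow> f0 * (LINT t|lborel. \<phi> t)) in_prob"
proof -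
  have "(\<lambda>n. 1 / sqrt (real n * h n)) \<longlonglongrightarrow> 0"
    using nh by (intro tendsto_divide_0[OF tendsto_const] filterlim_at_top_imp_at_infinity
        filterlim_compose[OF sqrt_at_top]) auto
  then have "((\<lambda>p. 1 / sqrt (real (fst p) * h (fst p)) * local_fluct \<phi> p) \<longlongrightarrow> 0) in_prob"
    by (intro bounded_in_prob_mult_0[OF local_fluct_tight[OF \<phi>]] tendsto_in_prob_const)
  moreover have "((\<lambda>p. local_mean \<phi> (fst p)) \<longlongrightarrow> f0 * (LINT t|lborel. \<phi> t)) in_prob"
    by (intro tendsto_in_prob_const local_mean_lim kernel_fun_integrable[OF \<phi>] kernel_funD(2)[OF \<phi>])
  ultimately have "((\<lambda>p. 1 / sqrt (real (fst p) * h (fst p)) * local_fluct \<phi> p + local_mean \<phi> (fst p))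
      \<longlongrightarrow> 0 + f0 * (LINT t|lborel. \<phi> t)) in_prob"
    by (rule tendsto_add)
  moreover have "\<forall>\<^sub>F p in in_prob. 1 / sqrt (real (fst p) * h (fst p)) * local_fluct \<phi> p + local_mean \<phi> (fst p) = local_avg \<phi> p"
    using eventually_in_prob_const[OF eventually_gt_at_top[of 0]]
    by eventually_elim (use h_pos in \<open>simp add: local_fluct_def less_imp_neq[OF h_pos, symmetric]\<close>)
  ultimately show ?thesis by (simp add: tendsto_cong)
qed

text \<open>Each of the n factors of the characteristic function is within o(1 / n) of 1 - t^2 V /
  (2 n), and a product of numbers of modulus at most one changes by no more than the sum of the
  changes of its factors. The shift B is carried along so that the result can be compared with the
  estimator directly.\<close>

lemma local_fluct_clt:
  assumes \<phi>: "kernel_fun z \<phi>" and V: "V = f0 * (LINT t|lborel. (\<phi> t)\<^sup>2)" "0 < V"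
  shows "weak_conv_m (\<lambda>n. distr M borel (\<lambda>w. local_fluct \<phi> (n, w) + B))
    (density lborel (\<lambda>y. ennreal (normal_density B (sqrt V) y)))"
proof (rule levy_continuity)
  note [measurable] = kernel_funD(1)[OF \<phi>] local_fluct_measurable[OF kernel_funD(1)[OF \<phi>]]
  show "real_distribution (distr M borel (\<lambda>w. local_fluct \<phi> (n, w) + B))" for n
    by (rule real_distribution_distr) simp
  show "real_distribution (density lborel (\<lambda>y. ennreal (normal_density B (sqrt V) y)))"
    using V by (intro normal_distribution_real_distribution) simp
  fix t :: real
  define a where "a = t\<^sup>2 * V / 2"
  define v where "v n = local_mean (\<lambda>t. (\<phi> t)\<^sup>2) n - h n * (local_mean \<phi> n)\<^sup>2" for n
  \<comment> \<open>The constants 24 and 8 come from evaluating min(6 y^2, |t| |y|^3) at twice its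
    argument, the price of separating the kernel from its centring.\<close>
  define I where "I n = (LINT u|lborel. min (24 * (\<phi> u)\<^sup>2) (8 * \<bar>t\<bar> * \<bar>\<phi> u\<bar> ^ 3 / sqrt (real n * h n)))" for n
  define R where "R n = 8 * \<bar>t\<bar> * ((h n)\<^sup>2 * \<bar>local_mean \<phi> n\<bar> ^ 3 / sqrt (real n * h n))" for n
  have a: "0 \<le> a" using V by (simp add: a_def)
  have sq_top: "filterlim (\<lambda>n. sqrt (real n * h n)) at_top sequentially"
    by (rule filterlim_compose[OF sqrt_at_top nh])
  have inv0: "(\<lambda>n. c / sqrt (real n * h n)) \<longlonglongrightarrow> 0" for c
    by (intro tendsto_divide_0[OF tendsto_const] filterlim_at_top_imp_at_infinity sq_top)
  have mean_lim: "local_mean \<phi> \<longlonglongrightarrow> f0 * (LINT t|lborel. \<phi> t)"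
    by (intro local_mean_lim kernel_fun_integrable[OF \<phi>] kernel_funD(2)[OF \<phi>])
  have v_lim: "v \<longlonglongrightarrow> V"
  proof -
    have "v \<longlonglongrightarrow> V - 0 * (f0 * (LINT t|lborel. \<phi> t))\<^sup>2"
      unfolding v_def V(1)
      by (intro tendsto_intros h_lim mean_lim local_mean_lim) (simp_all add: kernel_funD(2,3)[OF \<phi>])
    then show ?thesis by simp
  qed
  have I_lim: "I \<longlonglongrightarrow> 0"
  proof -
    have "I \<longlonglongrightarrow> (LINT (u::real)|lborel. (0::real))"
      unfolding I_def
    proof (rule integral_dominated_convergence[where w="\<lambda>u. 24 * (\<phi> u)\<^sup>2"])
      show "integrable lborel (\<lambda>u. 24 * (\<phi> u)\<^sup>2)" using kernel_funD(3)[OF \<phi>] by simp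
      show "AE u in lborel. (\<lambda>n. min (24 * (\<phi> u)\<^sup>2) (8 * \<bar>t\<bar> * \<bar>\<phi> u\<bar> ^ 3 / sqrt (real n * h n))) \<longlonglongrightarrow> 0"
      proof (rule AE_I2)
        fix u
        have "(\<lambda>n. min (24 * (\<phi> u)\<^sup>2) (8 * \<bar>t\<bar> * \<bar>\<phi> u\<bar> ^ 3 / sqrt (real n * h n))) \<longlonglongrightarrow> min (24 * (\<phi> u)\<^sup>2) 0"
          by (intro tendsto_min inv0 tendsto_const)
        then show "(\<lambda>n. min (24 * (\<phi> u)\<^sup>2) (8 * \<bar>t\<bar> * \<bar>\<phi> u\<bar> ^ 3 / sqrt (real n * h n))) \<longlonglongrightarrow> 0"
          by (simp add: min_absorb2)
      qed
      show "AE u in lborel. norm (min (24 * (\<phi> u)\<^sup>2) (8 * \<bar>t\<bar> * \<bar>\<phi> u\<bar> ^ 3 / sqrt (real n * h n))) \<le> 24 * (\<phi> u)\<^sup>2" for n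
        using h_pos[of n] by (intro AE_I2) (auto simp: less_imp_le)
    qed simp_all
    then show ?thesis by simp
  qed
  have R_lim: "R \<longlonglongrightarrow> 0"
  proof -
    have "(\<lambda>n. 8 * \<bar>t\<bar> * ((h n)\<^sup>2 * \<bar>local_mean \<phi> n\<bar> ^ 3 * (1 / sqrt (real n * h n)))) \<longlonglongrightarrow>
        8 * \<bar>t\<bar> * (0\<^sup>2 * \<bar>f0 * (LINT t|lborel. \<phi> t)\<bar> ^ 3 * 0)"
      by (intro tendsto_intros h_lim mean_lim inv0)
    then show ?thesis unfolding R_def by simp
  qed
  \<comment> \<open>\<open>I\<close> and \<open>R\<close> bound the third-order term of each factor: \<open>I\<close> comes from the kernel itself
    (dominated convergence replaces a third moment), \<open>R\<close> from the centring.\<close>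
  have key: "norm (char (distr M borel (\<lambda>w. local_fluct \<phi> (n, w))) t - complex_of_real ((1 - a / real n) ^ n))
      \<le> t\<^sup>2 / 6 * (f_bound * I n + R n) + t\<^sup>2 / 2 * \<bar>v n - V\<bar>"
    if n: "well_placed n" and na: "a \<le> real n" for n
  proof -
    have n0: "0 < n" using n by (simp add: well_placed_def)
    have nh0: "real n * h n > 0" using h_pos[of n] n0 by simp
    define s where "s = sqrt (real n * h n)"
    have s: "s > 0" "s\<^sup>2 = real n * h n" using nh0 by (auto simp: s_def)
    define m where "m = h n * local_mean \<phi> n"
    define Y where "Y i w = (\<phi> ((X i w - x n) / h n) - m) / s" for i w
    have Yeq: "Y i w = \<phi> ((X i w - x n) / h n) / s - m / s" for i w
      unfolding Y_def by (rule diff_divide_distrib)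
    note c = centred_summand[OF \<phi> n, folded m_def s_def, folded Y_def v_def]
    define w where "w = complex_of_real (1 - a / real n)"
    have fl: "(\<lambda>w. local_fluct \<phi> (n, w)) = (\<lambda>w. \<Sum>i\<in>{1..n}. Y i w)"
      by (simp add: fun_eq_iff local_fluct_eq[OF n0] Y_def m_def s_def)
    have Yrv [measurable]: "random_variable borel (Y i)" if "i \<in> {1..n}" for i
      using c(1) that by (auto simp: indep_vars_def)
    \<comment> \<open>The integrand of the remainder in \<open>char_approx3'\<close>: the cubic
      Taylor error, truncated by a quadratic one so that its expectation is finite.\<close>
    define \<psi> where "\<psi> y = min (6 * y\<^sup>2) (\<bar>t\<bar> * \<bar>y\<bar> ^ 3)" for y :: real
    have \<psi>_mono: "\<psi> y \<le> \<psi> y'" if "\<bar>y\<bar> \<le> \<bar>y'\<bar>" for y y'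
      using that power_mono[of "\<bar>y\<bar>" "\<bar>y'\<bar>" 2] power_mono[of "\<bar>y\<bar>" "\<bar>y'\<bar>" 3]
      unfolding \<psi>_def by (intro min.mono mult_left_mono) auto
    have \<psi>_nonneg: "0 \<le> \<psi> y" for y by (simp add: \<psi>_def)
    \<comment> \<open>A difference is at most twice the larger of its two terms in absolute value,
      and \<psi> is monotone in the absolute value.\<close>
    have \<psi>_diff: "\<psi> (y - y') \<le> \<psi> (2 * y) + \<psi> (2 * y')" for y y'
    proof (cases "\<bar>y\<bar> \<le> \<bar>y'\<bar>")
      case True
      then have "\<psi> (y - y') \<le> \<psi> (2 * y')" by (intro \<psi>_mono) auto
      then show ?thesis using \<psi>_nonneg[of "2 * y"] by simp
    next
      case False
      then have "\<psi> (y - y') \<le> \<psi> (2 * y)" by (intro \<psi>_mono) auto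
      then show ?thesis using \<psi>_nonneg[of "2 * y'"] by simp
    qed
    have [measurable]: "\<psi> \<in> borel_measurable borel" unfolding \<psi>_def by measurable
    have \<psi>\<phi>: "real n * h n * \<psi> (2 * (\<phi> u / s)) = min (24 * (\<phi> u)\<^sup>2) (8 * \<bar>t\<bar> * \<bar>\<phi> u\<bar> ^ 3 / s)" for u
    proof -
      have "real n * h n * \<psi> (2 * (\<phi> u / s)) =
          min (s\<^sup>2 * (6 * (2 * (\<phi> u / s))\<^sup>2)) (s\<^sup>2 * (\<bar>t\<bar> * \<bar>2 * (\<phi> u / s)\<bar> ^ 3))"
        unfolding \<psi>_def s(2)[symmetric] by (rule min_mult_distrib_left[THEN trans]) simp
      also have "s\<^sup>2 * (6 * (2 * (\<phi> u / s))\<^sup>2) = 24 * (\<phi> u)\<^sup>2"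
        using s(1) by (simp add: field_simps power2_eq_square)
      also have "s\<^sup>2 * (\<bar>t\<bar> * \<bar>2 * (\<phi> u / s)\<bar> ^ 3) = 8 * \<bar>t\<bar> * \<bar>\<phi> u\<bar> ^ 3 / s"
        using s(1) by (simp add: field_simps power2_eq_square power3_eq_cube abs_mult)
      finally show ?thesis .
    qed
    have intmin: "integrable lborel (\<lambda>u. min (24 * (\<phi> u)\<^sup>2) (8 * \<bar>t\<bar> * \<bar>\<phi> u\<bar> ^ 3 / s))"
    proof (rule Bochner_Integration.integrable_bound)
      show "integrable lborel (\<lambda>u. 24 * (\<phi> u)\<^sup>2)" using kernel_funD(3)[OF \<phi>] by simp
      show "AE u in lborel. norm (min (24 * (\<phi> u)\<^sup>2) (8 * \<bar>t\<bar> * \<bar>\<phi> u\<bar> ^ 3 / s)) \<le> norm (24 * (\<phi> u)\<^sup>2)"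
        using s(1) by (intro AE_I2) auto
    qed simp
    have supp: "min (24 * (\<phi> u)\<^sup>2) (8 * \<bar>t\<bar> * \<bar>\<phi> u\<bar> ^ 3 / s) = 0" if "u \<notin> {-z..1}" for u
      using kernel_funD(2)[OF \<phi> that] by simp
    have main: "norm (char (distr M borel (Y i)) t - w) \<le> (t\<^sup>2 / 6 * (f_bound * I n + R n) + t\<^sup>2 / 2 * \<bar>v n - V\<bar>) / real n"
      if i: "i \<in> {1..n}" for i
    proof -
      have i1: "1 \<le> i" using i by simp
      have int\<phi>: "integrable M (\<lambda>w. \<psi> (2 * (\<phi> ((X i w - x n) / h n) / s)))"
      proof (rule integrable_local[OF i1, of "\<lambda>u. \<psi> (2 * (\<phi> u / s))"])
        have "integrable lborel (\<lambda>u. (real n * h n * \<psi> (2 * (\<phi> u / s))) * f (x n + u * h n))"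
          unfolding \<psi>\<phi> by (rule integrable_mult_f(1)[OF n intmin supp])
        then show "integrable lborel (\<lambda>u. \<psi> (2 * (\<phi> u / s)) * f (x n + u * h n))"
          using nh0 n0 h_pos[of n] by (simp add: mult.assoc)
      qed simp
      have E\<phi>: "real n * expectation (\<lambda>w. \<psi> (2 * (\<phi> ((X i w - x n) / h n) / s))) \<le> f_bound * I n"
      proof -
        have "real n * expectation (\<lambda>w. \<psi> (2 * (\<phi> ((X i w - x n) / h n) / s))) =
          (LINT u|lborel. (real n * h n * \<psi> (2 * (\<phi> u / s))) * f (x n + u * h n))"
          by (subst expectation_local[OF i1, of "\<lambda>u. \<psi> (2 * (\<phi> u / s))"]) (simp_all add: mult.assoc)
        also have "\<dots> \<le> f_bound * I n"
          unfolding \<psi>\<phi> I_def s_def[symmetric]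
          using integrable_mult_f(2)[OF n intmin supp] s(1) f_nonneg by (simp add: abs_mult)
        finally show ?thesis .
      qed
      \<comment> \<open>The centring is of order h, so the cubic branch is enough: n h^3 / (n
        h)^(3/2) = h^2 / sqrt(n h).\<close>
      have Em: "real n * \<psi> (2 * (m / s)) \<le> R n"
      proof -
        have "real n * \<psi> (2 * (m / s)) \<le> real n * (\<bar>t\<bar> * \<bar>2 * (m / s)\<bar> ^ 3)"
          by (intro mult_left_mono) (auto simp: \<psi>_def)
        also have "\<bar>2 * (m / s)\<bar> ^ 3 = 8 * h n ^ 3 * \<bar>local_mean \<phi> n\<bar> ^ 3 / (s\<^sup>2 * s)"
          using s(1) h_pos[of n] by (simp add: m_def abs_mult power3_eq_cube power2_eq_square)
        also have "real n * (\<bar>t\<bar> * \<dots>) = R n"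
          using n0 h_pos[of n] s(1) unfolding s(2) R_def s_def[symmetric]
          by (simp add: field_simps power3_eq_cube power2_eq_square)
        finally show ?thesis .
      qed
      have \<psi>Y: "real n * expectation (\<lambda>w. \<psi> (Y i w)) \<le> f_bound * I n + R n"
      proof -
        have "expectation (\<lambda>w. \<psi> (Y i w)) \<le> expectation (\<lambda>w. \<psi> (2 * (\<phi> ((X i w - x n) / h n) / s)) + \<psi> (2 * (m / s)))"
        proof (rule integral_mono_AE')
          show "integrable M (\<lambda>w. \<psi> (2 * (\<phi> ((X i w - x n) / h n) / s)) + \<psi> (2 * (m / s)))"
            using int\<phi> by simp
          show "AE w in M. \<psi> (Y i w) \<le> \<psi> (2 * (\<phi> ((X i w - x n) / h n) / s)) + \<psi> (2 * (m / s))"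
            using \<psi>_diff by (auto simp only: Yeq intro!: AE_I2)
          show "AE w in M. 0 \<le> \<psi> (2 * (\<phi> ((X i w - x n) / h n) / s)) + \<psi> (2 * (m / s))"
            by (rule AE_I2, rule add_nonneg_nonneg, rule \<psi>_nonneg, rule \<psi>_nonneg)
        qed
        also have "\<dots> = expectation (\<lambda>w. \<psi> (2 * (\<phi> ((X i w - x n) / h n) / s))) + \<psi> (2 * (m / s))"
          using int\<phi> by (simp add: prob_space)
        finally have "real n * expectation (\<lambda>w. \<psi> (Y i w)) \<le>
          real n * (expectation (\<lambda>w. \<psi> (2 * (\<phi> ((X i w - x n) / h n) / s))) + \<psi> (2 * (m / s)))"
          by (intro mult_left_mono) auto
        then show ?thesis using E\<phi> Em by (simp add: distrib_left)
      qed
      \<comment> \<open>The summand is centred with variance \<open>v n / real n\<close>, so its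
        second-order expansion has no linear term.\<close>
      have "norm (char (distr M borel (Y i)) t - (1 - t\<^sup>2 * (v n / real n) / 2)) \<le> t\<^sup>2 / 6 * expectation (\<lambda>w. \<psi> (Y i w))"
        unfolding \<psi>_def using char_approx3'[of "Y i" "v n / real n" _ t] c(2-5)[OF i] Yrv[OF i] by simp
      moreover have "norm (complex_of_real (1 - t\<^sup>2 * (v n / real n) / 2) - w) = t\<^sup>2 / 2 * \<bar>v n - V\<bar> / real n"
      proof -
        have "1 - t\<^sup>2 * (v n / real n) / 2 - (1 - a / real n) = - (t\<^sup>2 / 2 * (v n - V) / real n)"
          using n0 by (simp add: a_def divide_simps) (simp add: algebra_simps)
        then show ?thesis unfolding w_def of_real_diff[symmetric] norm_of_real
          by (simp add: abs_mult)
      qed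
      ultimately have "norm (char (distr M borel (Y i)) t - w) \<le>
          t\<^sup>2 / 6 * expectation (\<lambda>w. \<psi> (Y i w)) + t\<^sup>2 / 2 * \<bar>v n - V\<bar> / real n"
        using norm_triangle_ineq[of "char (distr M borel (Y i)) t - (1 - t\<^sup>2 * (v n / real n) / 2)"
            "complex_of_real (1 - t\<^sup>2 * (v n / real n) / 2) - w"] by simp
      also have "\<dots> = (t\<^sup>2 / 6 * (real n * expectation (\<lambda>w. \<psi> (Y i w))) + t\<^sup>2 / 2 * \<bar>v n - V\<bar>) / real n"
        using n0 by (simp add: add_divide_distrib)
      also have "\<dots> \<le> (t\<^sup>2 / 6 * (f_bound * I n + R n) + t\<^sup>2 / 2 * \<bar>v n - V\<bar>) / real n"
        by (intro divide_right_mono add_right_mono mult_left_mono \<psi>Y) auto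
      finally show ?thesis .
    qed
    have "char (distr M borel (\<lambda>w. local_fluct \<phi> (n, w))) t = (\<Prod>i\<in>{1..n}. char (distr M borel (Y i)) t)"
      unfolding fl by (rule char_distr_sum[OF c(1)])
    moreover have "complex_of_real ((1 - a / real n) ^ n) = (\<Prod>i\<in>{1..n}. w)" by (simp add: w_def)
    moreover have "norm ((\<Prod>i\<in>{1..n}. char (distr M borel (Y i)) t) - (\<Prod>i\<in>{1..n}. w)) \<le>
        (\<Sum>i\<in>{1..n}. norm (char (distr M borel (Y i)) t - w))"
    proof (rule norm_prod_diff)
      show "norm (char (distr M borel (Y i)) t) \<le> 1" if "i \<in> {1..n}" for i
        using that by (intro real_distribution.cmod_char_le_1 real_distribution_distr) simp
      \<comment> \<open>Here \<open>a \<le> real n\<close> matters: it keeps 1 - a / n between 0 and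
        1.\<close>
      show "norm w \<le> 1"
        unfolding w_def norm_of_real using a na n0 by (simp add: abs_le_iff field_simps)
    qed
    moreover have "(\<Sum>i\<in>{1..n}. norm (char (distr M borel (Y i)) t - w)) \<le>
        (\<Sum>i\<in>{1..n}. (t\<^sup>2 / 6 * (f_bound * I n + R n) + t\<^sup>2 / 2 * \<bar>v n - V\<bar>) / real n)"
      by (rule sum_mono) (rule main)
    ultimately show ?thesis using n0 by simp
  qed
  have "(\<lambda>n. char (distr M borel (\<lambda>w. local_fluct \<phi> (n, w))) t - complex_of_real ((1 - a / real n) ^ n)) \<longlonglongrightarrow> 0"
  proof (rule Lim_null_comparison)
    have "(\<lambda>n. t\<^sup>2 / 6 * (f_bound * I n + R n) + t\<^sup>2 / 2 * \<bar>v n - V\<bar>) \<longlonglongrightarrow>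
      t\<^sup>2 / 6 * (f_bound * 0 + 0) + t\<^sup>2 / 2 * \<bar>V - V\<bar>"
      by (intro tendsto_intros I_lim R_lim v_lim)
    then show "(\<lambda>n. t\<^sup>2 / 6 * (f_bound * I n + R n) + t\<^sup>2 / 2 * \<bar>v n - V\<bar>) \<longlonglongrightarrow> 0" by simp
    have "\<forall>\<^sub>F n in sequentially. a \<le> real n"
      using filterlim_real_sequentially by (simp add: filterlim_at_top)
    then show "\<forall>\<^sub>F n in sequentially. norm (char (distr M borel (\<lambda>w. local_fluct \<phi> (n, w))) t
        - complex_of_real ((1 - a / real n) ^ n)) \<le> t\<^sup>2 / 6 * (f_bound * I n + R n) + t\<^sup>2 / 2 * \<bar>v n - V\<bar>"
      using eventually_well_placed by eventually_elim (rule key)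
  qed
  moreover have "(\<lambda>n. complex_of_real ((1 - a / real n) ^ n)) \<longlonglongrightarrow> complex_of_real (exp (- a))"
    using tendsto_exp_limit_sequentially[of "- a"] by (intro tendsto_of_real) simp
  ultimately have "(\<lambda>n. (char (distr M borel (\<lambda>w. local_fluct \<phi> (n, w))) t - complex_of_real ((1 - a / real n) ^ n))
      + complex_of_real ((1 - a / real n) ^ n)) \<longlonglongrightarrow> 0 + complex_of_real (exp (- a))"
    by (rule tendsto_add)
  then have "(\<lambda>n. char (distr M borel (\<lambda>w. local_fluct \<phi> (n, w))) t) \<longlonglongrightarrow> complex_of_real (exp (- a))"
    by simp
  then have "(\<lambda>n. iexp (t * B) * char (distr M borel (\<lambda>w. local_fluct \<phi> (n, w))) t) \<longlonglongrightarrow>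
      iexp (t * B) * complex_of_real (exp (- a))"
    by (rule tendsto_mult_left)
  moreover have "char (distr M borel (\<lambda>w. local_fluct \<phi> (n, w) + B)) t =
      iexp (t * B) * char (distr M borel (\<lambda>w. local_fluct \<phi> (n, w))) t" for n
    using char_affine[of "\<lambda>w. local_fluct \<phi> (n, w)" B 1 t] by (simp add: add.commute)
  ultimately show "(\<lambda>n. char (distr M borel (\<lambda>w. local_fluct \<phi> (n, w) + B)) t) \<longlonglongrightarrow>
      char (density lborel (\<lambda>y. ennreal (normal_density B (sqrt V) y))) t"
    using V by (simp add: char_normal_distribution a_def)
qed

end

section \<open>Taylor expansion and integration by parts\<close>

text \<open>Subtracting the monomial of degree k with coefficient \<open>D k a / fact k\<close>
  turns the k-th derivative into \<open>D k y - D k a\<close>, which e bounds; Taylor's theorem to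
  order k - 1 then applies to the difference. Working within a convex set covers one-sided
  derivatives.\<close>

lemma taylor_within_modulus:
  fixes D :: "nat \<Rightarrow> real \<Rightarrow> real"
  assumes I: "convex I"
    and D: "\<And>i y. i < k \<Longrightarrow> y \<in> I \<Longrightarrow> (D i has_real_derivative D (Suc i) y) (at y within I)"
    and e: "\<And>y. y \<in> I \<Longrightarrow> \<bar>D k y - D k a\<bar> \<le> e"
    and ab: "a \<in> I" "b \<in> I"
  shows "\<bar>D 0 b - (\<Sum>i\<le>k. D i a * (b - a) ^ i / fact i)\<bar> \<le> e * \<bar>b - a\<bar> ^ k"
proof (cases k)
  case 0
  then show ?thesis using e[OF ab(2)] by simp
next
  case (Suc n)
  define F where "F i y = D i y - D k a * (y - a) ^ (k - i) / fact (k - i)" for i y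
  have "norm (F 0 b - (\<Sum>i\<le>n. F i a * (b - a) ^ i / fact i)) \<le> e * norm (b - a) ^ Suc n / fact n"
  proof (rule field_Taylor[OF I])
    fix i y assume y: "y \<in> I" and i: "i \<le> n"
    then have "k - i = Suc (n - i)" "k - Suc i = n - i" using Suc by auto
    moreover have "((\<lambda>y. D i y - D k a / fact (Suc (n - i)) * (y - a) ^ Suc (n - i)) has_real_derivative
       D (Suc i) y - D k a / fact (Suc (n - i)) * ((1 + real (n - i)) * (1 * (y - a) ^ (n - i)))) (at y within I)"
      using i Suc by (intro DERIV_diff DERIV_cmult DERIV_power_Suc D y) (auto intro!: derivative_eq_intros)
    moreover have "D k a / fact (Suc (n - i)) * ((1 + real (n - i)) * (1 * (y - a) ^ (n - i))) =
       D k a * (y - a) ^ (n - i) / fact (n - i)"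
      unfolding fact_Suc by (simp add: divide_simps)
    ultimately show "(F i has_real_derivative F (Suc i) y) (at y within I)"
      unfolding F_def by (simp only: times_divide_eq_left)
  next
    show "norm (F (Suc n) y) \<le> e" if "y \<in> I" for y using e[OF that] by (simp add: F_def Suc)
  qed (use ab in auto)
  moreover have "F i a = D i a" if "i \<le> n" for i using that Suc by (simp add: F_def)
  then have "(\<Sum>i\<le>n. F i a * (b - a) ^ i / fact i) = (\<Sum>i\<le>n. D i a * (b - a) ^ i / fact i)"
    by (intro sum.cong) auto
  moreover have "e * norm (b - a) ^ Suc n / fact n \<le> e * \<bar>b - a\<bar> ^ k"
  proof -
    have "0 \<le> e" using e[OF ab(1)] by simp
    then have "0 \<le> e * \<bar>b - a\<bar> ^ k" by simp
    then have "e * \<bar>b - a\<bar> ^ k * 1 \<le> e * \<bar>b - a\<bar> ^ k * fact n"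
      by (intro mult_left_mono fact_ge_1)
    then show ?thesis using Suc by (simp add: divide_le_eq)
  qed
  ultimately show ?thesis using Suc by (simp add: F_def algebra_simps)
qed

lemma abs_exp_minus_one_le: "\<bar>exp x - 1\<bar> \<le> exp \<bar>x\<bar> - (1::real)"
proof (cases "0 \<le> x")
  case False
  then have "exp x \<le> 1" "\<bar>x\<bar> = - x" by simp_all
  then show ?thesis using exp_ge_add_one_self[of x] exp_ge_add_one_self[of "- x"] by linarith
qed simp

text \<open>By the mean value theorem the increment is v times an exponential at a point of size at
  most |u| + |v|. The linear term is v rather than v exp(u) because u will tend to zero as
  well.\<close>

lemma exp_first_order:
  fixes u v :: real
  shows "\<bar>exp (u + v) - exp u - v\<bar> \<le> \<bar>v\<bar> * (exp (\<bar>u\<bar> + \<bar>v\<bar>) - 1)"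
proof -
  have "\<exists>\<xi>. \<bar>\<xi>\<bar> \<le> \<bar>u\<bar> + \<bar>v\<bar> \<and> exp (u + v) - exp u = v * exp \<xi>"
  proof (cases "v = 0")
    case False
    define F where "F s = exp (u + s * v)" for s
    have "\<exists>s. 0 < s \<and> s < 1 \<and> F 1 - F 0 = (1 - 0) * (v * exp (u + s * v))"
      unfolding F_def by (rule MVT2) (auto intro!: derivative_eq_intros)
    then obtain s where s: "0 < s" "s < 1" "F 1 - F 0 = v * exp (u + s * v)" by auto
    have "\<bar>u + s * v\<bar> \<le> \<bar>u\<bar> + \<bar>v\<bar>"
      using abs_triangle_ineq[of u "s * v"] s mult_right_mono[of s 1 "\<bar>v\<bar>"] by (simp add: abs_mult)
    then show ?thesis using s(3) by (intro exI[of _ "u + s * v"]) (simp add: F_def)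
  qed auto
  then obtain \<xi> where \<xi>: "\<bar>\<xi>\<bar> \<le> \<bar>u\<bar> + \<bar>v\<bar>" "exp (u + v) - exp u = v * exp \<xi>" by blast
  then have "\<bar>exp (u + v) - exp u - v\<bar> = \<bar>v\<bar> * \<bar>exp \<xi> - 1\<bar>"
    by (simp add: abs_mult[symmetric] algebra_simps)
  also have "\<dots> \<le> \<bar>v\<bar> * (exp (\<bar>u\<bar> + \<bar>v\<bar>) - 1)"
    using abs_exp_minus_one_le[of \<xi>] \<xi>(1) by (intro mult_left_mono order_trans[OF abs_exp_minus_one_le]) auto
  finally show ?thesis .
qed

section \<open>Kernels on an interval and integration by parts\<close>

lemma continuous_kernel_fun:
  assumes "continuous_on {-z..1} G" "\<And>t. t \<notin> {-z..1} \<Longrightarrow> G t = 0"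
  shows "kernel_fun z G"
  unfolding kernel_fun_def
proof (intro conjI)
  have eq: "G = (\<lambda>t. indicator {-z..1} t *\<^sub>R G t)" using assms(2) by (auto simp: fun_eq_iff split: split_indicator)
  show "G \<in> borel_measurable borel"
    by (subst eq) (intro borel_measurable_continuous_on_indicator assms(1), simp)
  show "\<forall>t. t \<notin> {-z..1} \<longrightarrow> G t = 0" using assms(2) by simp
  have "set_integrable lborel {-z..1} (\<lambda>t. (G t)\<^sup>2)"
    by (intro borel_integrable_atLeastAtMost' continuous_intros assms(1))
  moreover have "(\<lambda>t. indicator {-z..1} t *\<^sub>R (G t)\<^sup>2) = (\<lambda>t. (G t)\<^sup>2)"
    using assms(2) by (auto simp: fun_eq_iff split: split_indicator)
  ultimately show "integrable lborel (\<lambda>t. (G t)\<^sup>2)" by (simp add: set_integrable_def)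
qed

text \<open>\<open>G'\<close> need not be continuous; its measurability comes from writing it as a
  pointwise limit of difference quotients of the continuous G.\<close>

lemma derivative_kernel_fun:
  assumes G: "\<And>t. t \<in> {-z..1} \<Longrightarrow> (G has_real_derivative G' t) (at t within {-z..1})"
    and supp: "\<And>t. t \<notin> {-z..1} \<Longrightarrow> G t = 0" "\<And>t. t \<notin> {-z..1} \<Longrightarrow> G' t = 0"
    and sq: "set_integrable lborel {-z..1} (\<lambda>t. (G' t)\<^sup>2)"
  shows "kernel_fun z G" "kernel_fun z G'"
proof -
  have cont: "continuous_on {-z..1} G"
    using G by (rule DERIV_continuous_on)
  show kG: "kernel_fun z G" by (rule continuous_kernel_fun[OF cont supp(1)])
  note [measurable] = kernel_funD(1)[OF kG]
  define d where "d n = 1 / real (Suc n)" for n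
  have d: "d n > 0" "d \<longlonglongrightarrow> 0" for n
    using LIMSEQ_inverse_real_of_nat by (simp_all add: d_def [abs_def] divide_inverse)
  \<comment> \<open>Forward quotients would leave the interval at t = 1, so the value there is put
    in by hand.\<close>
  define Q where "Q n t = indicator {-z..<1} t * ((G (t + d n) - G t) / d n) + indicator {1} t * G' 1" for n t
  have "(\<lambda>n. Q n t) \<longlonglongrightarrow> G' t" for t
  proof (cases "t \<in> {-z..<1}")
    case True
    then have lim: "((\<lambda>s. (G s - G t) / (s - t)) \<longlongrightarrow> G' t) (at t within {-z..1})"
      using G[of t] by (simp add: has_field_derivative_iff)
    have "\<forall>\<^sub>F n in sequentially. d n < 1 - t"
      using d(2) True by (intro order_tendstoD(2)) auto
    then have ev: "\<forall>\<^sub>F n in sequentially. t + d n \<in> {-z..1} \<and> t + d n \<noteq> t"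
      by eventually_elim (use d(1) True in \<open>auto simp: less_imp_neq[symmetric] less_imp_le add_increasing2\<close>)
    have "filterlim (\<lambda>n. t + d n) (at t within {-z..1}) sequentially"
      unfolding filterlim_at using ev tendsto_add[OF tendsto_const[of t] d(2)] by (simp add: eventually_conj_iff)
    from filterlim_compose[OF lim this] have "(\<lambda>n. (G (t + d n) - G t) / d n) \<longlonglongrightarrow> G' t" by simp
    then show ?thesis using True by (simp add: Q_def)
  next
    case False
    then show ?thesis using supp(2)[of t] by (cases "t = 1") (auto simp: Q_def)
  qed
  moreover have "Q n \<in> borel_measurable borel" for n unfolding Q_def by measurable
  ultimately have "G' \<in> borel_measurable borel" by (rule borel_measurable_LIMSEQ_real)
  moreover have "(\<lambda>t. indicator {-z..1} t *\<^sub>R (G' t)\<^sup>2) = (\<lambda>t. (G' t)\<^sup>2)"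
    using supp(2) by (auto simp: fun_eq_iff split: split_indicator)
  ultimately show "kernel_fun z G'" using sq supp(2) by (simp add: kernel_fun_def set_integrable_def)
qed

lemma set_integral_supported:
  fixes u v :: "real \<Rightarrow> real"
  assumes "\<And>t. t \<notin> A \<Longrightarrow> u t = 0"
  shows "(LINT t:A|lborel. u t * v t) = (LINT t|lborel. u t * v t)"
  unfolding set_lebesgue_integral_def
  by (rule Bochner_Integration.integral_cong) (auto simp: assms split: split_indicator)

text \<open>The gauge integral has a fundamental theorem for every everywhere differentiable
  function, so the discontinuity of \<open>G'\<close> does no harm. Both summands are Lebesgue
  integrable, hence the two integrals agree, and the boundary terms vanish with G.\<close>

lemma integral_by_parts_kernel:
  assumes z: "-z \<le> 1" and k: "kernel_fun z G'"
    and G: "\<And>t. t \<in> {-z..1} \<Longrightarrow> (G has_real_derivative G' t) (at t within {-z..1})"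
    and G0: "\<And>t. t \<notin> {-z..1} \<Longrightarrow> G t = 0" "G (-z) = 0" "G 1 = 0"
    and u: "\<And>t. t \<in> {-z..1} \<Longrightarrow> (u has_real_derivative u' t) (at t within {-z..1})"
    and u': "continuous_on {-z..1} u'"
  shows "(LINT t|lborel. G' t * u t) = - (LINT t|lborel. G t * u' t)"
proof -
  have cG: "continuous_on {-z..1} G" "continuous_on {-z..1} u"
    by (rule DERIV_continuous_on[OF G], assumption, rule DERIV_continuous_on[OF u], assumption)
  have i2: "set_integrable lborel {-z..1} (\<lambda>t. G t * u' t)"
    by (intro borel_integrable_atLeastAtMost' continuous_intros cG u')
  obtain C where "\<forall>t\<in>{-z..1}. \<bar>u t\<bar> \<le> C"
    using compact_imp_bounded[OF compact_continuous_image[OF cG(2) compact_Icc]]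
    unfolding bounded_iff by auto
  note C = this[rule_format]
  have "kernel_fun z (\<lambda>t. G' t * (indicator {-z..1} t *\<^sub>R u t))"
  proof (rule kernel_fun_mult_bounded[OF k, where C=C])
    show "(\<lambda>t. indicator {-z..1} t *\<^sub>R u t) \<in> borel_measurable borel"
      by (intro borel_measurable_continuous_on_indicator cG) simp
  qed (simp add: C)
  from kernel_fun_integrable[OF this]
  have i1: "set_integrable lborel {-z..1} (\<lambda>t. G' t * u t)"
    unfolding set_integrable_def by (simp add: mult_ac)
  have "((\<lambda>t. G' t * u t + G t * u' t) has_integral G 1 * u 1 - G (-z) * u (-z)) {-z..1}"
  proof (rule fundamental_theorem_of_calculus[OF z])
    fix t assume t: "t \<in> {-z..1}"
    show "((\<lambda>t. G t * u t) has_vector_derivative G' t * u t + G t * u' t) (at t within {-z..1})"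
      using DERIV_mult[OF G[OF t] u[OF t]]
      by (simp add: has_real_derivative_iff_has_vector_derivative mult.commute add.commute)
  qed
  then have "integral {-z..1} (\<lambda>t. G' t * u t + G t * u' t) = 0" using G0 by (simp add: integral_unique)
  moreover have "integral {-z..1} (\<lambda>t. G' t * u t + G t * u' t) =
      (LINT t:{-z..1}|lborel. G' t * u t) + (LINT t:{-z..1}|lborel. G t * u' t)"
    using set_borel_integral_eq_integral(2)[OF set_integral_add(1)[OF i1 i2]] set_integral_add(2)[OF i1 i2] by simp
  ultimately show ?thesis
    using set_integral_supported[of "{-z..1}" G' u] set_integral_supported[of "{-z..1}" G u']
      kernel_funD(2)[OF k] G0(1) by auto
qed

section \<open>Expansion of the estimator\<close>

text \<open>The denominator of the density estimator as a function of the rescaled coefficients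
  \<open>h^s \<beta>_s\<close>.\<close>

definition exp_moment :: "nat \<Rightarrow> (real \<Rightarrow> real) \<Rightarrow> (nat \<Rightarrow> real) \<Rightarrow> real" where
  "exp_moment S m \<gamma> = (LINT t|lborel. m t * exp (\<Sum>s=1..S. \<gamma> s * t ^ s / fact s))"

lemma abs_poly_le:
  assumes "\<bar>t\<bar> \<le> (1::real)"
  shows "\<bar>\<Sum>s=1..S. \<gamma> s * t ^ s / fact s\<bar> \<le> (\<Sum>s=1..S. \<bar>\<gamma> s\<bar>)"
proof (rule order_trans[OF sum_abs sum_mono])
  fix s
  have "\<bar>t\<bar> ^ s \<le> 1" using assms by (intro power_le_one) auto
  moreover have "(1::real) \<le> fact s" by (rule fact_ge_1)
  ultimately have "\<bar>t\<bar> ^ s \<le> fact s" by (rule order_trans)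
  then have "\<bar>t\<bar> ^ s / fact s \<le> 1" by (simp add: divide_le_eq)
  then have "\<bar>\<gamma> s\<bar> * (\<bar>t\<bar> ^ s / fact s) \<le> \<bar>\<gamma> s\<bar> * 1" by (intro mult_left_mono) auto
  then show "\<bar>\<gamma> s * t ^ s / fact s\<bar> \<le> \<bar>\<gamma> s\<bar>" by (simp add: abs_mult power_abs)
qed

lemma exp_poly_kernel_fun:
  assumes m: "kernel_fun z m" and z: "z \<le> 1"
  shows "kernel_fun z (\<lambda>t. m t * exp (\<Sum>s=1..S. \<gamma> s * t ^ s / fact s))"
proof (rule kernel_fun_mult_bounded[OF m])
  fix t assume "t \<in> {-z..1}"
  then have "\<bar>t\<bar> \<le> 1" using z by (auto simp: abs_le_iff)
  from abs_poly_le[OF this, of \<gamma> S] show "\<bar>exp (\<Sum>s=1..S. \<gamma> s * t ^ s / fact s)\<bar> \<le> exp (\<Sum>s=1..S. \<bar>\<gamma> s\<bar>)"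
    by simp
qed measurable

lemma power_kernel_fun:
  assumes m: "kernel_fun z m" and z: "z \<le> 1"
  shows "kernel_fun z (\<lambda>t. m t * t ^ s)"
proof (rule kernel_fun_mult_bounded[OF m, where C=1])
  fix t assume "t \<in> {-z..1}"
  then have "\<bar>t\<bar> \<le> 1" using z by (auto simp: abs_le_iff)
  then show "\<bar>t ^ s\<bar> \<le> 1" by (simp add: power_abs power_le_one)
qed measurable

text \<open>Linearises the denominator with the derivative taken at zero coefficients, where it is
  the vector of constants c. Since \<open>m\<close> is a probability density, a uniform bound on the
  error of the exponential survives integration unchanged.\<close>

lemma exp_moment_first_order:
  assumes m: "kernel_fun z m" "\<And>t. 0 \<le> m t" "(LINT t|lborel. m t) = 1" and z: "z \<le> 1"
  shows "\<bar>exp_moment S m (\<lambda>s. \<gamma> s + \<delta> s) - exp_moment S m \<gamma> - (\<Sum>s=1..S. \<delta> s * (LINT t|lborel. m t * t ^ s) / fact s)\<bar>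
    \<le> (\<Sum>s=1..S. \<bar>\<delta> s\<bar>) * (exp ((\<Sum>s=1..S. \<bar>\<gamma> s\<bar>) + (\<Sum>s=1..S. \<bar>\<delta> s\<bar>)) - 1)" (is "_ \<le> ?C")
proof -
  define p where "p \<gamma> t = (\<Sum>s=1..S. \<gamma> s * t ^ s / fact s)" for \<gamma> :: "nat \<Rightarrow> real" and t
  have p_add: "p (\<lambda>s. \<gamma> s + \<delta> s) t = p \<gamma> t + p \<delta> t" for t
    by (simp add: p_def sum.distrib ring_distribs add_divide_distrib)
  note i = kernel_fun_integrable[OF exp_poly_kernel_fun[OF m(1) z, where S=S], folded p_def]
  have ip: "integrable lborel (\<lambda>t. m t * t ^ s)" for s
    by (rule kernel_fun_integrable[OF power_kernel_fun[OF m(1) z]])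
  have m\<delta>: "m t * p \<delta> t = (\<Sum>s=1..S. \<delta> s / fact s * (m t * t ^ s))" for t
    by (simp add: p_def sum_distrib_left mult_ac)
  have i\<delta>: "integrable lborel (\<lambda>t. m t * p \<delta> t)" unfolding m\<delta> using ip by auto
  have "(LINT t|lborel. m t * p \<delta> t) = (\<Sum>s=1..S. \<delta> s * (LINT t|lborel. m t * t ^ s) / fact s)"
    unfolding m\<delta> using ip by simp
  then have eq: "exp_moment S m (\<lambda>s. \<gamma> s + \<delta> s) - exp_moment S m \<gamma> - (\<Sum>s=1..S. \<delta> s * (LINT t|lborel. m t * t ^ s) / fact s)
     = (LINT t|lborel. m t * exp (p (\<lambda>s. \<gamma> s + \<delta> s) t) - m t * exp (p \<gamma> t) - m t * p \<delta> t)"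
    unfolding exp_moment_def p_def[symmetric] using i i\<delta> by simp
  have "\<bar>exp_moment S m (\<lambda>s. \<gamma> s + \<delta> s) - exp_moment S m \<gamma> - (\<Sum>s=1..S. \<delta> s * (LINT t|lborel. m t * t ^ s) / fact s)\<bar>
    \<le> (LINT t|lborel. \<bar>m t * exp (p (\<lambda>s. \<gamma> s + \<delta> s) t) - m t * exp (p \<gamma> t) - m t * p \<delta> t\<bar>)"
    unfolding eq by (rule integral_abs_bound)
  also have "\<dots> \<le> (LINT t|lborel. ?C * m t)"
  proof (rule integral_mono)
    show "integrable lborel (\<lambda>t. \<bar>m t * exp (p (\<lambda>s. \<gamma> s + \<delta> s) t) - m t * exp (p \<gamma> t) - m t * p \<delta> t\<bar>)"
      by (intro integrable_abs Bochner_Integration.integrable_diff i i\<delta>)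
    show "integrable lborel (\<lambda>t. ?C * m t)" using kernel_fun_integrable[OF m(1)] by simp
    fix t
    show "\<bar>m t * exp (p (\<lambda>s. \<gamma> s + \<delta> s) t) - m t * exp (p \<gamma> t) - m t * p \<delta> t\<bar> \<le> ?C * m t"
    proof (cases "t \<in> {-z..1}")
      case True
      then have t: "\<bar>t\<bar> \<le> 1" using z by (auto simp: abs_le_iff)
      have "m t * exp (p (\<lambda>s. \<gamma> s + \<delta> s) t) - m t * exp (p \<gamma> t) - m t * p \<delta> t
        = m t * (exp (p \<gamma> t + p \<delta> t) - exp (p \<gamma> t) - p \<delta> t)"
        by (simp only: p_add) (simp add: algebra_simps)
      then have "\<bar>m t * exp (p (\<lambda>s. \<gamma> s + \<delta> s) t) - m t * exp (p \<gamma> t) - m t * p \<delta> t\<bar> =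
         \<bar>exp (p \<gamma> t + p \<delta> t) - exp (p \<gamma> t) - p \<delta> t\<bar> * m t"
        using m(2)[of t] by (simp add: abs_mult)
      also have "\<dots> \<le> (\<bar>p \<delta> t\<bar> * (exp (\<bar>p \<gamma> t\<bar> + \<bar>p \<delta> t\<bar>) - 1)) * m t"
        by (intro mult_right_mono exp_first_order m(2))
      also have "\<dots> \<le> ?C * m t"
        using abs_poly_le[OF t, of \<gamma> S] abs_poly_le[OF t, of \<delta> S] m(2)
        unfolding p_def[symmetric] by (intro mult_right_mono mult_mono diff_right_mono) (auto intro!: sum_nonneg)
      finally show ?thesis .
    qed (simp add: kernel_funD(2)[OF m(1)])
  qed
  also have "\<dots> = ?C" using m(3) by simp
  finally show ?thesis .
qed

section \<open>Perturbation of a linear system\<close>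

text \<open>
  Bounding the solution through the inverse of the limit matrix avoids inverting random matrices;
  with \<open>r = 0\<close> it also shows that the perturbed matrix is nonsingular.
\<close>

lemma perturbed_linear_system:
  fixes A A0 W :: "nat \<Rightarrow> nat \<Rightarrow> real" and c :: real
  assumes W: "\<And>i s. i \<in> {1..S} \<Longrightarrow> s \<in> {1..S} \<Longrightarrow> (\<Sum>j=1..S. W i j * A0 j s) = (if i = s then 1 else 0)"
    and c: "0 < c" and close: "(\<Sum>i=1..S. \<Sum>j=1..S. \<Sum>s=1..S. \<bar>W i j\<bar> * \<bar>A j s - c * A0 j s\<bar>) \<le> c / 2"
    and sys: "\<And>j. j \<in> {1..S} \<Longrightarrow> r j = (\<Sum>s=1..S. \<delta> s * A j s)"
  shows "(\<Sum>i=1..S. \<bar>\<delta> i\<bar>) \<le> 2 / c * (\<Sum>i=1..S. \<Sum>j=1..S. \<bar>W i j\<bar> * \<bar>r j\<bar>)"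
    and "i \<in> {1..S} \<Longrightarrow> c * \<delta> i = (\<Sum>j=1..S. W i j * (r j - (\<Sum>s=1..S. \<delta> s * (A j s - c * A0 j s))))"
proof -
  \<comment> \<open>Splits A into c A0 and the error A - c A0, moves the error to the side of r, and
    applies W.\<close>
  show eq: "c * \<delta> i = (\<Sum>j=1..S. W i j * (r j - (\<Sum>s=1..S. \<delta> s * (A j s - c * A0 j s))))"
    if i: "i \<in> {1..S}" for i
  proof -
    have "(\<Sum>j=1..S. W i j * (r j - (\<Sum>s=1..S. \<delta> s * (A j s - c * A0 j s)))) =
      (\<Sum>j=1..S. W i j * (\<Sum>s=1..S. \<delta> s * (c * A0 j s)))"
    proof (rule sum.cong[OF refl])
      fix j assume "j \<in> {1..S}"
      then have "r j - (\<Sum>s=1..S. \<delta> s * (A j s - c * A0 j s)) = (\<Sum>s=1..S. \<delta> s * (c * A0 j s))"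
        by (simp add: sys right_diff_distrib sum_subtractf)
      then show "W i j * (r j - (\<Sum>s=1..S. \<delta> s * (A j s - c * A0 j s))) = W i j * (\<Sum>s=1..S. \<delta> s * (c * A0 j s))" by simp
    qed
    also have "\<dots> = (\<Sum>j=1..S. \<Sum>s=1..S. c * \<delta> s * (W i j * A0 j s))"
      by (simp add: sum_distrib_left mult_ac)
    also have "\<dots> = (\<Sum>s=1..S. c * \<delta> s * (\<Sum>j=1..S. W i j * A0 j s))"
      by (subst sum.swap) (simp add: sum_distrib_left)
    also have "\<dots> = (\<Sum>s=1..S. c * \<delta> s * (if i = s then 1 else 0))"
      using i by (intro sum.cong refl arg_cong2[where f="(*)"] W) auto
    also have "\<dots> = (\<Sum>s=1..S. if i = s then c * \<delta> s else 0)" by (intro sum.cong) auto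
    also have "\<dots> = c * \<delta> i" using i by (subst sum.delta') auto
    finally show ?thesis ..
  qed
  let ?N = "\<Sum>i=1..S. \<bar>\<delta> i\<bar>"
  have le: "\<bar>\<delta> s\<bar> \<le> ?N" if "s \<in> {1..S}" for s
    using that by (intro member_le_sum) auto
  have "c * ?N = (\<Sum>i=1..S. \<bar>c * \<delta> i\<bar>)" using c by (simp add: sum_distrib_left abs_mult)
  also have "\<dots> \<le> (\<Sum>i=1..S. \<Sum>j=1..S. \<bar>W i j\<bar> * \<bar>r j\<bar> + (\<Sum>s=1..S. \<bar>W i j\<bar> * \<bar>A j s - c * A0 j s\<bar>) * ?N)"
  proof (rule sum_mono)
    fix i assume i: "i \<in> {1..S}"
    have "\<bar>c * \<delta> i\<bar> \<le> (\<Sum>j=1..S. \<bar>W i j * (r j - (\<Sum>s=1..S. \<delta> s * (A j s - c * A0 j s)))\<bar>)"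
      unfolding eq[OF i] by (rule sum_abs)
    also have "\<dots> \<le> (\<Sum>j=1..S. \<bar>W i j\<bar> * \<bar>r j\<bar> + (\<Sum>s=1..S. \<bar>W i j\<bar> * \<bar>A j s - c * A0 j s\<bar>) * ?N)"
    proof (rule sum_mono)
      fix j
      have "\<bar>\<Sum>s=1..S. \<delta> s * (A j s - c * A0 j s)\<bar> \<le> (\<Sum>s=1..S. ?N * \<bar>A j s - c * A0 j s\<bar>)"
      proof (rule order_trans[OF sum_abs sum_mono])
        fix s assume "s \<in> {1..S}"
        then show "\<bar>\<delta> s * (A j s - c * A0 j s)\<bar> \<le> ?N * \<bar>A j s - c * A0 j s\<bar>"
          unfolding abs_mult by (intro mult_right_mono le abs_ge_zero)
      qed
      then have "\<bar>W i j\<bar> * \<bar>\<Sum>s=1..S. \<delta> s * (A j s - c * A0 j s)\<bar> \<le> \<bar>W i j\<bar> * (\<Sum>s=1..S. ?N * \<bar>A j s - c * A0 j s\<bar>)"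
        by (intro mult_left_mono) auto
      also have "\<dots> = (\<Sum>s=1..S. \<bar>W i j\<bar> * \<bar>A j s - c * A0 j s\<bar>) * ?N"
        by (simp only: sum_distrib_left[symmetric]) (simp add: mult_ac)
      finally have 1: "\<bar>W i j\<bar> * \<bar>\<Sum>s=1..S. \<delta> s * (A j s - c * A0 j s)\<bar> \<le>
        (\<Sum>s=1..S. \<bar>W i j\<bar> * \<bar>A j s - c * A0 j s\<bar>) * ?N" .
      have "\<bar>W i j * (r j - (\<Sum>s=1..S. \<delta> s * (A j s - c * A0 j s)))\<bar> \<le>
        \<bar>W i j\<bar> * (\<bar>r j\<bar> + \<bar>\<Sum>s=1..S. \<delta> s * (A j s - c * A0 j s)\<bar>)"
        unfolding abs_mult by (intro mult_left_mono abs_triangle_ineq4) auto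
      also have "\<dots> = \<bar>W i j\<bar> * \<bar>r j\<bar> + \<bar>W i j\<bar> * \<bar>\<Sum>s=1..S. \<delta> s * (A j s - c * A0 j s)\<bar>"
        by (rule distrib_left)
      finally show "\<bar>W i j * (r j - (\<Sum>s=1..S. \<delta> s * (A j s - c * A0 j s)))\<bar> \<le>
        \<bar>W i j\<bar> * \<bar>r j\<bar> + (\<Sum>s=1..S. \<bar>W i j\<bar> * \<bar>A j s - c * A0 j s\<bar>) * ?N"
        using 1 by linarith
    qed
    finally show "\<bar>c * \<delta> i\<bar> \<le> (\<Sum>j=1..S. \<bar>W i j\<bar> * \<bar>r j\<bar> + (\<Sum>s=1..S. \<bar>W i j\<bar> * \<bar>A j s - c * A0 j s\<bar>) * ?N)" .
  qed
  also have "\<dots> = (\<Sum>i=1..S. \<Sum>j=1..S. \<bar>W i j\<bar> * \<bar>r j\<bar>) +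
      (\<Sum>i=1..S. \<Sum>j=1..S. \<Sum>s=1..S. \<bar>W i j\<bar> * \<bar>A j s - c * A0 j s\<bar>) * ?N"
    by (simp only: sum.distrib sum_distrib_right)
  also have "\<dots> \<le> (\<Sum>i=1..S. \<Sum>j=1..S. \<bar>W i j\<bar> * \<bar>r j\<bar>) + c / 2 * ?N"
    by (intro add_left_mono mult_right_mono close sum_nonneg) auto
  \<comment> \<open>The error term is absorbed into the left-hand side; this is the origin of the
    threshold c / 2 in \<open>close\<close>.\<close>
  finally have "c / 2 * ?N \<le> (\<Sum>i=1..S. \<Sum>j=1..S. \<bar>W i j\<bar> * \<bar>r j\<bar>)" by simp
  then show "?N \<le> 2 / c * (\<Sum>i=1..S. \<Sum>j=1..S. \<bar>W i j\<bar> * \<bar>r j\<bar>)"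
    using c by (simp add: field_simps)
qed

context local_sample
begin

text \<open>Splitting the integral in \<open>local_mean\<close> requires integrable terms, which
  \<open>well_placed\<close> secures.\<close>

lemma local_fluct_lincomb:
  assumes n: "well_placed n" and \<phi>: "kernel_fun z \<phi>" and \<psi>: "\<And>j. j \<in> J \<Longrightarrow> kernel_fun z (\<psi> j)"
  shows "local_fluct (\<lambda>t. \<phi> t - (\<Sum>j\<in>J. a j * \<psi> j t)) (n, w) =
    local_fluct \<phi> (n, w) - (\<Sum>j\<in>J. a j * local_fluct (\<psi> j) (n, w))"
proof -
  have i: "integrable lborel (\<lambda>t. \<theta> t * f (x n + t * h n))" if "kernel_fun z \<theta>" for \<theta>
    by (rule integrable_mult_f(1)[OF n kernel_fun_integrable[OF that] kernel_funD(2)[OF that]])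
  have "local_mean (\<lambda>t. \<phi> t - (\<Sum>j\<in>J. a j * \<psi> j t)) n =
    (LINT t|lborel. \<phi> t * f (x n + t * h n) - (\<Sum>j\<in>J. a j * (\<psi> j t * f (x n + t * h n))))"
    by (simp add: local_mean_def left_diff_distrib sum_distrib_right mult.assoc)
  also have "\<dots> = local_mean \<phi> n - (\<Sum>j\<in>J. a j * local_mean (\<psi> j) n)"
    using i[OF \<phi>] i[OF \<psi>] by (simp add: local_mean_def)
  finally have mean: "local_mean (\<lambda>t. \<phi> t - (\<Sum>j\<in>J. a j * \<psi> j t)) n = local_mean \<phi> n - (\<Sum>j\<in>J. a j * local_mean (\<psi> j) n)" .
  have avg: "local_avg (\<lambda>t. \<phi> t - (\<Sum>j\<in>J. a j * \<psi> j t)) (n, w) = local_avg \<phi> (n, w) - (\<Sum>j\<in>J. a j * local_avg (\<psi> j) (n, w))"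
    unfolding local_avg_def fst_conv snd_conv
    by (simp add: sum_subtractf diff_divide_distrib sum.swap[of _ J] sum_distrib_left[symmetric] sum_divide_distrib[symmetric])
  show ?thesis
    unfolding local_fluct_def fst_conv mean avg
    by (simp add: right_diff_distrib sum_distrib_left sum_subtractf mult_ac)
qed

end

text \<open>\<open>D i\<close> stands for the i-th derivative of ln f, taken within I so that the
  limit point may be an endpoint of the support. Only the top derivative is asked to be continuous
  separately; the others are differentiable.\<close>

locale log_smooth_sample = local_sample M X f h x z f0
  for M :: "'a measure" and X f h x z f0 +
  fixes I :: "real set" and D :: "nat \<Rightarrow> real \<Rightarrow> real" and S :: nat and x0 :: real
  assumes z: "0 \<le> z" "z \<le> 1"
    and I: "convex I"
    and near: "\<forall>\<^sub>F n in sequentially. \<forall>t\<in>{-z..1}. x n + t * h n \<in> I"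
    and f_exp: "\<And>y. y \<in> I \<Longrightarrow> f y = exp (D 0 y)"
    and D_deriv: "\<And>i y. i \<le> S \<Longrightarrow> y \<in> I \<Longrightarrow> (D i has_real_derivative D (Suc i) y) (at y within I)"
    and D_cont: "continuous_on I (D (Suc S))"
    and x0: "x0 \<in> I" "x \<longlonglongrightarrow> x0"
    and f0: "f0 = f x0"
    and S: "1 \<le> S"
begin

definition \<gamma> :: "nat \<Rightarrow> nat \<Rightarrow> real" where "\<gamma> n s = D s (x n) * h n ^ s"

lemma f0_pos: "0 < f0" using f0 f_exp[OF x0(1)] by simp

lemma D_continuous: "i \<le> Suc S \<Longrightarrow> continuous_on I (D i)"
  using D_cont DERIV_continuous_on[OF D_deriv, of i] by (cases "i = Suc S") simp_all

lemma x_in_I: "\<forall>\<^sub>F n in sequentially. x n \<in> I"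
proof -
  have "0 \<in> {-z..1}" using z by simp
  from near show ?thesis
  proof eventually_elim
    case (elim n)
    from bspec[OF elim \<open>0 \<in> {-z..1}\<close>] show ?case by simp
  qed
qed

lemma D_lim: "i \<le> Suc S \<Longrightarrow> (\<lambda>n. D i (x n)) \<longlonglongrightarrow> D i x0"
  by (rule continuous_on_tendsto_compose[OF D_continuous x0(2,1) x_in_I])

lemma f_x_lim: "(\<lambda>n. f (x n)) \<longlonglongrightarrow> f0"
proof -
  have "(\<lambda>n. exp (D 0 (x n))) \<longlonglongrightarrow> exp (D 0 x0)" by (intro tendsto_intros D_lim) simp
  moreover have "\<forall>\<^sub>F n in sequentially. exp (D 0 (x n)) = f (x n)"
    using x_in_I by eventually_elim (simp add: f_exp)
  ultimately show ?thesis using f0 f_exp[OF x0(1)] by (simp add: tendsto_cong)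
qed

lemma \<gamma>_lim: "1 \<le> s \<Longrightarrow> s \<le> Suc S \<Longrightarrow> (\<lambda>n. \<gamma> n s) \<longlonglongrightarrow> 0"
  using tendsto_mult[OF D_lim[of s] tendsto_power[OF h_lim, of s]] by (simp add: \<gamma>_def power_0_left)

text \<open>Near x0 the top derivative stays within e / 2 of its value at x0, hence varies by less
  than e over the window. The case j = 1 serves the score and j = 0 the density.\<close>

lemma taylor_uniform:
  assumes e: "e > 0" and j: "j \<le> Suc S" and k: "k + j = Suc S"
  shows "\<forall>\<^sub>F n in sequentially. \<forall>t\<in>{-z..1}.
    \<bar>D j (x n + t * h n) - (\<Sum>i\<le>k. D (i + j) (x n) * (t * h n) ^ i / fact i)\<bar> \<le> e * h n ^ k"
proof -
  obtain d where d: "d > 0" "\<And>y. y \<in> I \<Longrightarrow> dist y x0 < d \<Longrightarrow> dist (D (Suc S) y) (D (Suc S) x0) < e / 2"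
    using D_cont x0(1) e unfolding continuous_on_iff by (metis half_gt_zero)
  have "\<forall>\<^sub>F n in sequentially. dist (x n) x0 < d / 2" using tendstoD[OF x0(2) half_gt_zero[OF d(1)]] .
  moreover have "\<forall>\<^sub>F n in sequentially. h n < d / 2" using order_tendstoD(2)[OF h_lim half_gt_zero[OF d(1)]] .
  ultimately show ?thesis using near
  proof eventually_elim
    case (elim n)
    \<comment> \<open>The window itself: small enough for the modulus of continuity, and
      convex.\<close>
    define J where "J = {x n - z * h n..x n + h n}"
    have hn: "0 < h n" by (rule h_pos)
    have JI: "J \<subseteq> I"
    proof
      fix y assume "y \<in> J"
      then have "(y - x n) / h n \<in> {-z..1}" using hn by (auto simp: J_def field_simps)
      then have "x n + (y - x n) / h n * h n \<in> I" using elim(3) by blast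
      then show "y \<in> I" using hn by simp
    qed
    have Jd: "\<bar>D (Suc S) y - D (Suc S) x0\<bar> < e / 2" if "y \<in> J" for y
    proof -
      have "z * h n \<le> h n" using z hn by simp
      moreover have "x n - z * h n \<le> y" "y \<le> x n + h n" using that by (auto simp: J_def)
      ultimately have "dist y x0 < d"
        using elim(1,2) unfolding dist_real_def abs_less_iff by linarith
      from d(2)[OF _ this] show ?thesis using JI that by (auto simp: dist_real_def)
    qed
    have xJ: "x n \<in> J" using z hn by (simp add: J_def)
    show ?case
    proof
      fix t assume t: "t \<in> {-z..1}"
      have tJ: "x n + t * h n \<in> J"
        using t hn mult_right_mono[of "-z" t "h n"] mult_right_mono[of t 1 "h n"] by (simp add: J_def)
      have "\<bar>D (0 + j) (x n + t * h n) - (\<Sum>i\<le>k. D (i + j) (x n) * ((x n + t * h n) - x n) ^ i / fact i)\<bar>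
        \<le> e * \<bar>(x n + t * h n) - x n\<bar> ^ k"
      proof (rule taylor_within_modulus[where I=J and D="\<lambda>i. D (i + j)"])
        show "convex J" by (simp add: J_def)
        show "(D (i + j) has_real_derivative D (Suc i + j) y) (at y within J)" if "i < k" "y \<in> J" for i y
          using D_deriv[of "i + j" y] that k JI by (auto intro: DERIV_subset)
        show "\<bar>D (k + j) y - D (k + j) (x n)\<bar> \<le> e" if "y \<in> J" for y
          using Jd[OF that] Jd[OF xJ] k unfolding k by linarith
      qed (use xJ tJ in auto)
      moreover have "e * \<bar>(x n + t * h n) - x n\<bar> ^ k \<le> e * h n ^ k"
      proof -
        have "\<bar>t\<bar> \<le> 1" using t z by (auto simp: abs_le_iff)
        then have "\<bar>t * h n\<bar> \<le> h n" using hn mult_right_mono[of "\<bar>t\<bar>" 1 "h n"] by (simp add: abs_mult)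
        then show ?thesis using e by (intro mult_left_mono) (auto intro: power_mono)
      qed
      ultimately show "\<bar>D j (x n + t * h n) - (\<Sum>i\<le>k. D (i + j) (x n) * (t * h n) ^ i / fact i)\<bar> \<le> e * h n ^ k"
        by simp
    qed
  qed
qed

text \<open>Since f' = f L', integration by parts gives minus the integral of G f times h L'(x + t
  h). The Taylor coefficients of h L' are exactly \<open>\<gamma> n (Suc i) / fact i\<close>. The
  sum runs to i = S, one beyond the system; this last term becomes the bias.\<close>

lemma score_mean_expansion:
  assumes G': "kernel_fun z G'"
    and G: "\<And>t. t \<in> {-z..1} \<Longrightarrow> (G has_real_derivative G' t) (at t within {-z..1})"
    and G0: "\<And>t. t \<notin> {-z..1} \<Longrightarrow> G t = 0" "G (-z) = 0" "G 1 = 0"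
    and e: "e > 0"
  shows "\<forall>\<^sub>F n in sequentially. \<bar>local_mean G' n +
    (\<Sum>i\<le>S. \<gamma> n (Suc i) / fact i * local_mean (\<lambda>t. G t * t ^ i) n)\<bar> \<le> e * h n ^ Suc S"
proof -
  have cG: "continuous_on {-z..1} G" using G by (rule DERIV_continuous_on)
  have kG: "kernel_fun z G" by (rule continuous_kernel_fun[OF cG G0(1)])
  \<comment> \<open>Bounds the integral of |G f| over every well placed window; the added 1 makes it
    positive.\<close>
  define K where "K = f_bound * (LINT t|lborel. \<bar>G t\<bar>) + 1"
  have K: "K > 0" using f_bound_pos by (simp add: K_def add_nonneg_pos)
  have "\<forall>\<^sub>F n in sequentially. \<forall>t\<in>{-z..1}.
    \<bar>D 1 (x n + t * h n) - (\<Sum>i\<le>S. D (i + 1) (x n) * (t * h n) ^ i / fact i)\<bar> \<le> e / K * h n ^ S"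
    using e K by (intro taylor_uniform) auto
  then show ?thesis using near eventually_well_placed
  proof eventually_elim
    case (elim n)
    have hn: "0 < h n" by (rule h_pos)
    define u where "u t = f (x n + t * h n)" for t
    define u' where "u' t = u t * (D 1 (x n + t * h n) * h n)" for t
    have img: "(\<lambda>t. x n + t * h n) ` {-z..1} \<subseteq> I" using elim(2) by auto
    have cD: "continuous_on {-z..1} (\<lambda>t. D i (x n + t * h n))" if "i \<le> 1" for i
      by (rule continuous_on_compose2[OF D_continuous _ img]) (use that in \<open>auto intro!: continuous_intros\<close>)
    have u_eq: "u t = exp (D 0 (x n + t * h n))" if "t \<in> {-z..1}" for t
      using elim(2) that by (simp add: u_def f_exp)
    have u: "(u has_real_derivative u' t) (at t within {-z..1})" if t: "t \<in> {-z..1}" for t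
    proof -
      have "((\<lambda>t. D 0 (x n + t * h n)) has_real_derivative D (Suc 0) (x n + t * h n) * h n) (at t within {-z..1})"
      proof -
        have "(D 0 has_real_derivative D (Suc 0) (x n + t * h n)) (at (x n + t * h n) within (\<lambda>t. x n + t * h n) ` {-z..1})"
          using elim(2) t by (intro DERIV_subset[OF D_deriv img]) auto
        moreover have "((\<lambda>t. x n + t * h n) has_real_derivative h n) (at t within {-z..1})"
          by (auto intro!: derivative_eq_intros)
        ultimately show ?thesis using DERIV_image_chain[of "D 0" _ "\<lambda>t. x n + t * h n" t "{-z..1}"] by (simp add: comp_def)
      qed
      then have "((\<lambda>t. exp (D 0 (x n + t * h n))) has_real_derivative u' t) (at t within {-z..1})"
        using t by (auto intro!: derivative_eq_intros simp: u'_def u_eq)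
      then show ?thesis
        by (rule has_field_derivative_transform_within[OF _ zero_less_one_class.zero_less_one t]) (simp add: u_eq)
    qed
    have cu: "continuous_on {-z..1} u" using u by (rule DERIV_continuous_on)
    have cu': "continuous_on {-z..1} u'"
      unfolding u'_def by (intro continuous_intros cu cD) simp
    have "local_mean G' n = - (LINT t|lborel. G t * u' t)"
      unfolding local_mean_def u_def[symmetric] using z
      by (intro integral_by_parts_kernel[OF _ G' G G0 u cu']) auto
    moreover have "(\<Sum>i\<le>S. \<gamma> n (Suc i) / fact i * local_mean (\<lambda>t. G t * t ^ i) n) =
      (LINT t|lborel. (\<Sum>i\<le>S. \<gamma> n (Suc i) / fact i * (G t * t ^ i * u t)))"
      and iS: "integrable lborel (\<lambda>t. \<Sum>i\<le>S. \<gamma> n (Suc i) / fact i * (G t * t ^ i * u t))"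
    proof -
      have "integrable lborel (\<lambda>t. G t * t ^ i * u t)" for i
        unfolding u_def
        by (intro integrable_mult_f(1)[OF elim(3)] kernel_fun_integrable[OF power_kernel_fun[OF kG z(2)]])
          (simp add: G0)
      then show "(\<Sum>i\<le>S. \<gamma> n (Suc i) / fact i * local_mean (\<lambda>t. G t * t ^ i) n) =
          (LINT t|lborel. (\<Sum>i\<le>S. \<gamma> n (Suc i) / fact i * (G t * t ^ i * u t)))"
        "integrable lborel (\<lambda>t. \<Sum>i\<le>S. \<gamma> n (Suc i) / fact i * (G t * t ^ i * u t))"
        by (simp_all add: local_mean_def u_def)
    qed
    moreover have iG: "integrable lborel (\<lambda>t. G t * u' t)"
      using G0(1) by (intro kernel_fun_integrable[of z] continuous_kernel_fun continuous_intros cG cu') auto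
    ultimately have eq: "local_mean G' n + (\<Sum>i\<le>S. \<gamma> n (Suc i) / fact i * local_mean (\<lambda>t. G t * t ^ i) n) =
      (LINT t|lborel. (\<Sum>i\<le>S. \<gamma> n (Suc i) / fact i * (G t * t ^ i * u t)) - G t * u' t)" by simp
    have "\<bar>local_mean G' n + (\<Sum>i\<le>S. \<gamma> n (Suc i) / fact i * local_mean (\<lambda>t. G t * t ^ i) n)\<bar>
      \<le> (LINT t|lborel. \<bar>(\<Sum>i\<le>S. \<gamma> n (Suc i) / fact i * (G t * t ^ i * u t)) - G t * u' t\<bar>)"
      unfolding eq by (rule integral_abs_bound)
    also have "\<dots> \<le> (LINT t|lborel. e / K * h n ^ Suc S * \<bar>G t * u t\<bar>)"
    proof (rule integral_mono)
      show "integrable lborel (\<lambda>t. \<bar>(\<Sum>i\<le>S. \<gamma> n (Suc i) / fact i * (G t * t ^ i * u t)) - G t * u' t\<bar>)"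
        by (intro integrable_abs Bochner_Integration.integrable_diff iS iG)
      show "integrable lborel (\<lambda>t. e / K * h n ^ Suc S * \<bar>G t * u t\<bar>)"
        unfolding u_def using integrable_mult_f(1)[OF elim(3) kernel_fun_integrable[OF kG] G0(1)] by simp
      fix t
      show "\<bar>(\<Sum>i\<le>S. \<gamma> n (Suc i) / fact i * (G t * t ^ i * u t)) - G t * u' t\<bar> \<le> e / K * h n ^ Suc S * \<bar>G t * u t\<bar>"
      proof (cases "t \<in> {-z..1}")
        case True
        have "(\<Sum>i\<le>S. \<gamma> n (Suc i) / fact i * (G t * t ^ i * u t)) =
          G t * u t * h n * (\<Sum>i\<le>S. D (i + 1) (x n) * (t * h n) ^ i / fact i)"
          by (simp add: sum_distrib_left \<gamma>_def power_mult_distrib mult_ac)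
        then have "(\<Sum>i\<le>S. \<gamma> n (Suc i) / fact i * (G t * t ^ i * u t)) - G t * u' t =
          - (h n * (G t * u t) * (D 1 (x n + t * h n) - (\<Sum>i\<le>S. D (i + 1) (x n) * (t * h n) ^ i / fact i)))"
          by (simp add: u'_def algebra_simps)
        then have "\<bar>(\<Sum>i\<le>S. \<gamma> n (Suc i) / fact i * (G t * t ^ i * u t)) - G t * u' t\<bar> =
          h n * \<bar>G t * u t\<bar> * \<bar>D 1 (x n + t * h n) - (\<Sum>i\<le>S. D (i + 1) (x n) * (t * h n) ^ i / fact i)\<bar>"
          by (simp only: abs_minus_cancel abs_mult abs_of_pos[OF hn])
        also have "\<dots> \<le> h n * \<bar>G t * u t\<bar> * (e / K * h n ^ S)"
          using elim(1) True hn by (intro mult_left_mono) auto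
        finally show ?thesis by (simp add: mult_ac)
      qed (simp add: G0)
    qed
    also have "\<dots> = e / K * h n ^ Suc S * (LINT t|lborel. \<bar>G t * u t\<bar>)" by simp
    also have "\<dots> \<le> e / K * h n ^ Suc S * K"
    proof (rule mult_left_mono)
      show "(LINT t|lborel. \<bar>G t * u t\<bar>) \<le> K"
        using integrable_mult_f(2)[OF elim(3) kernel_fun_integrable[OF kG] G0(1)] by (simp add: K_def u_def)
    qed (use e K hn in auto)
    also have "\<dots> = e * h n ^ Suc S" using K by simp
    finally show ?case .
  qed
qed

text \<open>Relative to f(x), the density on the window is the exponential of a polynomial in
  \<gamma> plus a term of order h^(S+1). The polynomial, merely of order h, is kept inside the
  exponential because the denominator reproduces it; only the small term is linearised.\<close>

lemma density_mean_expansion: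
  assumes m: "kernel_fun z m" "\<And>t. 0 \<le> m t" "(LINT t|lborel. m t) = 1" and e: "e > 0"
  shows "\<forall>\<^sub>F n in sequentially. \<bar>local_mean m n - f (x n) * (exp_moment S m (\<gamma> n) +
    h n ^ Suc S * D (Suc S) (x n) * ((LINT t|lborel. m t * t ^ Suc S) / fact (Suc S)))\<bar> \<le> e * h n ^ Suc S"
proof -
  \<comment> \<open>The Taylor remainder may use e / 2, with \<open>f (x n)\<close> eventually below
    f0 + 1. The cap 1 matches the added 1 in \<open>B\<close>, so that |v| is at most
    \<open>B n * H\<close>.\<close>
  define d where "d = min 1 (e / (2 * (f0 + 1)))"
  have d: "0 < d" "d \<le> 1" using e f0_pos by (auto simp: d_def)
  have "(f0 + 1) * d \<le> (f0 + 1) * (e / (2 * (f0 + 1)))"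
    using f0_pos by (intro mult_left_mono) (auto simp: d_def)
  also have "\<dots> = e / 2" using f0_pos by (simp add: divide_simps)
  finally have d3: "(f0 + 1) * d \<le> e / 2" .
  define N where "N n = (\<Sum>s=1..S. \<bar>\<gamma> n s\<bar>)" for n
  define B where "B n = \<bar>D (Suc S) (x n)\<bar> + 1" for n
  have N_lim: "N \<longlonglongrightarrow> 0"
    unfolding N_def by (intro tendsto_null_sum tendsto_rabs_zero \<gamma>_lim) auto
  have B_lim: "B \<longlonglongrightarrow> \<bar>D (Suc S) x0\<bar> + 1" unfolding B_def by (intro tendsto_intros D_lim) simp
  have "(\<lambda>n. f (x n) * (B n * (exp (N n + B n * h n ^ Suc S) - 1))) \<longlonglongrightarrow>
    f0 * ((\<bar>D (Suc S) x0\<bar> + 1) * (exp (0 + (\<bar>D (Suc S) x0\<bar> + 1) * 0 ^ Suc S) - 1))"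
    by (intro tendsto_intros N_lim B_lim h_lim f_x_lim)
  then have "(\<lambda>n. f (x n) * (B n * (exp (N n + B n * h n ^ Suc S) - 1))) \<longlonglongrightarrow> 0" by simp
  then have ev1: "\<forall>\<^sub>F n in sequentially. f (x n) * (B n * (exp (N n + B n * h n ^ Suc S) - 1)) < e / 2"
    using e by (intro order_tendstoD(2)) auto
  have ev2: "\<forall>\<^sub>F n in sequentially. f (x n) < f0 + 1" using f_x_lim by (intro order_tendstoD(2)) auto
  have "\<forall>\<^sub>F n in sequentially. \<forall>t\<in>{-z..1}.
    \<bar>D 0 (x n + t * h n) - (\<Sum>i\<le>Suc S. D (i + 0) (x n) * (t * h n) ^ i / fact i)\<bar> \<le> d * h n ^ Suc S"
    using d by (intro taylor_uniform) auto
  then show ?thesis using near eventually_well_placed ev1 ev2 x_in_I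
  proof eventually_elim
    case (elim n)
    have hn: "0 < h n" by (rule h_pos)
    define H where "H = h n ^ Suc S"
    have H: "0 < H" using hn by (simp add: H_def)
    define p where "p t = (\<Sum>s=1..S. \<gamma> n s * t ^ s / fact s)" for t
    define w where "w t = H * D (Suc S) (x n) * t ^ Suc S / fact (Suc S)" for t
    \<comment> \<open>Relative error in units of H: the first summand comes from linearising the
      exponential and vanishes with n, the second from the Taylor remainder.\<close>
    define \<eta> where "\<eta> = B n * (exp (N n + B n * H) - 1) + d"
    have fx: "f (x n) = exp (D 0 (x n))" "0 \<le> f (x n)" using f_exp elim(6) f_nonneg by auto
    have pt: "\<bar>f (x n + t * h n) - f (x n) * exp (p t) - f (x n) * w t\<bar> \<le> f (x n) * (H * \<eta>)"
      if t: "t \<in> {-z..1}" for t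
    proof -
      have t1: "\<bar>t\<bar> \<le> 1" using t z by (auto simp: abs_le_iff)
      define v where "v = D 0 (x n + t * h n) - D 0 (x n) - p t"
      have tay: "(\<Sum>i\<le>Suc S. D (i + 0) (x n) * (t * h n) ^ i / fact i) = D 0 (x n) + p t + w t"
      proof -
        have "(\<Sum>i\<le>Suc S. D (i + 0) (x n) * (t * h n) ^ i / fact i) =
          (\<Sum>i\<in>{0..S}. D i (x n) * (t * h n) ^ i / fact i) + D (Suc S) (x n) * (t * h n) ^ Suc S / fact (Suc S)"
          by (simp add: atLeast0AtMost)
        also have "(\<Sum>i\<in>{0..S}. D i (x n) * (t * h n) ^ i / fact i) =
          D 0 (x n) + (\<Sum>i=1..S. D i (x n) * (t * h n) ^ i / fact i)"
          by (subst sum.atLeast_Suc_atMost) auto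
        also have "(\<Sum>i=1..S. D i (x n) * (t * h n) ^ i / fact i) = p t"
          by (simp add: p_def \<gamma>_def power_mult_distrib mult_ac)
        also have "D (Suc S) (x n) * (t * h n) ^ Suc S / fact (Suc S) = w t"
          by (simp only: w_def H_def power_mult_distrib mult_ac)
        finally show ?thesis .
      qed
      have vw: "\<bar>v - w t\<bar> \<le> d * H"
        using bspec[OF elim(1) t] unfolding tay H_def[symmetric] v_def by (simp add: diff_diff_eq)
      have wH: "\<bar>w t\<bar> \<le> \<bar>D (Suc S) (x n)\<bar> * H"
      proof -
        have "\<bar>t\<bar> ^ Suc S / fact (Suc S) \<le> 1"
          using order_trans[OF power_le_one[of "\<bar>t\<bar>" "Suc S"] fact_ge_1[of "Suc S"]] t1
          by (simp add: divide_le_eq del: fact_Suc power_Suc)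
        then have "(\<bar>D (Suc S) (x n)\<bar> * H) * (\<bar>t\<bar> ^ Suc S / fact (Suc S)) \<le> (\<bar>D (Suc S) (x n)\<bar> * H) * 1"
          using H by (intro mult_left_mono) auto
        then show ?thesis using H by (simp add: w_def abs_mult power_abs mult_ac del: fact_Suc power_Suc)
      qed
      have vH: "\<bar>v\<bar> \<le> B n * H"
      proof -
        have "d * H \<le> 1 * H" using d H by (intro mult_right_mono) auto
        then show ?thesis using vw wH by (simp add: B_def distrib_right)
      qed
      have pN: "\<bar>p t\<bar> \<le> N n" unfolding p_def N_def by (rule abs_poly_le[OF t1])
      have "f (x n + t * h n) = f (x n) * exp (p t + v)"
        using elim(2) t by (simp add: f_exp fx v_def flip: exp_add)
      then have "f (x n + t * h n) - f (x n) * exp (p t) - f (x n) * w t =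
        f (x n) * ((exp (p t + v) - exp (p t) - v) + (v - w t))" by (simp add: algebra_simps)
      then have "\<bar>f (x n + t * h n) - f (x n) * exp (p t) - f (x n) * w t\<bar> =
        f (x n) * \<bar>(exp (p t + v) - exp (p t) - v) + (v - w t)\<bar>"
        using fx(2) by (simp add: abs_mult)
      also have "\<dots> \<le> f (x n) * (\<bar>v\<bar> * (exp (\<bar>p t\<bar> + \<bar>v\<bar>) - 1) + d * H)"
        using exp_first_order[of "p t" v] vw
        by (intro mult_left_mono fx(2) order_trans[OF abs_triangle_ineq add_mono])
      also have "\<dots> \<le> f (x n) * ((B n * H) * (exp (N n + B n * H) - 1) + d * H)"
        using vH pN H by (intro mult_left_mono fx(2) add_right_mono mult_mono diff_right_mono) (auto simp: B_def)
      also have "\<dots> = f (x n) * (H * \<eta>)" by (simp add: \<eta>_def algebra_simps)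
      finally show ?thesis .
    qed
    have i1: "integrable lborel (\<lambda>t. m t * f (x n + t * h n))"
      by (rule integrable_mult_f(1)[OF elim(3) kernel_fun_integrable[OF m(1)] kernel_funD(2)[OF m(1)]])
    have i2: "integrable lborel (\<lambda>t. m t * exp (p t))"
      unfolding p_def by (rule kernel_fun_integrable[OF exp_poly_kernel_fun[OF m(1) z(2)]])
    have i3: "integrable lborel (\<lambda>t. m t * t ^ Suc S)"
      by (rule kernel_fun_integrable[OF power_kernel_fun[OF m(1) z(2)]])
    have mw: "m t * w t = H * D (Suc S) (x n) / fact (Suc S) * (m t * t ^ Suc S)" for t
      by (simp only: w_def) (simp add: mult_ac del: fact_Suc power_Suc)
    have i4: "integrable lborel (\<lambda>t. m t * w t)"
      and I4: "(LINT t|lborel. m t * w t) = H * D (Suc S) (x n) * ((LINT t|lborel. m t * t ^ Suc S) / fact (Suc S))"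
      unfolding mw using i3 by (simp_all del: fact_Suc power_Suc)
    have eq: "local_mean m n - f (x n) * (exp_moment S m (\<gamma> n) +
      H * D (Suc S) (x n) * ((LINT t|lborel. m t * t ^ Suc S) / fact (Suc S))) =
      (LINT t|lborel. m t * f (x n + t * h n) - f (x n) * (m t * exp (p t)) - f (x n) * (m t * w t))"
      unfolding local_mean_def exp_moment_def p_def[symmetric] I4[symmetric]
      using i1 i2 i4 by (simp add: distrib_left)
    have "\<bar>local_mean m n - f (x n) * (exp_moment S m (\<gamma> n) +
      H * D (Suc S) (x n) * ((LINT t|lborel. m t * t ^ Suc S) / fact (Suc S)))\<bar> \<le>
      (LINT t|lborel. \<bar>m t * f (x n + t * h n) - f (x n) * (m t * exp (p t)) - f (x n) * (m t * w t)\<bar>)"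
      unfolding eq by (rule integral_abs_bound)
    also have "\<dots> \<le> (LINT t|lborel. f (x n) * (H * \<eta>) * m t)"
    proof (rule integral_mono)
      show "integrable lborel (\<lambda>t. \<bar>m t * f (x n + t * h n) - f (x n) * (m t * exp (p t)) - f (x n) * (m t * w t)\<bar>)"
        by (intro integrable_abs Bochner_Integration.integrable_diff integrable_mult_right i1 i2 i4)
      show "integrable lborel (\<lambda>t. f (x n) * (H * \<eta>) * m t)" using kernel_fun_integrable[OF m(1)] by simp
      fix t
      have "m t * f (x n + t * h n) - f (x n) * (m t * exp (p t)) - f (x n) * (m t * w t) =
        m t * (f (x n + t * h n) - f (x n) * exp (p t) - f (x n) * w t)" by (simp add: algebra_simps)
      then show "\<bar>m t * f (x n + t * h n) - f (x n) * (m t * exp (p t)) - f (x n) * (m t * w t)\<bar> \<le> f (x n) * (H * \<eta>) * m t"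
        using mult_left_mono[OF pt m(2)[of t], of t] m(2)[of t] kernel_funD(2)[OF m(1), of t]
        by (cases "t \<in> {-z..1}") (auto simp: abs_mult mult_ac)
    qed
    also have "\<dots> = f (x n) * (H * \<eta>)" using m(3) by simp
    also have "\<dots> = (f (x n) * (B n * (exp (N n + B n * H) - 1)) + f (x n) * d) * H"
      by (simp add: \<eta>_def algebra_simps)
    also have "\<dots> \<le> (e / 2 + e / 2) * H"
    proof (intro mult_right_mono add_mono)
      show "f (x n) * (B n * (exp (N n + B n * H) - 1)) \<le> e / 2" using elim(4) by (simp add: H_def)
      have "f (x n) * d \<le> (f0 + 1) * d" using elim(5) d by (intro mult_right_mono) auto
      then show "f (x n) * d \<le> e / 2" using d3 by simp
    qed (use H in auto)
    finally show ?case by (simp add: H_def)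
  qed
qed

end

section \<open>Stochastic expansion of the two-step estimator\<close>

context log_smooth_sample
begin

lemma sqrt_nh_top: "filterlim (\<lambda>n. sqrt (real n * h n)) at_top sequentially"
  by (rule filterlim_compose[OF sqrt_at_top nh])

lemma inverse_sqrt_nh: "(\<lambda>n. 1 / sqrt (real n * h n)) \<longlonglongrightarrow> 0"
  by (intro tendsto_divide_0[OF tendsto_const] filterlim_at_top_imp_at_infinity sqrt_nh_top)

text \<open>The bandwidth rate keeps sqrt(n h) h^(S+1) bounded, so every deterministic o(h^(S+1))
  remainder vanishes after scaling.\<close>

lemma scaled_remainder_lim:
  assumes bias: "(\<lambda>n. sqrt (real n * h n) * h n ^ Suc S) \<longlonglongrightarrow> \<Xi>"
    and R: "\<And>e. e > 0 \<Longrightarrow> \<forall>\<^sub>F n in sequentially. \<bar>R n\<bar> \<le> e * h n ^ Suc S"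
  shows "(\<lambda>n. sqrt (real n * h n) * R n) \<longlonglongrightarrow> 0"
proof (rule tendstoI)
  fix e :: real assume e: "e > 0"
  define K where "K = \<bar>\<Xi>\<bar> + 1"
  have K: "K > 0" by (simp add: K_def)
  have "\<forall>\<^sub>F n in sequentially. \<bar>R n\<bar> \<le> e / (2 * K) * h n ^ Suc S" using e K by (intro R) simp
  moreover have "\<forall>\<^sub>F n in sequentially. sqrt (real n * h n) * h n ^ Suc S < K"
    using bias by (intro order_tendstoD(2)) (auto simp: K_def)
  ultimately show "\<forall>\<^sub>F n in sequentially. dist (sqrt (real n * h n) * R n) 0 < e"
  proof eventually_elim
    case (elim n)
    have q: "0 \<le> sqrt (real n * h n)" using h_pos[of n] by simp
    then have "\<bar>sqrt (real n * h n) * R n\<bar> = sqrt (real n * h n) * \<bar>R n\<bar>" by (simp add: abs_mult)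
    also have "\<dots> \<le> sqrt (real n * h n) * (e / (2 * K) * h n ^ Suc S)"
      using q elim(1) by (rule mult_left_mono[rotated])
    also have "\<dots> = e / (2 * K) * (sqrt (real n * h n) * h n ^ Suc S)" by (simp only: mult_ac)
    also have "\<dots> \<le> e / (2 * K) * K" using elim(2) e K by (intro mult_left_mono) auto
    also have "\<dots> < e" using e K by simp
    finally show ?case by simp
  qed
qed

text \<open>Sign and factorial are those of \<Omega>; with them the rescaled system equates the
  average of \<open>g'\<close> with the sum of \<open>T p s * A j s p\<close>.\<close>

lemma score_coefficient_lim:
  assumes G: "kernel_fun z G"
    and \<Omega>: "\<Omega> = - (1 / fact (s - 1)) * (LINT t|lborel. G t * t ^ (s - 1))"
  shows "((\<lambda>p. - (1 / fact (s - 1)) * local_avg (\<lambda>t. G t * t ^ (s - 1)) p) \<longlongrightarrow> f0 * \<Omega>) in_prob"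
proof -
  have "((\<lambda>p. - (1 / fact (s - 1)) * local_avg (\<lambda>t. G t * t ^ (s - 1)) p) \<longlongrightarrow>
      - (1 / fact (s - 1)) * (f0 * (LINT t|lborel. G t * t ^ (s - 1)))) in_prob"
    by (intro tendsto_mult_left local_avg_lim power_kernel_fun G z)
  then show ?thesis by (simp add: \<Omega> mult_ac)
qed

lemma score_matrix_error_lim:
  assumes A: "\<And>j s. j \<in> {1..S} \<Longrightarrow> (A j s \<longlongrightarrow> f0 * \<Omega> j s) in_prob"
  shows "((\<lambda>p. \<Sum>i=1..S. \<Sum>j=1..S. \<Sum>s=1..S. \<bar>W i j\<bar> * \<bar>A j s p - f0 * \<Omega> j s\<bar>) \<longlongrightarrow> 0) in_prob"
proof -
  have "((\<lambda>p. \<bar>W i j\<bar> * \<bar>A j s p - f0 * \<Omega> j s\<bar>) \<longlongrightarrow> 0) in_prob" if "j \<in> {1..S}" for i j s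
    using A[OF that, of s] by (intro tendsto_mult_right_zero tendsto_rabs_zero) (simp add: LIM_zero)
  then show ?thesis by (intro tendsto_null_sum) auto
qed

text \<open>T need only solve the rescaled system with probability tending to one; its rate of
  convergence comes out of the system. The row \<open>a\<close> is c W with W a left inverse of
  \<Omega>. It transports the score error through the system into the denominator, hence its double
  role before \<open>G'\<close> and in the bias.\<close>

lemma estimator_expansion:
  fixes G G' W \<Omega> :: "nat \<Rightarrow> _" and m :: "real \<Rightarrow> real" and T :: "nat \<times> 'a \<Rightarrow> nat \<Rightarrow> real"
  assumes G': "\<And>j. j \<in> {1..S} \<Longrightarrow> kernel_fun z (G' j)"
    and G: "\<And>j t. j \<in> {1..S} \<Longrightarrow> t \<in> {-z..1} \<Longrightarrow> (G j has_real_derivative G' j t) (at t within {-z..1})"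
    and G0: "\<And>j t. j \<in> {1..S} \<Longrightarrow> t \<notin> {-z..1} \<Longrightarrow> G j t = 0"
      "\<And>j. j \<in> {1..S} \<Longrightarrow> G j (-z) = 0" "\<And>j. j \<in> {1..S} \<Longrightarrow> G j 1 = 0"
    and m: "kernel_fun z m" "\<And>t. 0 \<le> m t" "(LINT t|lborel. m t) = 1"
    and \<Omega>: "\<And>j s. \<Omega> j s = - (1 / fact (s - 1)) * (LINT t|lborel. G j t * t ^ (s - 1))"
    and W: "\<And>i s. i \<in> {1..S} \<Longrightarrow> s \<in> {1..S} \<Longrightarrow> (\<Sum>j=1..S. W i j * \<Omega> j s) = (if i = s then 1 else (0::real))"
    and bias: "(\<lambda>n. sqrt (real n * h n) * h n ^ Suc S) \<longlonglongrightarrow> \<Xi>"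
    and A: "\<And>j s p. A j s p = - (1 / fact (s - 1)) * local_avg (\<lambda>t. G j t * t ^ (s - 1)) p"
    and c: "\<And>s. c s = (LINT t|lborel. m t * t ^ s) / fact s"
    and a: "\<And>j. a j = (\<Sum>i=1..S. c i * W i j)"
    and T: "\<forall>\<^sub>F p in in_prob. \<forall>j\<in>{1..S}. local_avg (G' j) p = (\<Sum>s=1..S. T p s * A j s p)"
  shows "((\<lambda>p. sqrt (real (fst p) * h (fst p)) * (local_avg m p / exp_moment S m (T p) - f (x (fst p)))
      - (local_fluct (\<lambda>t. m t - (\<Sum>j=1..S. a j * G' j t)) p
         + f0 * D (Suc S) x0 * \<Xi> * (c (Suc S) - (\<Sum>j=1..S. a j * \<Omega> j (Suc S))))) \<longlongrightarrow> 0) in_prob"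
proof -
  define q where "q p = sqrt (real (fst p) * h (fst p))" for p :: "nat \<times> 'a"
  define \<delta> where "\<delta> p s = T p s - \<gamma> (fst p) s" for p s
  \<comment> \<open>Residual of the system at \<gamma>; where T solves the system, this is the
    random matrix applied to \<delta>.\<close>
  define r where "r j p = local_avg (G' j) p - (\<Sum>s=1..S. \<gamma> (fst p) s * A j s p)" for j p
  define N where "N p = (\<Sum>s=1..S. \<bar>\<delta> p s\<bar>)" for p
  define E where "E p = (\<Sum>i=1..S. \<Sum>j=1..S. \<Sum>s=1..S. \<bar>W i j\<bar> * \<bar>A j s p - f0 * \<Omega> j s\<bar>)" for p
  define \<beta> where "\<beta> = D (Suc S) x0"
  have q_nonneg: "0 \<le> q p" for p using h_pos[of "fst p"] by (simp add: q_def)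
  have q_inv: "((\<lambda>p. 1 / q p) \<longlongrightarrow> 0) in_prob"
    unfolding q_def using tendsto_in_prob_const[OF inverse_sqrt_nh] by simp
  have q_ne: "\<forall>\<^sub>F p in in_prob. q p \<noteq> 0"
    using eventually_in_prob_const[OF eventually_gt_at_top[of 0]]
    by eventually_elim (use h_pos in \<open>auto simp: q_def less_imp_neq[symmetric]\<close>)
  have kG: "kernel_fun z (G j)" if "j \<in> {1..S}" for j
    by (rule continuous_kernel_fun[OF DERIV_continuous_on[OF G[OF that]] G0(1)[OF that]])
  have kGp: "kernel_fun z (\<lambda>t. G j t * t ^ s)" if "j \<in> {1..S}" for j s
    by (rule power_kernel_fun[OF kG[OF that] z(2)])
  have A_lim: "(A j s \<longlongrightarrow> f0 * \<Omega> j s) in_prob" if "j \<in> {1..S}" for j s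
    using score_coefficient_lim[OF kG[OF that] \<Omega>] by (simp add: A [abs_def])
  have E_lim: "(E \<longlongrightarrow> 0) in_prob"
    unfolding E_def by (rule score_matrix_error_lim[OF A_lim])
  have r_sys: "\<forall>\<^sub>F p in in_prob. \<forall>j\<in>{1..S}. r j p = (\<Sum>s=1..S. \<delta> p s * A j s p)"
    using T by eventually_elim (auto simp: r_def \<delta>_def left_diff_distrib sum_subtractf)

  \<comment> \<open>Removing the term i = S from the expansion of the mean leaves the bias, with the
    sign of \<Omega>. The fluctuations of the coefficients come multiplied by \<gamma>, which tends
    to zero, so only the fluctuation of \<open>G'\<close> remains.\<close>
  have r_lim: "((\<lambda>p. q p * r j p - local_fluct (G' j) p) \<longlongrightarrow> \<Xi> * \<beta> * (f0 * \<Omega> j (Suc S))) in_prob"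
    if j: "j \<in> {1..S}" for j
  proof -
    define mean where "mean i n = local_mean (\<lambda>t. G j t * t ^ i) n" for i n
    define R where "R n = local_mean (G' j) n + (\<Sum>i\<le>S. \<gamma> n (Suc i) / fact i * mean i n)" for n
    have mean_lim: "mean i \<longlonglongrightarrow> f0 * (LINT t|lborel. G j t * t ^ i)" for i
      unfolding mean_def
      by (rule local_mean_lim[OF kernel_fun_integrable[OF kGp[OF j]] kernel_funD(2)[OF kGp[OF j]]])
    have "(\<lambda>n. sqrt (real n * h n) * R n) \<longlonglongrightarrow> 0"
      unfolding R_def mean_def
      by (intro scaled_remainder_lim[OF bias] score_mean_expansion[OF G'[OF j] G[OF j] G0(1)[OF j] G0(2)[OF j] G0(3)[OF j]])
    then have l1: "((\<lambda>p. q p * R (fst p)) \<longlongrightarrow> 0) in_prob" unfolding q_def by (rule tendsto_in_prob_const)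
    have "(\<lambda>n. (sqrt (real n * h n) * h n ^ Suc S) * D (Suc S) (x n) * (1 / fact S * mean S n)) \<longlonglongrightarrow>
        \<Xi> * D (Suc S) x0 * (1 / fact S * (f0 * (LINT t|lborel. G j t * t ^ S)))"
      by (intro tendsto_mult bias D_lim mean_lim tendsto_const) simp
    from tendsto_in_prob_const[OF this]
    have l2: "((\<lambda>p. q p * (\<gamma> (fst p) (Suc S) / fact S * mean S (fst p))) \<longlongrightarrow> - (\<Xi> * \<beta> * (f0 * \<Omega> j (Suc S)))) in_prob"
      by (simp add: q_def \<gamma>_def \<beta>_def \<Omega> mult_ac)
    have l3: "((\<lambda>p. \<Sum>s=1..S. \<gamma> (fst p) s / fact (s - 1) * local_fluct (\<lambda>t. G j t * t ^ (s - 1)) p) \<longlongrightarrow> 0) in_prob"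
    proof (intro tendsto_null_sum bounded_in_prob_mult_0 local_fluct_tight kGp j)
      fix s assume "s \<in> {1..S}"
      then have "(\<lambda>n. \<gamma> n s / fact (s - 1)) \<longlonglongrightarrow> 0"
        by (intro tendsto_divide_zero \<gamma>_lim) auto
      then show "((\<lambda>p. \<gamma> (fst p) s / fact (s - 1)) \<longlongrightarrow> 0) in_prob" by (rule tendsto_in_prob_const)
    qed
    have "((\<lambda>p. q p * R (fst p) - q p * (\<gamma> (fst p) (Suc S) / fact S * mean S (fst p))
        + (\<Sum>s=1..S. \<gamma> (fst p) s / fact (s - 1) * local_fluct (\<lambda>t. G j t * t ^ (s - 1)) p))
        \<longlongrightarrow> 0 - - (\<Xi> * \<beta> * (f0 * \<Omega> j (Suc S))) + 0) in_prob"
      by (intro tendsto_add tendsto_diff l1 l2 l3)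
    moreover have "q p * R (fst p) - q p * (\<gamma> (fst p) (Suc S) / fact S * mean S (fst p))
        + (\<Sum>s=1..S. \<gamma> (fst p) s / fact (s - 1) * local_fluct (\<lambda>t. G j t * t ^ (s - 1)) p)
        = q p * r j p - local_fluct (G' j) p" for p
    proof -
      have "(\<Sum>i\<le>S. \<gamma> (fst p) (Suc i) / fact i * mean i (fst p)) =
        (\<Sum>i<S. \<gamma> (fst p) (Suc i) / fact i * mean i (fst p)) + \<gamma> (fst p) (Suc S) / fact S * mean S (fst p)"
        by (simp flip: lessThan_Suc_atMost)
      moreover have "(\<Sum>i<S. \<gamma> (fst p) (Suc i) / fact i * mean i (fst p)) =
        (\<Sum>s=1..S. \<gamma> (fst p) s / fact (s - 1) * mean (s - 1) (fst p))"
        by (rule sum.reindex_bij_witness[of _ "\<lambda>s. s - 1" Suc]) auto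
      ultimately have R_eq: "R (fst p) - \<gamma> (fst p) (Suc S) / fact S * mean S (fst p) =
        local_mean (G' j) (fst p) + (\<Sum>s=1..S. \<gamma> (fst p) s / fact (s - 1) * mean (s - 1) (fst p))"
        by (simp add: R_def)
      have "(\<Sum>s=1..S. \<gamma> (fst p) s / fact (s - 1) * local_fluct (\<lambda>t. G j t * t ^ (s - 1)) p) =
        (\<Sum>s=1..S. q p * (- (\<gamma> (fst p) s * A j s p) - \<gamma> (fst p) s / fact (s - 1) * mean (s - 1) (fst p)))"
        by (intro sum.cong refl) (simp add: local_fluct_def q_def A mean_def algebra_simps)
      also have "\<dots> = q p * (- (\<Sum>s=1..S. \<gamma> (fst p) s * A j s p)
          - (\<Sum>s=1..S. \<gamma> (fst p) s / fact (s - 1) * mean (s - 1) (fst p)))"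
        by (simp only: sum_distrib_left[symmetric] sum_subtractf sum_negf)
      finally have F: "(\<Sum>s=1..S. \<gamma> (fst p) s / fact (s - 1) * local_fluct (\<lambda>t. G j t * t ^ (s - 1)) p) = \<dots>" .
      have "q p * R (fst p) - q p * (\<gamma> (fst p) (Suc S) / fact S * mean S (fst p)) =
        q p * (local_mean (G' j) (fst p) + (\<Sum>s=1..S. \<gamma> (fst p) s / fact (s - 1) * mean (s - 1) (fst p)))"
        by (simp only: R_eq[symmetric] right_diff_distrib)
      then show ?thesis unfolding F
        by (simp add: r_def local_fluct_def q_def[symmetric] algebra_simps)
    qed
    ultimately show ?thesis by simp
  qed
  have r_tight: "bounded_in_prob (\<lambda>p. q p * r j p)" if j: "j \<in> {1..S}" for j
  proof -
    have "bounded_in_prob (\<lambda>p. (q p * r j p - local_fluct (G' j) p) + local_fluct (G' j) p)"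
      by (intro bounded_in_prob_add bounded_in_prob_tendsto[OF r_lim[OF j]] local_fluct_tight G' j)
    then show ?thesis by simp
  qed

  have sys: "\<forall>\<^sub>F p in in_prob. (\<forall>j\<in>{1..S}. r j p = (\<Sum>s=1..S. \<delta> p s * A j s p)) \<and> E p \<le> f0 / 2"
    using r_sys order_tendstoD(2)[OF E_lim, of "f0 / 2"] f0_pos by (auto elim: eventually_elim2)
  \<comment> \<open>Once the matrix error E is at most f0 / 2, the perturbation bound controls
    \<delta> by the residuals, which are tight after scaling by q.\<close>
  have N_tight: "bounded_in_prob (\<lambda>p. q p * N p)"
  proof (rule bounded_in_prob_bound)
    show "bounded_in_prob (\<lambda>p. 2 / f0 * (\<Sum>i=1..S. \<Sum>j=1..S. \<bar>W i j\<bar> * \<bar>q p * r j p\<bar>))"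
      by (intro bounded_in_prob_mult[OF bounded_in_prob_tendsto[OF tendsto_const]] bounded_in_prob_sum bounded_in_prob_abs r_tight)
    show "\<forall>\<^sub>F p in in_prob. \<bar>q p * N p\<bar> \<le> \<bar>2 / f0 * (\<Sum>i=1..S. \<Sum>j=1..S. \<bar>W i j\<bar> * \<bar>q p * r j p\<bar>)\<bar>"
      using sys
    proof eventually_elim
      case (elim p)
      have "N p \<le> 2 / f0 * (\<Sum>i=1..S. \<Sum>j=1..S. \<bar>W i j\<bar> * \<bar>r j p\<bar>)"
        unfolding N_def using elim
        by (intro perturbed_linear_system(1)[where A="\<lambda>j s. A j s p" and ?A0.0=\<Omega>, OF W f0_pos]) (auto simp: E_def)
      then have "q p * N p \<le> q p * (2 / f0 * (\<Sum>i=1..S. \<Sum>j=1..S. \<bar>W i j\<bar> * \<bar>r j p\<bar>))"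
        by (rule mult_left_mono[OF _ q_nonneg])
      also have "\<dots> = 2 / f0 * (\<Sum>i=1..S. \<Sum>j=1..S. \<bar>W i j\<bar> * \<bar>q p * r j p\<bar>)"
        using q_nonneg[of p] by (simp add: abs_mult sum_distrib_left mult_ac)
      finally have "q p * N p \<le> 2 / f0 * (\<Sum>i=1..S. \<Sum>j=1..S. \<bar>W i j\<bar> * \<bar>q p * r j p\<bar>)" .
      moreover have "0 \<le> q p * N p" unfolding N_def by (intro mult_nonneg_nonneg q_nonneg sum_nonneg) auto
      ultimately show ?case by linarith
    qed
  qed
  have \<delta>_tight: "bounded_in_prob (\<lambda>p. q p * \<delta> p s)" if "s \<in> {1..S}" for s
  proof (rule bounded_in_prob_bound[OF N_tight always_eventually], rule allI)
    fix p
    have "\<bar>\<delta> p s\<bar> \<le> N p" unfolding N_def using that by (intro member_le_sum) auto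
    then show "\<bar>q p * \<delta> p s\<bar> \<le> \<bar>q p * N p\<bar>"
      unfolding abs_mult by (intro mult_left_mono) auto
  qed
  have N_lim: "(N \<longlongrightarrow> 0) in_prob"
  proof -
    have "((\<lambda>p. 1 / q p * (q p * N p)) \<longlongrightarrow> 0) in_prob" by (rule bounded_in_prob_mult_0[OF N_tight q_inv])
    moreover have "\<forall>\<^sub>F p in in_prob. 1 / q p * (q p * N p) = N p"
      using q_ne by eventually_elim simp
    ultimately show ?thesis by (simp add: tendsto_cong)
  qed

  \<comment> \<open>Scaled first-order change of the denominator when \<gamma> is replaced by
    T.\<close>
  define cd where "cd p = (\<Sum>i=1..S. c i * (q p * \<delta> p i))" for p
  have cd_tight: "bounded_in_prob cd"
    unfolding cd_def by (intro bounded_in_prob_sum bounded_in_prob_mult[OF bounded_in_prob_tendsto[OF tendsto_const]] \<delta>_tight)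
  \<comment> \<open>Solving the system against c trades \<delta> for the residuals with weights
    \<open>a\<close>; the matrix error multiplies the tight \<open>q p * \<delta> p s\<close> and
    vanishes.\<close>
  have cd_lim: "((\<lambda>p. f0 * cd p - (\<Sum>j=1..S. a j * (q p * r j p))) \<longlongrightarrow> 0) in_prob"
  proof -
    have "((\<lambda>p. - (\<Sum>i=1..S. \<Sum>j=1..S. \<Sum>s=1..S. c i * W i j * ((A j s p - f0 * \<Omega> j s) * (q p * \<delta> p s)))) \<longlongrightarrow> - 0) in_prob"
    proof (intro tendsto_minus tendsto_null_sum tendsto_mult_right_zero bounded_in_prob_mult_0 \<delta>_tight)
      fix j s assume "j \<in> {1..S}"
      then show "((\<lambda>p. A j s p - f0 * \<Omega> j s) \<longlongrightarrow> 0) in_prob" using A_lim[of j s] by (simp add: LIM_zero)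
    qed
    moreover have "\<forall>\<^sub>F p in in_prob. - (\<Sum>i=1..S. \<Sum>j=1..S. \<Sum>s=1..S. c i * W i j * ((A j s p - f0 * \<Omega> j s) * (q p * \<delta> p s)))
       = f0 * cd p - (\<Sum>j=1..S. a j * (q p * r j p))"
      using sys
    proof eventually_elim
      case (elim p)
      have e: "f0 * \<delta> p i = (\<Sum>j=1..S. W i j * (r j p - (\<Sum>s=1..S. \<delta> p s * (A j s p - f0 * \<Omega> j s))))" if "i \<in> {1..S}" for i
        using elim that
        by (intro perturbed_linear_system(2)[where A="\<lambda>j s. A j s p" and ?A0.0=\<Omega> and W=W, OF W f0_pos]) (auto simp: E_def)
      have "f0 * cd p = (\<Sum>i=1..S. c i * q p * (f0 * \<delta> p i))"
        by (simp add: cd_def sum_distrib_left mult_ac)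
      also have "\<dots> = (\<Sum>i=1..S. c i * q p * (\<Sum>j=1..S. W i j * (r j p - (\<Sum>s=1..S. \<delta> p s * (A j s p - f0 * \<Omega> j s)))))"
        by (intro sum.cong refl arg_cong2[where f="(*)"] e)
      also have "\<dots> = (\<Sum>i=1..S. \<Sum>j=1..S. c i * W i j * (q p * r j p) - (\<Sum>s=1..S. c i * W i j * ((A j s p - f0 * \<Omega> j s) * (q p * \<delta> p s))))"
        by (simp add: sum_distrib_left right_diff_distrib sum_subtractf mult_ac)
      also have "\<dots> = (\<Sum>i=1..S. \<Sum>j=1..S. c i * W i j * (q p * r j p)) -
          (\<Sum>i=1..S. \<Sum>j=1..S. \<Sum>s=1..S. c i * W i j * ((A j s p - f0 * \<Omega> j s) * (q p * \<delta> p s)))"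
        by (simp only: sum_subtractf)
      also have "(\<Sum>i=1..S. \<Sum>j=1..S. c i * W i j * (q p * r j p)) = (\<Sum>j=1..S. a j * (q p * r j p))"
        by (subst sum.swap) (simp add: a sum_distrib_right)
      finally show ?case by simp
    qed
    ultimately show ?thesis by (simp add: tendsto_cong)
  qed

  define g where "g p = (\<Sum>s=1..S. \<bar>\<gamma> (fst p) s\<bar>)" for p :: "nat \<times> 'a"
  have g_lim: "(g \<longlongrightarrow> 0) in_prob"
    unfolding g_def by (intro tendsto_null_sum tendsto_rabs_zero tendsto_in_prob_const[OF \<gamma>_lim]) auto
  \<comment> \<open>The linearisation error is N times a factor tending to zero, and q N is tight,
    so the error is negligible even after scaling.\<close>
  have expT: "((\<lambda>p. q p * (exp_moment S m (T p) - exp_moment S m (\<gamma> (fst p))) - cd p) \<longlongrightarrow> 0) in_prob"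
  proof (rule Lim_null_comparison[OF always_eventually])
    have "((\<lambda>p. exp (g p + N p) - 1) \<longlongrightarrow> exp (0 + 0) - 1) in_prob"
      by (intro tendsto_intros g_lim N_lim)
    then have "((\<lambda>p. exp (g p + N p) - 1) \<longlongrightarrow> 0) in_prob" by simp
    then show "((\<lambda>p. (exp (g p + N p) - 1) * (q p * N p)) \<longlongrightarrow> 0) in_prob"
      by (rule bounded_in_prob_mult_0[OF N_tight])
    show "\<forall>p. norm (q p * (exp_moment S m (T p) - exp_moment S m (\<gamma> (fst p))) - cd p) \<le> (exp (g p + N p) - 1) * (q p * N p)"
    proof
      fix p
      have Tp: "(\<lambda>s. \<gamma> (fst p) s + \<delta> p s) = T p" by (simp add: \<delta>_def)
      have cdp: "cd p = q p * (\<Sum>s=1..S. \<delta> p s * (LINT t|lborel. m t * t ^ s) / fact s)"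
        by (simp add: cd_def c sum_distrib_left mult_ac)
      have "q p * (exp_moment S m (T p) - exp_moment S m (\<gamma> (fst p))) - cd p =
        q p * (exp_moment S m (T p) - exp_moment S m (\<gamma> (fst p)) - (\<Sum>s=1..S. \<delta> p s * (LINT t|lborel. m t * t ^ s) / fact s))"
        unfolding cdp by (simp only: right_diff_distrib)
      then have "norm (q p * (exp_moment S m (T p) - exp_moment S m (\<gamma> (fst p))) - cd p) =
        q p * \<bar>exp_moment S m (T p) - exp_moment S m (\<gamma> (fst p)) - (\<Sum>s=1..S. \<delta> p s * (LINT t|lborel. m t * t ^ s) / fact s)\<bar>"
        using q_nonneg[of p] by (simp add: abs_mult)
      also have "\<dots> \<le> q p * (N p * (exp (g p + N p) - 1))"
        using exp_moment_first_order[OF m z(2), of S "\<gamma> (fst p)" "\<delta> p"] unfolding Tp N_def g_def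
        by (intro mult_left_mono q_nonneg)
      finally show "norm (q p * (exp_moment S m (T p) - exp_moment S m (\<gamma> (fst p))) - cd p) \<le> (exp (g p + N p) - 1) * (q p * N p)"
        by (simp add: mult_ac)
    qed
  qed
  \<comment> \<open>At zero coefficients the denominator is the integral of \<open>m\<close>, which
    is 1.\<close>
  have exp\<gamma>_lim: "((\<lambda>p. exp_moment S m (\<gamma> (fst p))) \<longlongrightarrow> 1) in_prob"
  proof -
    have c\<gamma>: "((\<lambda>p. \<Sum>s=1..S. \<gamma> (fst p) s * (LINT t|lborel. m t * t ^ s) / fact s) \<longlongrightarrow> 0) in_prob"
      by (intro tendsto_null_sum tendsto_divide_zero tendsto_mult_left_zero tendsto_in_prob_const[OF \<gamma>_lim]) auto
    have bound: "\<forall>p. norm (exp_moment S m (\<gamma> (fst p)) - 1 - (\<Sum>s=1..S. \<gamma> (fst p) s * (LINT t|lborel. m t * t ^ s) / fact s))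
        \<le> g p * (exp (g p) - 1)"
    proof
      fix p :: "nat \<times> 'a"
      have "exp_moment S m (\<lambda>_. 0) = 1" using m(3) by (simp add: exp_moment_def)
      then show "norm (exp_moment S m (\<gamma> (fst p)) - 1 - (\<Sum>s=1..S. \<gamma> (fst p) s * (LINT t|lborel. m t * t ^ s) / fact s)) \<le> g p * (exp (g p) - 1)"
        using exp_moment_first_order[OF m z(2), of S "\<lambda>_. 0" "\<gamma> (fst p)"] by (simp add: g_def)
    qed
    have "((\<lambda>p. g p * (exp (g p) - 1)) \<longlongrightarrow> 0 * (exp 0 - 1)) in_prob"
      by (intro tendsto_intros g_lim)
    then have "((\<lambda>p. g p * (exp (g p) - 1)) \<longlongrightarrow> 0) in_prob" by simp
    then have "((\<lambda>p. exp_moment S m (\<gamma> (fst p)) - 1 - (\<Sum>s=1..S. \<gamma> (fst p) s * (LINT t|lborel. m t * t ^ s) / fact s)) \<longlongrightarrow> 0) in_prob"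
      by (rule Lim_null_comparison[OF always_eventually[OF bound]])
    from tendsto_add[OF tendsto_add[OF this c\<gamma>] tendsto_const[of 1]] show ?thesis by simp
  qed
  have expT_lim: "((\<lambda>p. exp_moment S m (T p)) \<longlongrightarrow> 1) in_prob"
  proof -
    have "bounded_in_prob (\<lambda>p. (q p * (exp_moment S m (T p) - exp_moment S m (\<gamma> (fst p))) - cd p) + cd p)"
      by (intro bounded_in_prob_add bounded_in_prob_tendsto[OF expT] cd_tight)
    from bounded_in_prob_mult_0[OF this q_inv]
    have "((\<lambda>p. 1 / q p * (q p * (exp_moment S m (T p) - exp_moment S m (\<gamma> (fst p))))) \<longlongrightarrow> 0) in_prob" by simp
    moreover have "\<forall>\<^sub>F p in in_prob. 1 / q p * (q p * (exp_moment S m (T p) - exp_moment S m (\<gamma> (fst p)))) =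
        exp_moment S m (T p) - exp_moment S m (\<gamma> (fst p))"
      using q_ne by eventually_elim simp
    ultimately have "((\<lambda>p. exp_moment S m (T p) - exp_moment S m (\<gamma> (fst p))) \<longlongrightarrow> 0) in_prob"
      by (simp add: tendsto_cong)
    from tendsto_add[OF this exp\<gamma>_lim] show ?thesis by simp
  qed

  define \<omega> where "\<omega> t = m t - (\<Sum>j=1..S. a j * G' j t)" for t
  define B where "B = f0 * D (Suc S) x0 * \<Xi> * (c (Suc S) - (\<Sum>j=1..S. a j * \<Omega> j (Suc S)))"
  \<comment> \<open>The scaled estimation error with its random denominator cleared: both the
    average and the denominator now enter linearly.\<close>
  define num where "num p = q p * (local_avg m p - f (x (fst p)) * exp_moment S m (T p))" for p
  have k\<omega>: "kernel_fun z \<omega>"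
    unfolding \<omega>_def
    using kernel_fun_add[OF m(1) kernel_fun_scale[OF kernel_fun_sum[of "{1..S}" z "\<lambda>j t. a j * G' j t"], of "-1"]]
    by (simp add: kernel_fun_scale G')
  have fx_lim: "((\<lambda>p. f (x (fst p))) \<longlongrightarrow> f0) in_prob" by (rule tendsto_in_prob_const[OF f_x_lim])
  have num_lim: "((\<lambda>p. num p - (local_fluct \<omega> p + B)) \<longlongrightarrow> 0) in_prob"
  proof -
    define R where "R n = local_mean m n - f (x n) * (exp_moment S m (\<gamma> n) + h n ^ Suc S * D (Suc S) (x n) * c (Suc S))" for n
    have "(\<lambda>n. sqrt (real n * h n) * R n) \<longlonglongrightarrow> 0"
      unfolding R_def c by (intro scaled_remainder_lim[OF bias] density_mean_expansion m)
    then have l1: "((\<lambda>p. q p * R (fst p)) \<longlongrightarrow> 0) in_prob" unfolding q_def by (rule tendsto_in_prob_const)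
    have "(\<lambda>n. f (x n) * ((sqrt (real n * h n) * h n ^ Suc S) * D (Suc S) (x n) * c (Suc S))) \<longlonglongrightarrow>
        f0 * (\<Xi> * D (Suc S) x0 * c (Suc S))"
      by (intro tendsto_mult f_x_lim bias D_lim tendsto_const) simp
    from tendsto_in_prob_const[OF this]
    have l2: "((\<lambda>p. f (x (fst p)) * (q p * h (fst p) ^ Suc S * D (Suc S) (x (fst p)) * c (Suc S))) \<longlongrightarrow> f0 * \<Xi> * \<beta> * c (Suc S)) in_prob"
      by (simp add: q_def \<beta>_def mult_ac)
    have l3: "((\<lambda>p. f (x (fst p)) * (q p * (exp_moment S m (T p) - exp_moment S m (\<gamma> (fst p))) - cd p)) \<longlongrightarrow> f0 * 0) in_prob"
      by (intro tendsto_mult fx_lim expT)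
    have l4: "((\<lambda>p. (f (x (fst p)) - f0) * cd p) \<longlongrightarrow> 0) in_prob"
      using fx_lim by (intro bounded_in_prob_mult_0[OF cd_tight]) (simp add: LIM_zero)
    have l5: "((\<lambda>p. \<Sum>j=1..S. a j * (q p * r j p - local_fluct (G' j) p)) \<longlongrightarrow> (\<Sum>j=1..S. a j * (\<Xi> * \<beta> * (f0 * \<Omega> j (Suc S))))) in_prob"
      by (intro tendsto_sum tendsto_mult_left r_lim)
    \<comment> \<open>The pieces are arranged to add up exactly to
      \<open>num p - (local_fluct \<omega> p + B)\<close>; the term with f(x) - f0 pays for
      replacing f(x) by its limit before \<open>cd\<close>.\<close>
    have lim: "((\<lambda>p. q p * R (fst p) + f (x (fst p)) * (q p * h (fst p) ^ Suc S * D (Suc S) (x (fst p)) * c (Suc S))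
       - f (x (fst p)) * (q p * (exp_moment S m (T p) - exp_moment S m (\<gamma> (fst p))) - cd p)
       - (f (x (fst p)) - f0) * cd p - (f0 * cd p - (\<Sum>j=1..S. a j * (q p * r j p)))
       - (\<Sum>j=1..S. a j * (q p * r j p - local_fluct (G' j) p)) - B)
      \<longlongrightarrow> 0 + f0 * \<Xi> * \<beta> * c (Suc S) - f0 * 0 - 0 - 0 - (\<Sum>j=1..S. a j * (\<Xi> * \<beta> * (f0 * \<Omega> j (Suc S)))) - B) in_prob"
      by (intro tendsto_add tendsto_diff l1 l2 l3 l4 l5 cd_lim tendsto_const)
    have zero: "0 + f0 * \<Xi> * \<beta> * c (Suc S) - f0 * 0 - 0 - 0 - (\<Sum>j=1..S. a j * (\<Xi> * \<beta> * (f0 * \<Omega> j (Suc S)))) - B = 0"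
      by (simp add: B_def \<beta>_def right_diff_distrib sum_distrib_left mult_ac)
    have ev: "\<forall>\<^sub>F p in in_prob. q p * R (fst p) + f (x (fst p)) * (q p * h (fst p) ^ Suc S * D (Suc S) (x (fst p)) * c (Suc S))
       - f (x (fst p)) * (q p * (exp_moment S m (T p) - exp_moment S m (\<gamma> (fst p))) - cd p)
       - (f (x (fst p)) - f0) * cd p - (f0 * cd p - (\<Sum>j=1..S. a j * (q p * r j p)))
       - (\<Sum>j=1..S. a j * (q p * r j p - local_fluct (G' j) p)) - B = num p - (local_fluct \<omega> p + B)"
      using eventually_in_prob_const[OF eventually_well_placed]
    proof eventually_elim
      case (elim p)
      have "local_fluct \<omega> p = local_fluct m p - (\<Sum>j=1..S. a j * local_fluct (G' j) p)"
        using local_fluct_lincomb[OF elim m(1), of "{1..S}" G' a "snd p"] G' unfolding \<omega>_def by simp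
      moreover have "local_fluct m p = q p * local_avg m p - q p * local_mean m (fst p)"
        by (simp add: local_fluct_def q_def right_diff_distrib)
      ultimately show ?case
        by (simp add: num_def R_def right_diff_distrib sum_subtractf) (simp add: algebra_simps)
    qed
    show ?thesis by (rule Lim_transform_eventually[OF lim[unfolded zero] ev])
  qed
  have num_tight: "bounded_in_prob num"
  proof -
    have "bounded_in_prob (\<lambda>p. (num p - (local_fluct \<omega> p + B)) + (local_fluct \<omega> p + B))"
      by (intro bounded_in_prob_add bounded_in_prob_tendsto[OF num_lim] local_fluct_tight k\<omega> bounded_in_prob_tendsto[OF tendsto_const])
    then show ?thesis by simp
  qed
  \<comment> \<open>Restoring a denominator that tends to 1 changes the tight \<open>num\<close>
    negligibly.\<close>
  have "((\<lambda>p. 1 / exp_moment S m (T p) - 1) \<longlongrightarrow> 1 / 1 - 1) in_prob"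
    by (intro tendsto_intros expT_lim) simp
  then have "((\<lambda>p. 1 / exp_moment S m (T p) - 1) \<longlongrightarrow> 0) in_prob" by simp
  from tendsto_add[OF bounded_in_prob_mult_0[OF num_tight this] num_lim]
  have lim: "((\<lambda>p. (1 / exp_moment S m (T p) - 1) * num p + (num p - (local_fluct \<omega> p + B))) \<longlongrightarrow> 0) in_prob" by simp
  have ev: "\<forall>\<^sub>F p in in_prob. (1 / exp_moment S m (T p) - 1) * num p + (num p - (local_fluct \<omega> p + B)) =
     q p * (local_avg m p / exp_moment S m (T p) - f (x (fst p))) - (local_fluct \<omega> p + B)"
    using order_tendstoD(1)[OF expT_lim zero_less_one_class.zero_less_one]
    by eventually_elim (simp add: num_def field_simps)
  show ?thesis
    using Lim_transform_eventually[OF lim ev]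
    unfolding \<omega>_def[symmetric, abs_def] B_def[symmetric] q_def[symmetric] .
qed

end

section \<open>The estimator as a function of the data\<close>

lemma sum_atLeast1_shift: "(\<Sum>i=1..S. F i) = (\<Sum>i=0..<S. F (Suc i) :: real)"
  by (rule sum.reindex_bij_witness[of _ Suc "\<lambda>i. i - 1"]) auto

text \<open>The inverse provided by \<open>invertible_mat\<close> comes without dimensions; the two
  product identities force it to be S by S. Then the matrix is a unit of the matrix ring, so
  \<open>mat_inverse\<close> cannot return \<open>None\<close> and \<open>the\<close> yields the
  true inverse.\<close>

lemma Omega_inv_left_inverse:
  assumes "invertible_mat (Omega_mat S z g)"
  shows "Omega_inv S z g \<in> carrier_mat S S"
    and "i \<in> {1..S} \<Longrightarrow> s \<in> {1..S} \<Longrightarrow>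
      (\<Sum>j=1..S. Omega_inv S z g $$ (i - 1, j - 1) * Omega z g j s) = (if i = s then 1 else 0)"
proof -
  let ?A = "Omega_mat S z g"
  have A: "?A \<in> carrier_mat S S" by (simp add: Omega_mat_def)
  obtain B where B: "?A * B = 1\<^sub>m (dim_row ?A)" "B * ?A = 1\<^sub>m (dim_row B)"
    using assms by (auto simp: invertible_mat_def inverts_mat_def)
  have "dim_col (?A * B) = S" unfolding B(1) using A by simp
  then have "dim_col B = S" by simp
  moreover have "dim_row B = S"
  proof -
    have "dim_col (B * ?A) = dim_row B" unfolding B(2) by simp
    then show ?thesis using A by simp
  qed
  ultimately have Bc: "B \<in> carrier_mat S S" by (intro carrier_matI)
  have "?A \<in> Units (ring_mat TYPE(real) S ())"
    unfolding Units_def ring_mat_simps using A Bc B by auto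
  then have "mat_inverse ?A \<noteq> None" using mat_inverse(1)[OF A, of "()"] by auto
  then have "mat_inverse ?A = Some (Omega_inv S z g)" by (auto simp: Omega_inv_def)
  from mat_inverse(2)[OF A this]
  have inv: "Omega_inv S z g * ?A = 1\<^sub>m S" and W: "Omega_inv S z g \<in> carrier_mat S S" by auto
  show "Omega_inv S z g \<in> carrier_mat S S" by (rule W)
  assume i: "i \<in> {1..S}" and s: "s \<in> {1..S}"
  have "(\<Sum>j=1..S. Omega_inv S z g $$ (i - 1, j - 1) * Omega z g j s) =
    (\<Sum>j=0..<S. Omega_inv S z g $$ (i - 1, j) * ?A $$ (j, s - 1))"
    using s by (subst sum_atLeast1_shift) (auto simp: Omega_mat_def intro!: sum.cong)
  also have "\<dots> = (Omega_inv S z g * ?A) $$ (i - 1, s - 1)"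
    using i s A W by (subst index_mult_mat) (auto simp: scalar_prod_def intro!: sum.cong)
  also have "\<dots> = (if i = s then 1 else 0)"
    unfolding inv using i s by (auto simp: one_mat_def)
  finally show "(\<Sum>j=1..S. Omega_inv S z g $$ (i - 1, j - 1) * Omega z g j s) = (if i = s then 1 else 0)" .
qed

text \<open>Associativity, c (W v) = (c W) v: with v built from \<open>g'\<close> or from a column
  of \<Omega>, the same weights c W appear in \<omega> and in the bias constant.\<close>

lemma scalar_prod_c_vec:
  assumes W: "W \<in> carrier_mat S S"
  shows "Matrix.scalar_prod (c_vec S m z) (W *\<^sub>v Matrix.vec S v) =
    (\<Sum>j=1..S. (\<Sum>i=1..S. c_const m i z * W $$ (i - 1, j - 1)) * v (j - 1))"
proof -
  have "Matrix.scalar_prod (c_vec S m z) (W *\<^sub>v Matrix.vec S v) =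
    (\<Sum>i=0..<S. \<Sum>j=0..<S. c_const m (Suc i) z * (W $$ (i, j) * v j))"
    using W by (auto simp: scalar_prod_def c_vec_def sum_distrib_left intro!: sum.cong)
  also have "\<dots> = (\<Sum>j=0..<S. (\<Sum>i=0..<S. c_const m (Suc i) z * W $$ (i, j)) * v j)"
    by (subst sum.swap) (simp add: sum_distrib_right mult.assoc)
  finally show ?thesis unfolding sum_atLeast1_shift by simp
qed

text \<open>If the square integrates to zero, the function vanishes almost everywhere and so does
  its integral.\<close>

lemma kernel_fun_square_integral_pos:
  assumes "kernel_fun z \<phi>" "(LINT t|lborel. \<phi> t) \<noteq> 0"
  shows "0 < (LINT t|lborel. (\<phi> t)\<^sup>2)"
proof (rule ccontr)
  assume "\<not> 0 < (LINT t|lborel. (\<phi> t)\<^sup>2)"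
  moreover have "0 \<le> (LINT t|lborel. (\<phi> t)\<^sup>2)" by (intro integral_nonneg_AE) simp
  ultimately have "(LINT t|lborel. (\<phi> t)\<^sup>2) = 0" by simp
  then have "AE t in lborel. (\<phi> t)\<^sup>2 = 0"
    using integral_nonneg_eq_0_iff_AE[OF kernel_funD(3)[OF assms(1)]] by simp
  then have "AE t in lborel. \<phi> t = 0" by simp
  then have "(LINT t|lborel. \<phi> t) = (LINT (t::real)|lborel. (0::real))"
    using kernel_funD(1)[OF assms(1)] by (intro integral_cong_AE) auto
  then show False using assms(2) by simp
qed

text \<open>Measuring distances in units of h isolates the factor h^(s-1) in column s, which the
  rescaling of the unknowns absorbs.\<close>

lemma score_coeff_eq:
  assumes "0 < h"
  shows "score_coeff g n h x y j s = h ^ (s - 1) / fact (s - 1) *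
    ((\<Sum>i=1..n. g j ((y i - x) / h) * ((y i - x) / h) ^ (s - 1)) / (real n * h))"
proof -
  have "g j ((y i - x) / h) * ((y i - x) ^ (s - 1) / fact (s - 1)) =
    h ^ (s - 1) / fact (s - 1) * (g j ((y i - x) / h) * ((y i - x) / h) ^ (s - 1))" for i
    using assms by (simp add: power_divide)
  then have "score_coeff g n h x y j s = 1 / (real n * h) *
    (h ^ (s - 1) / fact (s - 1) * (\<Sum>i=1..n. g j ((y i - x) / h) * ((y i - x) / h) ^ (s - 1)))"
    unfolding score_coeff_def by (simp only: sum_distrib_left)
  then show ?thesis by simp
qed

lemma score_lhs_eq: "score_lhs g' n h x y j = (\<Sum>i=1..n. g' j ((y i - x) / h)) / (real n * h) / h"
  by (simp add: score_lhs_def power2_eq_square)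

text \<open>A null vector, with the powers of h of the columns moved into \<delta>, solves the
  perturbed system with zero right-hand side, so it must vanish.\<close>

lemma invertible_score_mat:
  assumes h: "0 < h"
    and A: "\<And>j s. A j s = - (1 / fact (s - 1)) *
      ((\<Sum>i=1..n. g j ((y i - x) / h) * ((y i - x) / h) ^ (s - 1)) / (real n * h))"
    and W: "\<And>i s. i \<in> {1..S} \<Longrightarrow> s \<in> {1..S} \<Longrightarrow> (\<Sum>j=1..S. W i j * A0 j s) = (if i = s then 1 else 0)"
    and c: "0 < c" and close: "(\<Sum>i=1..S. \<Sum>j=1..S. \<Sum>s=1..S. \<bar>W i j\<bar> * \<bar>A j s - c * A0 j s\<bar>) \<le> c / 2"
  shows "invertible_mat (score_mat S g n h x y)"
proof -
  let ?M = "score_mat S g n h x y"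
  have M: "?M \<in> carrier_mat S S" by (simp add: score_mat_def)
  have "det ?M \<noteq> 0"
  proof
    assume "det ?M = 0"
    then obtain v where v: "v \<in> carrier_vec S" "v \<noteq> 0\<^sub>v S" "?M *\<^sub>v v = 0\<^sub>v S"
      using det_0_iff_vec_prod_zero_field[OF M] by auto
    define \<delta> where "\<delta> s = v $ (s - 1) * h ^ (s - 1)" for s
    have sys: "0 = (\<Sum>s=1..S. \<delta> s * A j s)" if j: "j \<in> {1..S}" for j
    proof -
      have "0 = (?M *\<^sub>v v) $ (j - 1)" using v j by auto
      also have "\<dots> = (\<Sum>s=0..<S. score_coeff g n h x y j (Suc s) * v $ s)"
        using v(1) j by (auto simp: score_mat_def scalar_prod_def intro!: sum.cong)
      also have "\<dots> = (\<Sum>s=1..S. score_coeff g n h x y j s * v $ (s - 1))"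
        unfolding sum_atLeast1_shift by simp
      also have "\<dots> = (\<Sum>s=1..S. - (\<delta> s * A j s))"
        by (intro sum.cong refl, unfold score_coeff_eq[OF h] \<delta>_def A) simp
      finally show ?thesis by (simp add: sum_negf)
    qed
    have "(\<Sum>i=1..S. \<bar>\<delta> i\<bar>) \<le> 2 / c * (\<Sum>i=1..S. \<Sum>j=1..S. \<bar>W i j\<bar> * \<bar>0\<bar>)"
      by (rule perturbed_linear_system(1)[where A=A and ?A0.0=A0 and r="\<lambda>_. 0", OF W c close sys])
    then have "(\<Sum>i=1..S. \<bar>\<delta> i\<bar>) \<le> 0" by simp
    moreover have "0 \<le> (\<Sum>i=1..S. \<bar>\<delta> i\<bar>)" by (rule sum_nonneg) simp
    ultimately have "(\<Sum>i=1..S. \<bar>\<delta> i\<bar>) = 0" by linarith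
    then have \<delta>0: "\<delta> i = 0" if "i \<in> {1..S}" for i using that by (subst (asm) sum_nonneg_eq_0_iff) auto
    have "v = 0\<^sub>v S"
    proof (rule eq_vecI)
      fix i assume "i < dim_vec (0\<^sub>v S :: real Matrix.vec)"
      then show "v $ i = 0\<^sub>v S $ i" using \<delta>0[of "Suc i"] h by (simp add: \<delta>_def)
    qed (use v in auto)
    then show False using v by simp
  qed
  from det_non_zero_imp_unit[OF M this]
  obtain B where "B \<in> carrier_mat S S" "B * ?M = 1\<^sub>m S" "?M * B = 1\<^sub>m S"
    unfolding Units_def ring_mat_simps by auto
  then show ?thesis
    using M unfolding invertible_mat_def inverts_mat_def by (intro conjI exI[of _ B]) auto
qed

lemma density_est_eq:
  assumes "\<And>t. t \<notin> {-z..1} \<Longrightarrow> m t = 0"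
  shows "density_est S z m n h x y \<beta> =
    ((\<Sum>i=1..n. m ((y i - x) / h)) / (real n * h)) / exp_moment S m (\<lambda>s. \<beta> s * h ^ s)"
proof -
  have i: "(LINT t:{-z..1}|lborel. m t * exp (\<Sum>s=1..S. \<beta> s * t ^ s * h ^ s / fact s)) =
    (LINT t|lborel. m t * exp (\<Sum>s=1..S. \<beta> s * t ^ s * h ^ s / fact s))"
    by (rule set_integral_supported) (rule assms)
  have e: "(\<Sum>s=1..S. \<beta> s * t ^ s * h ^ s / fact s) = (\<Sum>s=1..S. \<beta> s * h ^ s * t ^ s / fact s)" for t
    by (rule sum.cong) (simp_all add: mult_ac)
  show ?thesis unfolding density_est_def exp_moment_def i unfolding e by simp
qed

lemma tendsto_zero_of_power:
  fixes h :: "nat \<Rightarrow> real"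
  assumes "\<And>n. 0 < h n" "(\<lambda>n. h n ^ k) \<longlonglongrightarrow> 0"
  shows "h \<longlonglongrightarrow> 0"
proof (rule tendstoI)
  fix e :: real assume e: "e > 0"
  then have "\<forall>\<^sub>F n in sequentially. h n ^ k < e ^ k" by (intro order_tendstoD(2)[OF assms(2)]) simp
  then show "\<forall>\<^sub>F n in sequentially. dist (h n) 0 < e"
  proof eventually_elim
    case (elim n)
    then have "h n < e" by (rule power_less_imp_less_base) (use e in simp)
    then show ?case using assms(1)[of n] by simp
  qed
qed

lemma nderiv_within_has_derivative:
  assumes "nderiv_within A j F differentiable (at y within A)"
  shows "(nderiv_within A j F has_real_derivative nderiv_within A (Suc j) F y) (at y within A)"
  using assms by (simp add: vector_derivative_works has_real_derivative_iff_has_vector_derivative)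

text \<open>The integrand is jointly measurable in the sample point and t, and integrating t out
  preserves measurability.\<close>

lemma (in prob_space) exp_moment_measurable:
  assumes [measurable]: "m \<in> borel_measurable borel"
    and T: "\<And>s. s \<in> {1..S} \<Longrightarrow> (\<lambda>w. T w s) \<in> borel_measurable M"
  shows "(\<lambda>w. exp_moment S m (T w)) \<in> borel_measurable M"
proof -
  have [measurable]: "(\<lambda>p. \<Sum>s=1..S. T (fst p) s * snd p ^ s / fact s) \<in> borel_measurable (M \<Otimes>\<^sub>M lborel)"
  proof (rule borel_measurable_sum)
    fix s assume "s \<in> {1..S}"
    note [measurable] = measurable_compose[OF measurable_fst T[OF this]]
    show "(\<lambda>p. T (fst p) s * snd p ^ s / fact s) \<in> borel_measurable (M \<Otimes>\<^sub>M lborel)" by measurable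
  qed
  have "(\<lambda>p. m (snd p) * exp (\<Sum>s=1..S. T (fst p) s * snd p ^ s / fact s)) \<in> borel_measurable (M \<Otimes>\<^sub>M lborel)"
    by measurable
  then have "(\<lambda>(w, t). m t * exp (\<Sum>s=1..S. T w s * t ^ s / fact s)) \<in> borel_measurable (M \<Otimes>\<^sub>M lborel)"
    by (simp add: case_prod_beta')
  then show ?thesis
    unfolding exp_moment_def by (rule lborel.borel_measurable_lebesgue_integral)
qed

theorem theorem2:
  fixes M :: "'a measure" and X :: "nat \<Rightarrow> 'a \<Rightarrow> real"
    and f :: "real \<Rightarrow> real" and U :: ereal and supp :: "real set"
    and S :: nat and h x :: "nat \<Rightarrow> real" and x0 z \<Xi> :: real
    and g g' :: "real \<Rightarrow> nat \<Rightarrow> real \<Rightarrow> real" and m :: "real \<Rightarrow> real \<Rightarrow> real"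
    and \<beta>hat :: "nat \<Rightarrow> 'a \<Rightarrow> nat \<Rightarrow> real"
  assumes S: "1 \<le> S"
    \<comment> \<open>the sample\<close>
    and M: "prob_space M"
    and indep: "prob_space.indep_vars M (\<lambda>_. borel) X {1..}"
    and dens: "\<And>i. 1 \<le> i \<Longrightarrow> distributed M lborel (X i) (\<lambda>y. ennreal (f y))"
    and U: "0 < U"
    and supp: "supp = {y. 0 \<le> y \<and> ereal y < U}"
    and f_pos: "\<And>y. y \<in> supp \<Longrightarrow> 0 < f y"
    and f_zero: "\<And>y. y \<notin> supp \<Longrightarrow> f y = 0"
    \<comment> \<open>the bandwidth\<close>
    and h_pos: "\<And>n. 0 < h n"
    and \<Xi>: "0 \<le> \<Xi>" "(\<lambda>n. real n * h n ^ (2 * S + 3)) \<longlonglongrightarrow> \<Xi>\<^sup>2"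
    and nh: "filterlim (\<lambda>n. real n * h n) at_top sequentially"
    \<comment> \<open>the evaluation points: a fixed point, or the points z h n near the boundary 0\<close>
    and x0: "x0 \<in> supp" "0 < f x0"
    and x_nonneg: "\<And>n. 0 \<le> x n"
    and x: "(\<forall>n. x n = x0) \<or> (x0 = 0 \<and> (\<forall>n. x n = z * h n))"
    and z: "\<forall>\<^sub>F n in sequentially. edge_ratio (x n) (h n) = z"
    and smooth: "cont_differentiable_near supp (S + 1) (\<lambda>y. ln (f y)) x0"
    \<comment> \<open>the functions g and m\<close>
    and g_supp: "\<And>j t. j \<in> {1..S} \<Longrightarrow> t \<notin> {-z..1} \<Longrightarrow> g z j t = 0"
    and g_deriv: "\<And>j t. j \<in> {1..S} \<Longrightarrow> t \<in> {-z..1} \<Longrightarrow>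
                    (g z j has_real_derivative g' z j t) (at t within {-z..1})"
    and g'_zero: "\<And>j t. j \<in> {1..S} \<Longrightarrow> t \<notin> {-z..1} \<Longrightarrow> g' z j t = 0"
    and g_ends: "\<And>j. j \<in> {1..S} \<Longrightarrow> g z j (-z) = 0 \<and> g z j 1 = 0"
    and g'_sq: "\<And>j. j \<in> {1..S} \<Longrightarrow> set_integrable lborel {-z..1} (\<lambda>t. (g' z j t)\<^sup>2)"
    and m_nonneg: "\<And>t. 0 \<le> m z t"
    and m_supp: "\<And>t. t \<notin> {-z..1} \<Longrightarrow> m z t = 0"
    and m_int: "set_integrable lborel {-z..1} (m z)" "(LINT t:{-z..1}|lborel. m z t) = 1"
    and m_sq: "set_integrable lborel {-z..1} (\<lambda>t. (m z t)\<^sup>2)"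
    and Omega: "invertible_mat (Omega_mat S z (g z))"
    \<comment> \<open>the first step: the random vector solving the linear system, with an arbitrary value
        on the event that the system is singular\<close>
    and \<beta>hat_meas: "\<And>n s. s \<in> {1..S} \<Longrightarrow> (\<lambda>w. \<beta>hat n w s) \<in> borel_measurable M"
    and \<beta>hat: "\<And>n w. w \<in> space M \<Longrightarrow>
            invertible_mat (score_mat S (g (edge_ratio (x n) (h n))) n (h n) (x n) (\<lambda>i. X i w)) \<Longrightarrow>
            solves_score_system S (g (edge_ratio (x n) (h n))) (g' (edge_ratio (x n) (h n)))
              n (h n) (x n) (\<lambda>i. X i w) (\<beta>hat n w)"
  shows "let fhat = (\<lambda>n w. density_est S (edge_ratio (x n) (h n)) (m (edge_ratio (x n) (h n)))
                             n (h n) (x n) (\<lambda>i. X i w) (\<beta>hat n w));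
             \<omega> = omega_fun S z (g z) (g' z) (m z);
             fx = limit_density f x;
             \<beta> = limit_log_deriv supp (S + 1) f x;
             B = fx * \<beta> * \<Xi> * (1 / fact (S + 1)) * (LINT t:{-z..1}|lborel. \<omega> t * t ^ (S + 1));
             V = fx * (LINT t:{-z..1}|lborel. (\<omega> t)\<^sup>2)
         in weak_conv_m
              (\<lambda>n. distr M borel (\<lambda>w. sqrt (real n * h n) * (fhat n w - f (x n))))
              (density lborel (\<lambda>y. ennreal (normal_density B (sqrt V) y)))
          \<and> B = fx * \<beta> * \<Xi> *
                  (c_const (m z) (S + 1) z - Matrix.scalar_prod (c_vec S (m z) z) (b_vec S z (g z)))"
proof -
  interpret prob_space M by (rule M)
  define D where "D i = nderiv_within supp i (\<lambda>y. ln (f y))" for i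
  \<comment> \<open>As an attained edge ratio, z lies between 0 and 1.\<close>
  obtain n0 where n0: "edge_ratio (x n0) (h n0) = z"
    using z by (auto simp: eventually_sequentially)
  have z01: "0 \<le> z" "z \<le> 1"
    using n0 x_nonneg[of n0] h_pos[of n0] by (auto simp: edge_ratio_def)

  \<comment> \<open>Dividing the convergent n h^(2S+3) by n leaves h^(2S+3), which therefore tends
    to zero.\<close>
  have h_lim: "h \<longlonglongrightarrow> 0"
  proof -
    have "(\<lambda>n. real n * h n ^ (2 * S + 3) * inverse (real n)) \<longlonglongrightarrow> \<Xi>\<^sup>2 * 0"
      by (intro tendsto_mult \<Xi>(2) lim_inverse_n)
    moreover have "\<forall>\<^sub>F n in sequentially. real n * h n ^ (2 * S + 3) * inverse (real n) = h n ^ (2 * S + 3)"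
      using eventually_gt_at_top[of 0] by eventually_elim simp
    ultimately have "(\<lambda>n. h n ^ (2 * S + 3)) \<longlonglongrightarrow> \<Xi>\<^sup>2 * 0" by (rule Lim_transform_eventually)
    then show ?thesis by (intro tendsto_zero_of_power[OF h_pos, where k="2 * S + 3"]) simp
  qed
  have x_lim: "x \<longlonglongrightarrow> x0"
  proof (cases "\<forall>n. x n = x0")
    case True
    then have "x = (\<lambda>_. x0)" by (simp add: fun_eq_iff)
    then show ?thesis by simp
  next
    case False
    then have "x0 = 0" "x = (\<lambda>n. z * h n)" using x by (auto simp: fun_eq_iff)
    then show ?thesis using tendsto_mult_right_zero[OF h_lim] by simp
  qed
  \<comment> \<open>Square root of the rate condition, with 1 + 2 (S + 1) = 2 S + 3; nonnegativity
    of \<Xi> selects the root.\<close>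
  have bias: "(\<lambda>n. sqrt (real n * h n) * h n ^ Suc S) \<longlonglongrightarrow> \<Xi>"
  proof -
    have "sqrt (real n * h n) * h n ^ Suc S = sqrt (real n * h n ^ (2 * S + 3))" for n
    proof -
      have "h n ^ Suc S = sqrt ((h n ^ Suc S)\<^sup>2)" using h_pos[of n] by simp
      then have "sqrt (real n * h n) * h n ^ Suc S = sqrt (real n * h n * (h n ^ Suc S)\<^sup>2)"
        by (metis real_sqrt_mult)
      also have "real n * h n * (h n ^ Suc S)\<^sup>2 = real n * h n ^ (2 * S + 3)"
      proof -
        have "h n * (h n ^ Suc S)\<^sup>2 = h n ^ Suc (Suc S * 2)"
          unfolding power_Suc[of "h n" "Suc S * 2"] power_mult ..
        moreover have "Suc (Suc S * 2) = 2 * S + 3" by simp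
        ultimately show ?thesis by (simp only: mult.assoc)
      qed
      finally show ?thesis .
    qed
    moreover have "(\<lambda>n. sqrt (real n * h n ^ (2 * S + 3))) \<longlonglongrightarrow> sqrt (\<Xi>\<^sup>2)"
      by (intro tendsto_real_sqrt \<Xi>(2))
    ultimately show ?thesis using \<Xi>(1) by simp
  qed

  obtain \<delta> where \<delta>: "\<delta> > 0"
    and diff: "\<And>j y. j < S + 1 \<Longrightarrow> y \<in> supp \<inter> ball x0 \<delta> \<Longrightarrow> D j differentiable (at y within supp)"
    and contS: "continuous_on (supp \<inter> ball x0 \<delta>) (D (S + 1))"
    using smooth unfolding cont_differentiable_near_def D_def by blast
  define I where "I = supp \<inter> ball x0 \<delta>"
  have D_deriv: "(D i has_real_derivative D (Suc i) y) (at y within I)" if "i \<le> S" "y \<in> I" for i y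
  proof -
    have "(D i has_real_derivative D (Suc i) y) (at y within supp)"
      unfolding D_def using diff[of i y] that by (intro nderiv_within_has_derivative) (auto simp: I_def D_def)
    then show ?thesis by (rule DERIV_subset) (auto simp: I_def)
  qed
  \<comment> \<open>Makes I, the intersection of the support with a ball, convex also when x0 is an
    endpoint.\<close>
  have supp_int: "is_interval supp"
  proof -
    have "ereal y < U" if "ereal b < U" "y \<le> b" for y b
      using that by (intro le_less_trans[of "ereal y" "ereal b" U]) auto
    then show ?thesis unfolding is_interval_1 supp by auto
  qed
  have I_convex: "convex I"
    unfolding I_def by (intro convex_Int convex_ball is_interval_convex supp_int)
  have x0I: "x0 \<in> I" using x0 \<delta> by (simp add: I_def)
  have f_exp: "f y = exp (D 0 y)" if "y \<in> I" for y
    using f_pos that by (simp add: I_def D_def)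
  have near: "\<forall>\<^sub>F n in sequentially. \<forall>t\<in>{-z..1}. x n + t * h n \<in> I"
  proof -
    have "\<forall>\<^sub>F y in nhds x0. ereal y < U"
    proof -
      have "((\<lambda>y. ereal y) \<longlongrightarrow> ereal x0) (nhds x0)" by (intro tendsto_intros filterlim_ident)
      moreover have "ereal x0 < U" using x0 supp by simp
      ultimately show ?thesis by (rule order_tendstoD(2))
    qed
    then obtain \<epsilon> where \<epsilon>: "\<epsilon> > 0" "\<And>y. dist y x0 < \<epsilon> \<Longrightarrow> ereal y < U"
      unfolding eventually_nhds_metric by blast
    define r where "r = min \<delta> \<epsilon>"
    have r: "r > 0" using \<delta> \<epsilon> by (simp add: r_def)
    have "\<forall>\<^sub>F n in sequentially. dist (x n) x0 < r / 2" using x_lim half_gt_zero[OF r] by (rule tendstoD)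
    moreover have "\<forall>\<^sub>F n in sequentially. h n < r / 2" using h_lim half_gt_zero[OF r] by (rule order_tendstoD(2))
    ultimately show ?thesis using z
    proof eventually_elim
      case (elim n)
      have hn: "0 < h n" by (rule h_pos)
      \<comment> \<open>The definition of the edge ratio keeps the left end x - z h of the window
        inside the support.\<close>
      have zx: "z * h n \<le> x n"
      proof -
        have "z \<le> x n / h n" using elim(3) by (auto simp: edge_ratio_def min_def split: if_splits)
        then show ?thesis using hn by (simp add: pos_le_divide_eq)
      qed
      show ?case
      proof
        fix t assume t: "t \<in> {-z..1}"
        then have "- z * h n \<le> t * h n" "t * h n \<le> 1 * h n"
          using hn mult_right_mono[of "-z" t "h n"] mult_right_mono[of t 1 "h n"] by auto
        moreover have "z * h n \<le> 1 * h n" using hn z01 by (intro mult_right_mono) auto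
        ultimately have nn: "0 \<le> x n + t * h n" and "\<bar>x n + t * h n - x0\<bar> < r"
          using zx elim(1,2) unfolding dist_real_def abs_less_iff by linarith+
        then show "x n + t * h n \<in> I"
          using \<epsilon>(2)[of "x n + t * h n"] by (auto simp: I_def supp r_def dist_real_def abs_minus_commute)
      qed
    qed
  qed
  have f_lim: "\<forall>\<^sub>F n in sequentially. \<forall>t\<in>{-z..1}. \<bar>f (x n + t * h n) - f x0\<bar> < e" if e: "e > 0" for e
  proof -
    have "continuous_on I (D 0)" using D_deriv[of 0] by (intro DERIV_continuous_on[of I "D 0" "D 1"]) auto
    then have "continuous_on I (\<lambda>y. exp (D 0 y))" by (intro continuous_intros)
    then obtain d where d: "d > 0" "\<And>y. y \<in> I \<Longrightarrow> dist y x0 < d \<Longrightarrow> dist (exp (D 0 y)) (exp (D 0 x0)) < e"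
      using x0I e unfolding continuous_on_iff by blast
    have "\<forall>\<^sub>F n in sequentially. dist (x n) x0 < d / 2" using x_lim half_gt_zero[OF d(1)] by (rule tendstoD)
    moreover have "\<forall>\<^sub>F n in sequentially. h n < d / 2" using h_lim half_gt_zero[OF d(1)] by (rule order_tendstoD(2))
    ultimately show ?thesis using near
    proof eventually_elim
      case (elim n)
      have hn: "0 < h n" by (rule h_pos)
      show ?case
      proof
        fix t assume t: "t \<in> {-z..1}"
        then have "- 1 * h n \<le> t * h n" "t * h n \<le> 1 * h n" 
          using hn z01 mult_right_mono[of "-1" t "h n"] mult_right_mono[of t 1 "h n"] by auto
        then have "dist (x n + t * h n) x0 < d"
          using elim(1,2) unfolding dist_real_def abs_less_iff by linarith
        from d(2)[OF _ this] show "\<bar>f (x n + t * h n) - f x0\<bar> < e"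
          using elim(3) t f_exp x0I by (simp add: dist_real_def)
      qed
    qed
  qed
  have f_nonneg: "0 \<le> f y" for y using f_pos[of y] f_zero[of y] by (cases "y \<in> supp") auto
  note edge_ev = z and fx0 = x0(2)
  interpret log_smooth_sample M X f h x z "f x0" I D S x0
    by unfold_locales
      (use indep dens f_nonneg h_pos h_lim nh f_lim z01 I_convex near f_exp D_deriv contS x0I x_lim S in
        \<open>simp_all add: I_def\<close>)

  have kg: "kernel_fun z (g z j)" "kernel_fun z (g' z j)" if "j \<in> {1..S}" for j
    using derivative_kernel_fun[OF g_deriv[OF that] g_supp[OF that] g'_zero[OF that] g'_sq[OF that]] by auto
  have km: "kernel_fun z (m z)"
  proof -
    have "(\<lambda>t. indicator {-z..1} t *\<^sub>R m z t) = m z"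
      using m_supp by (auto simp: fun_eq_iff split: split_indicator)
    moreover have "(\<lambda>t. indicator {-z..1} t *\<^sub>R (m z t)\<^sup>2) = (\<lambda>t. (m z t)\<^sup>2)"
      using m_supp by (auto simp: fun_eq_iff split: split_indicator)
    ultimately show ?thesis
      using m_int(1) m_sq m_supp borel_measurable_integrable[of lborel "m z"]
      by (simp add: kernel_fun_def set_integrable_def)
  qed
  have supported: "(LINT t:{-z..1}|lborel. u t * v t) = (LINT t|lborel. u t * v t)"
    if "kernel_fun z u" for u v
    by (rule set_integral_supported[OF kernel_funD(2)[OF that]])
  have m1: "(LINT t|lborel. m z t) = 1"
    using m_int(2) supported[OF km, of "\<lambda>_. 1"] by simp

  define W where "W i j = Omega_inv S z (g z) $$ (i - 1, j - 1)" for i j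
  define c where "c s = (LINT t|lborel. m z t * t ^ s) / fact s" for s
  define a where "a j = (\<Sum>i=1..S. c i * W i j)" for j
  define \<Omega> where "\<Omega> j s = - (1 / fact (s - 1)) * (LINT t|lborel. g z j t * t ^ (s - 1))" for j s
  define A where "A j s p = - (1 / fact (s - 1)) * local_avg (\<lambda>t. g z j t * t ^ (s - 1)) p" for j s p
  define T where "T p s = \<beta>hat (fst p) (snd p) s * h (fst p) ^ s" for p s
  have c_const: "c_const (m z) s z = c s" for s
    by (simp add: c_const_def c_def supported[OF km])
  have Omega_eq: "Omega z (g z) j s = \<Omega> j s" if "j \<in> {1..S}" for j s
    using supported[OF kg(1)[OF that], of "\<lambda>t. t ^ (s - 1)"] by (simp add: Omega_def \<Omega>_def)
  have W: "(\<Sum>j=1..S. W i j * \<Omega> j s) = (if i = s then 1 else 0)" if "i \<in> {1..S}" "s \<in> {1..S}" for i s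
  proof -
    have "(\<Sum>j=1..S. W i j * \<Omega> j s) = (\<Sum>j=1..S. W i j * Omega z (g z) j s)"
      by (intro sum.cong refl) (simp add: Omega_eq)
    then show ?thesis using Omega_inv_left_inverse(2)[OF Omega that] by (simp add: W_def)
  qed
  note carrier = Omega_inv_left_inverse(1)[OF Omega]
  define \<omega> where "\<omega> t = m z t - (\<Sum>j=1..S. a j * g' z j t)" for t
  have omega_fun: "omega_fun S z (g z) (g' z) (m z) = \<omega>"
  proof
    fix t
    show "omega_fun S z (g z) (g' z) (m z) t = \<omega> t"
      unfolding omega_fun_def scalar_prod_c_vec[OF carrier] \<omega>_def a_def W_def c_const
      by (intro arg_cong2[where f="(-)"] refl sum.cong) auto
  qed
  have cb: "Matrix.scalar_prod (c_vec S (m z) z) (b_vec S z (g z)) = (\<Sum>j=1..S. a j * \<Omega> j (Suc S))"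
    unfolding b_vec_def scalar_prod_c_vec[OF carrier] a_def W_def c_const
    by (intro sum.cong refl) (simp add: Omega_eq)
  have k\<omega>: "kernel_fun z \<omega>"
    unfolding \<omega>_def
    using kernel_fun_add[OF km kernel_fun_scale[OF kernel_fun_sum[of "{1..S}" z "\<lambda>j t. a j * g' z j t"], of "-1"]]
    by (simp add: kernel_fun_scale kg)

  \<comment> \<open>For k = 0 this says that \<open>g'\<close> integrates to zero, so \<omega>
    inherits the mass of \<open>m\<close>; for k = S + 1 it turns moments of \<open>g'\<close> into
    entries of \<Omega>.\<close>
  have power_parts: "(LINT t|lborel. g' z j t * t ^ k) = - (LINT t|lborel. g z j t * (real k * t ^ (k - 1)))"
    if j: "j \<in> {1..S}" for j k
  proof (rule integral_by_parts_kernel[OF _ kg(2)[OF j] g_deriv[OF j] g_supp[OF j]])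
    show "((\<lambda>t. t ^ k) has_real_derivative real k * t ^ (k - 1)) (at t within {-z..1})" for t :: real
      by (auto intro!: derivative_eq_intros)
  qed (use z01 g_ends[OF j] in \<open>auto intro!: continuous_intros\<close>)
  have \<omega>_moment: "(LINT t|lborel. \<omega> t * t ^ k) = (LINT t|lborel. m z t * t ^ k) - (\<Sum>j=1..S. a j * (LINT t|lborel. g' z j t * t ^ k))" for k
  proof -
    have i: "integrable lborel (\<lambda>t. m z t * t ^ k)" "\<And>j. j \<in> {1..S} \<Longrightarrow> integrable lborel (\<lambda>t. g' z j t * t ^ k)"
      by (intro kernel_fun_integrable[OF power_kernel_fun[OF _ z01(2)]] km kg; assumption)+
    have "(LINT t|lborel. \<omega> t * t ^ k) = (LINT t|lborel. m z t * t ^ k - (\<Sum>j=1..S. a j * (g' z j t * t ^ k)))"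
      by (simp add: \<omega>_def left_diff_distrib sum_distrib_right mult.assoc)
    then show ?thesis using i by (simp del: atLeastAtMost_iff One_nat_def)
  qed
  have \<omega>1: "(LINT t|lborel. \<omega> t) = 1"
    using \<omega>_moment[of 0] power_parts[of _ 0] m1 by simp
  \<comment> \<open>The factor (S + 1) / (S + 1)! = 1 / S! produces the column of \<Omega> with
    index S + 1, so the two forms of the bias constant agree.\<close>
  have bias_const: "1 / fact (S + 1) * (LINT t|lborel. \<omega> t * t ^ (S + 1)) = c (Suc S) - (\<Sum>j=1..S. a j * \<Omega> j (Suc S))"
  proof -
    have "1 / fact (Suc S) * (LINT t|lborel. g' z j t * t ^ Suc S) = \<Omega> j (Suc S)" if "j \<in> {1..S}" for j
    proof -
      have "(LINT t|lborel. g z j t * (real (Suc S) * t ^ S)) = real (Suc S) * (LINT t|lborel. g z j t * t ^ S)"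
        by (simp add: mult.left_commute del: of_nat_Suc)
      then show ?thesis
        unfolding power_parts[OF that] \<Omega>_def by (simp add: divide_simps del: of_nat_Suc)
    qed
    then have "(\<Sum>j=1..S. a j * (1 / fact (Suc S) * (LINT t|lborel. g' z j t * t ^ Suc S))) = (\<Sum>j=1..S. a j * \<Omega> j (Suc S))"
      by (intro sum.cong) auto
    moreover have "1 / fact (Suc S) * (LINT t|lborel. \<omega> t * t ^ Suc S) =
      c (Suc S) - (\<Sum>j=1..S. a j * (1 / fact (Suc S) * (LINT t|lborel. g' z j t * t ^ Suc S)))"
      unfolding \<omega>_moment c_def
      by (simp add: right_diff_distrib sum_distrib_left mult.left_commute diff_divide_distrib sum_divide_distrib
          del: fact_Suc power_Suc)
    ultimately show ?thesis by simp
  qed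

  have fx: "limit_density f x = f x0" unfolding limit_density_def by (rule limI[OF f_x_lim])
  have \<beta>x: "limit_log_deriv supp (S + 1) f x = D (Suc S) x0"
    unfolding limit_log_deriv_def using limI[OF D_lim[of "Suc S"]] by (simp add: D_def)

  \<comment> \<open>Closeness of the random matrix to its limit, in probability, forces it to be
    invertible; on that event \<open>\<beta>hat\<close> solves the system, and multiplying by h
    gives the rescaled form.\<close>
  have sys: "\<forall>\<^sub>F p in in_prob. \<forall>j\<in>{1..S}. local_avg (g' z j) p = (\<Sum>s=1..S. T p s * A j s p)"
  proof -
    have A_lim: "(A j s \<longlongrightarrow> f x0 * \<Omega> j s) in_prob" if "j \<in> {1..S}" for j s
      using score_coefficient_lim[OF kg(1)[OF that] \<Omega>_def] by (simp add: A_def [abs_def])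
    have "\<forall>\<^sub>F p in in_prob. (\<Sum>i=1..S. \<Sum>j=1..S. \<Sum>s=1..S. \<bar>W i j\<bar> * \<bar>A j s p - f x0 * \<Omega> j s\<bar>) < f x0 / 2"
      using fx0 by (intro order_tendstoD(2)[OF score_matrix_error_lim[OF A_lim]]) auto
    then show ?thesis using eventually_in_prob_const[OF edge_ev] eventually_in_prob_space
    proof eventually_elim
      case (elim p)
      obtain n w where p: "p = (n, w)" by fastforce
      have edge: "edge_ratio (x n) (h n) = z" and w: "w \<in> space M" using elim p by auto
      have hn: "0 < h n" by (rule h_pos)
      have "invertible_mat (score_mat S (g z) n (h n) (x n) (\<lambda>i. X i w))"
        using elim(1) by (intro invertible_score_mat[OF hn _ W fx0, where A="\<lambda>j s. A j s p"])
          (auto simp: A_def local_avg_def p)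
      then have "solves_score_system S (g z) (g' z) n (h n) (x n) (\<lambda>i. X i w) (\<beta>hat n w)"
        using \<beta>hat[OF w, of n] unfolding edge by simp
      then have s: "score_lhs (g' z) n (h n) (x n) (\<lambda>i. X i w) j =
          - (\<Sum>s=1..S. \<beta>hat n w s * score_coeff (g z) n (h n) (x n) (\<lambda>i. X i w) j s)" if "j \<in> {1..S}" for j
        using that unfolding solves_score_system_def by blast
      show ?case
      proof
        fix j assume j: "j \<in> {1..S}"
        have "local_avg (g' z j) p = h n * score_lhs (g' z) n (h n) (x n) (\<lambda>i. X i w) j"
          using hn by (simp add: score_lhs_eq local_avg_def p)
        also have "\<dots> = (\<Sum>s=1..S. - (h n * (\<beta>hat n w s * score_coeff (g z) n (h n) (x n) (\<lambda>i. X i w) j s)))"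
          unfolding s[OF j] by (simp add: sum_distrib_left sum_negf)
        also have "\<dots> = (\<Sum>s=1..S. T p s * A j s p)"
        proof (rule sum.cong[OF refl])
          fix s assume "s \<in> {1..S}"
          then have "h n * h n ^ (s - 1) = h n ^ s" by (cases s) auto
          moreover have "score_coeff (g z) n (h n) (x n) (\<lambda>i. X i w) j s = - (h n ^ (s - 1) * A j s p)"
            by (simp add: score_coeff_eq[OF hn] A_def local_avg_def p)
          ultimately show "- (h n * (\<beta>hat n w s * score_coeff (g z) n (h n) (x n) (\<lambda>i. X i w) j s)) = T p s * A j s p"
            by (simp add: T_def p mult_ac)
        qed
        finally show "local_avg (g' z j) p = (\<Sum>s=1..S. T p s * A j s p)" .
      qed
    qed
  qed

  define B where "B = f x0 * D (Suc S) x0 * \<Xi> * (c (Suc S) - (\<Sum>j=1..S. a j * \<Omega> j (Suc S)))"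
  define V where "V = f x0 * (LINT t|lborel. (\<omega> t)\<^sup>2)"
  have V: "0 < V" using fx0 kernel_fun_square_integral_pos[OF k\<omega>] \<omega>1 by (simp add: V_def)
  define Z where "Z n w = sqrt (real n * h n) * (density_est S (edge_ratio (x n) (h n)) (m (edge_ratio (x n) (h n)))
      n (h n) (x n) (\<lambda>i. X i w) (\<beta>hat n w) - f (x n))" for n w
  have Z_eq: "Z n w = sqrt (real n * h n) * (local_avg (m z) (n, w) / exp_moment S (m z) (T (n, w)) - f (x n))"
    if "edge_ratio (x n) (h n) = z" for n w
  proof -
    have "T (n, w) = (\<lambda>s. \<beta>hat n w s * h n ^ s)" by (simp add: T_def fun_eq_iff)
    then show ?thesis
      unfolding Z_def that using density_est_eq[of z "m z" S n "h n" "x n"] m_supp by (simp add: local_avg_def)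
  qed
  have "weak_conv_m (\<lambda>n. distr M borel (Z n)) (density lborel (\<lambda>y. ennreal (normal_density B (sqrt V) y)))"
  proof (rule slutsky)
    show "random_variable borel (\<lambda>w. local_fluct \<omega> (n, w) + B)" for n
      using local_fluct_measurable[OF kernel_funD(1)[OF k\<omega>]] by simp
    show "weak_conv_m (\<lambda>n. distr M borel (\<lambda>w. local_fluct \<omega> (n, w) + B)) (density lborel (\<lambda>y. ennreal (normal_density B (sqrt V) y)))"
      by (rule local_fluct_clt[OF k\<omega> V_def V])
    show "real_distribution (density lborel (\<lambda>y. ennreal (normal_density B (sqrt V) y)))"
      "isCont (cdf (density lborel (\<lambda>y. ennreal (normal_density B (sqrt V) y)))) b" for b
      using V by (auto intro: normal_distribution_real_distribution isCont_cdf_normal_distribution)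
    \<comment> \<open>Restricted to indices with edge ratio z, where the kernel is
      \<open>m z\<close> and hence measurable.\<close>
    show "\<forall>\<^sub>F n in sequentially. random_variable borel (Z n)"
      using edge_ev
    proof eventually_elim
      case (elim n)
      note [measurable] = kernel_funD(1)[OF km]
      have [measurable]: "X i \<in> borel_measurable M" if "i \<in> {1..n}" for i using X_measurable that by simp
      have [measurable]: "(\<lambda>w. exp_moment S (m z) (T (n, w))) \<in> borel_measurable M"
        by (rule exp_moment_measurable) (auto simp: T_def intro!: borel_measurable_times \<beta>hat_meas)
      have "(\<lambda>w. sqrt (real n * h n) * (local_avg (m z) (n, w) / exp_moment S (m z) (T (n, w)) - f (x n))) \<in> borel_measurable M"
        unfolding local_avg_def fst_conv snd_conv by measurable
      then show ?case by (simp add: Z_eq[OF elim, abs_def])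
    qed
    have ev: "\<forall>\<^sub>F p in in_prob. sqrt (real (fst p) * h (fst p)) *
          (local_avg (m z) p / exp_moment S (m z) (T p) - f (x (fst p))) - (local_fluct \<omega> p + B) =
        Z (fst p) (snd p) - (local_fluct \<omega> (fst p, snd p) + B)"
      using eventually_in_prob_const[OF edge_ev] by eventually_elim (simp add: Z_eq)
    have "((\<lambda>p. sqrt (real (fst p) * h (fst p)) *
          (local_avg (m z) p / exp_moment S (m z) (T p) - f (x (fst p))) - (local_fluct \<omega> p + B)) \<longlongrightarrow> 0) in_prob"
      unfolding \<omega>_def [abs_def] B_def
      by (rule estimator_expansion[OF kg(2) g_deriv g_supp _ _ km m_nonneg m1 \<Omega>_def W bias A_def c_def a_def sys])
        (use g_ends in auto)
    then show "((\<lambda>p. Z (fst p) (snd p) - (local_fluct \<omega> (fst p, snd p) + B)) \<longlongrightarrow> 0) in_prob"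
      by (rule Lim_transform_eventually[OF _ ev])
  qed
  moreover have "f x0 * D (Suc S) x0 * \<Xi> * (1 / fact (S + 1)) * (LINT t:{-z..1}|lborel. \<omega> t * t ^ (S + 1)) = B"
    unfolding supported[OF k\<omega>] B_def using bias_const by (simp only: mult.assoc)
  moreover have "f x0 * (LINT t:{-z..1}|lborel. (\<omega> t)\<^sup>2) = V"
    using supported[OF k\<omega>, of \<omega>] by (simp add: V_def power2_eq_square)
  moreover have "B = f x0 * D (Suc S) x0 * \<Xi> *
      (c_const (m z) (S + 1) z - Matrix.scalar_prod (c_vec S (m z) z) (b_vec S z (g z)))"
    by (simp add: B_def c_const cb)
  ultimately show ?thesis
    unfolding Let_def omega_fun fx \<beta>x Z_def [abs_def] by metis
qed

end
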